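(* Let $T\in\mathcal{K}(V)$ be bisectorial of angle $\omega\in(0,\frac{\pi}{2})$ and let $p,q$ be two intrinsic polynomials such that i) $\deg(q)\geq\deg(p)+1$, ii) $p$ has a zero at the origin, iii) $q$ does not have any zeros in $\overline{D_\omega}$. Then $q[T]$ is bijective (from $\operatorname{dom}(q[T])$ onto $V$), there exists some $\theta\in(\omega,\frac{\pi}{2})$ such that $\frac{p}{q}\in\mathcal{N}^0(D_\theta)$, and $$\Big(\frac{p}{q}\Big)(T)=p[T]q[T]^{-1},$$ where the left hand side is given by the $\omega$-functional calculus.
   Context: Clifford setting. Fix an integer $n\geq 1$. $\mathbb{R}_n$ is the real Clifford algebra generated by $e_1,\dots,e_n$ with $e_i^2=-1$, $e_ie_j=-e_je_i$ ($i\neq j$), with basis $e_A=e_{i_1}\cdots e_{i_r}$ for $A=(i_1<\dots<i_r)$, $e_\emptyset=1$, and $|s|^2=\sum_As_A^2$ for $s=\sum_As_Ae_A$. Paravectors: $\mathbb{R}^{n+1}=\{s_0+s_1e_1+\dots+s_ne_n\}\subseteq\mathbb{R}_n$ with $\overline{s}=s_0-s_1e_1-\dots-s_ne_n$. $\mathbb{S}=\{s\in\mathbb{R}^{n+1}: s_0=0,|s|=1\}$ and $\mathbb{C}_J=\{x+Jy: x,y\in\mathbb{R}\}$ for $J\in\mathbb{S}$. $U\subseteq\mathbb{R}^{n+1}$ is axially symmetric if $x+Jy\in U$ ($x,y\in\mathbb{R}$, $J\in\mathbb{S}$) implies $x+Iy\in U$ for all $I\in\mathbb{S}$. Slice hyperholomorphic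 functions. For $U$ open and axially symmetric, $f:U\to\mathbb{R}_n$ is left slice hyperholomorphic ($f\in\mathcal{SH}_L(U)$) if there are continuously differentiable $f_0,f_1:\{(x,y)\in\mathbb{R}^2: x+\mathbb{S}y\subseteq U\}\to\mathbb{R}_n$ with $f(x+Jy)=f_0(x,y)+Jf_1(x,y)$ for all $J\in\mathbb{S}$, $f_0(x,-y)=f_0(x,y)$, $f_1(x,-y)=-f_1(x,y)$, $\partial_xf_0=\partial_yf_1$, $\partial_yf_0=-\partial_xf_1$. If $f_0,f_1$ are real valued, $f$ is called intrinsic ($f\in\mathcal{N}(U)$). Operators. $V_\mathbb{R}$ is a real Banach space, $V=\{\sum_Av_A\otimes e_A: v_A\in V_\mathbb{R}\}$ the corresponding Clifford module with norm $\|v\|^2=\sum_A\|v_A\|^2$ and the natural left and right multiplications by $\mathbb{R}_n$. $\mathcal{B}(V)$: bounded everywhere defined right-linear operators; $\mathcal{K}(V)$: closed right-linear operators $T:\operatorname{dom}(T)\to V$ with right-linear domain $\operatorname{dom}(T)\subseteq V$. A Clifford number $a$ is identified with the operator $v\mapsto av$, so $(aT)v=a(Tv)$, $(Ta)v=T(av)$. For $s\in\mathbb{R}^{n+1}$, $Q_s[T]=T^2-2s_0T+|s|^2$ on $\operatorname{dom}(T^2)$; $\rho_S(T)=\{s\in\mathbb{R}^{n+1}: Q_s[T]^{-1}\in\mathcal{B}(V)\}$, $\sigma_S(T)=\mathbb{R}^{n+1}\setminus\rho_S(T)$, and $S_L^{-1}(s,T)=Q_s[T]^{-1}\overline{s}-TQ_s[T]^{-1}$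 for $s\in\rho_S(T)$. Bisectorial operators. For $\omega\in(0,\frac{\pi}{2})$, $I_\omega=(-\omega,\omega)\cup(\pi-\omega,\pi+\omega)$ and $D_\omega=\{re^{J\phi}: r>0,\,J\in\mathbb{S},\,\phi\in I_\omega\}\subseteq\mathbb{R}^{n+1}$ (so $0\in\overline{D_\omega}$). $T\in\mathcal{K}(V)$ is bisectorial of angle $\omega$ if $\sigma_S(T)\subseteq\overline{D_\omega}$ and for every $\varphi\in(\omega,\frac{\pi}{2})$ there is $C_\varphi\geq 0$ with $\|S_L^{-1}(s,T)\|\leq\frac{C_\varphi}{|s|}$ for all $s\in\mathbb{R}^{n+1}\setminus(D_\varphi\cup\{0\})$. $\omega$-functional calculus. $\mathcal{SH}_L^0(D_\theta)$ is the set of bounded $f\in\mathcal{SH}_L(D_\theta)$ with $\int_0^\infty|f(te^{J\phi})|\frac{dt}{t}<\infty$ for all $J\in\mathbb{S}$, $\phi\in I_\theta$; $\mathcal{N}^0(D_\theta)$ is the set of intrinsic such functions. For $T$ bisectorial of angle $\omega$, $\theta\in(\omega,\frac{\pi}{2})$ and $f\in\mathcal{SH}_L^0(D_\theta)$, $$f(T)=\frac{1}{2\pi}\int_{\partial D_\varphi\cap\mathbb{C}_J}S_L^{-1}(s,T)ds_Jf(s):=\frac{1}{2\pi}\sum_\pm\int_\mathbb{R}S_L^{-1}(\gamma_\pm(t),T)\frac{\gamma_\pm'(t)}{J}f(\gamma_\pm(t))dt\in\mathcal{B}(V),$$ with $\gamma_\pm(t)=\pm|t|e^{-\operatorname{sgn}(t)J\varphi}$;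 it does not depend on the choice of $\varphi\in(\omega,\theta)$ and $J\in\mathbb{S}$. Polynomials. An intrinsic polynomial of degree $m$ is $p(s)=p_0+p_1s+\dots+p_ms^m$ with real coefficients, $p_m\neq 0$, as a function of $s\in\mathbb{R}^{n+1}$; $p[T]=p_0+p_1T+\dots+p_mT^m$ with $\operatorname{dom}(p[T])=\operatorname{dom}(T^m)$. *)

theory Defs
  imports "HOL-Analysis.Analysis" "HOL-Computational_Algebra.Polynomial"
begin

section \<open>The real Clifford algebra\<close>

text \<open>
  The generators are indexed by a finite linear order \<open>'n\<close>, so that \<open>n = CARD('n) \<ge> 1\<close>.
  For \<open>A = {i\<^sub>1 < \<dots> < i\<^sub>r}\<close> the basis element \<open>e\<^sub>A = e\<^sub>i\<^sub>1 \<cdots> e\<^sub>i\<^sub>r\<close> is the unit vector at the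
  index \<open>A :: 'n set\<close>, and likewise an element \<open>\<Sum>\<^sub>A v\<^sub>A \<otimes> e\<^sub>A\<close> of the Clifford module is the vector
  with components \<open>v\<^sub>A\<close> in \<open>'v ^ 'n set\<close>, whose library norm is \<open>(\<Sum>\<^sub>A \<parallel>v\<^sub>A\<parallel>\<^sup>2)\<^sup>1\<^sup>/\<^sup>2\<close>.
  Reordering the product \<open>e\<^sub>A e\<^sub>B\<close> costs one sign for each pair \<open>j < i\<close> and one for each \<open>i = j\<close>,
  where \<open>i \<in> A\<close> and \<open>j \<in> B\<close>.
\<close>

definition csign :: "'n::linorder set \<Rightarrow> 'n set \<Rightarrow> real" where
  "csign A B = (\<Prod>i\<in>A. \<Prod>j\<in>B. if j \<le> i then -1 else 1)"

definition vec_lmul ::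
  "real ^ ('n::{finite,linorder} set) \<Rightarrow> 'v::real_vector ^ 'n set \<Rightarrow> 'v ^ 'n set" where
  "vec_lmul a v =
     (\<Sum>A\<in>UNIV. \<Sum>B\<in>UNIV. axis (sym_diff A B) ((csign A B * (a $ A)) *\<^sub>R (v $ B)))"

definition vec_rmul ::
  "'v::real_vector ^ ('n::{finite,linorder} set) \<Rightarrow> real ^ 'n set \<Rightarrow> 'v ^ 'n set" where
  "vec_rmul v a =
     (\<Sum>B\<in>UNIV. \<Sum>A\<in>UNIV. axis (sym_diff B A) ((csign B A * (a $ A)) *\<^sub>R (v $ B)))"

lemma prod_sym_diff:
  fixes g :: "'n::finite \<Rightarrow> real"
  assumes "\<And>i. g i * g i = 1"
  shows "prod g (sym_diff A B) = prod g A * prod g B"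
proof -
  have *: "prod g (A \<inter> B) * prod g (A \<inter> B) = 1"
    using assms by (simp flip: prod.distrib)
  have A: "prod g A = prod g (A - B) * prod g (A \<inter> B)"
    using prod.Int_Diff[of A g B] by simp
  have B: "prod g B = prod g (B - A) * prod g (A \<inter> B)"
    using prod.Int_Diff[of B g A] by (simp add: Int_commute)
  have "prod g (sym_diff A B) = prod g (A - B) * prod g (B - A)"
    by (rule prod.union_disjoint) auto
  then show ?thesis
    unfolding A B using * by (simp add: algebra_simps)
qed

lemma prod_sign_square:
  fixes P :: "'a \<Rightarrow> bool"
  shows "(\<Prod>j\<in>B. if P j then -1 else 1::real) * (\<Prod>j\<in>B. if P j then -1 else 1) = 1"
  by (simp flip: prod.distrib) (rule prod.neutral, auto)

lemma csign_sym_diff_left: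
  "csign (sym_diff A B) (C :: 'n::{finite,linorder} set) = csign A C * csign B C"
  unfolding csign_def by (rule prod_sym_diff) (rule prod_sign_square)

lemma csign_sym_diff_right:
  "csign (C :: 'n::{finite,linorder} set) (sym_diff A B) = csign C A * csign C B"
proof -
  have "csign C D = (\<Prod>j\<in>D. \<Prod>i\<in>C. if j \<le> i then -1 else 1)" for D
    unfolding csign_def by (rule prod.swap)
  then show ?thesis
    by (simp add: prod_sym_diff[OF prod_sign_square])
qed

lemma csign_square: "csign A B * csign A B = 1"
  unfolding csign_def by (simp flip: prod.distrib) (intro prod.neutral ballI, auto)

lemma csign_empty [simp]: "csign {} B = 1" "csign A {} = 1"
  by (simp_all add: csign_def)

lemma sym_diff_eq_iff: "C = sym_diff A B \<longleftrightarrow> B = sym_diff A C"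
  by blast

lemma vec_lmul_nth:
  "vec_lmul a v $ C = (\<Sum>A\<in>UNIV. (csign A (sym_diff A C) * a $ A) *\<^sub>R v $ sym_diff A C)"
proof -
  have "(\<Sum>B\<in>UNIV. axis (sym_diff A B) ((csign A B * a $ A) *\<^sub>R v $ B) $ C)
      = (csign A (sym_diff A C) * a $ A) *\<^sub>R v $ sym_diff A C" for A
    by (simp only: axis_def vec_lambda_beta sym_diff_eq_iff[of C A]) simp
  then show ?thesis
    by (simp add: vec_lmul_def sum_component)
qed

lemma bij_sym_diff: "bij (sym_diff A)"
  by (rule involuntory_imp_bij) blast

lemma sum_sym_diff: "(\<Sum>B\<in>UNIV. g (sym_diff A B)) = (\<Sum>B\<in>UNIV. g (B :: 'n::finite set))"
  using sum.reindex_bij_betw[OF bij_sym_diff] .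

lemma vec_lmul_assoc:
  fixes v :: "'v::real_vector ^ ('n::{finite,linorder} set)"
  shows "vec_lmul (vec_lmul a b) v = vec_lmul a (vec_lmul b v)"
proof (rule vec_eq_iff[THEN iffD2], rule allI)
  fix C :: "'n set"
  have "vec_lmul (vec_lmul a b) v $ C =
      (\<Sum>D\<in>UNIV. \<Sum>A\<in>UNIV. (csign D (sym_diff D C) * (csign A (sym_diff A D) * a $ A * b $ sym_diff A D))
        *\<^sub>R v $ sym_diff D C)"
    by (simp add: vec_lmul_nth sum_distrib_left scaleR_sum_left mult.assoc)
  also have "\<dots> = (\<Sum>A\<in>UNIV. \<Sum>D\<in>UNIV.
      (csign D (sym_diff D C) * (csign A (sym_diff A D) * a $ A * b $ sym_diff A D)) *\<^sub>R v $ sym_diff D C)"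
    by (rule sum.swap)
  also have "\<dots> = (\<Sum>A\<in>UNIV. \<Sum>B\<in>UNIV.
      (csign (sym_diff A B) (sym_diff (sym_diff A B) C) * (csign A (sym_diff A (sym_diff A B)) * a $ A
        * b $ sym_diff A (sym_diff A B))) *\<^sub>R v $ sym_diff (sym_diff A B) C)"
    by (rule sum.cong[OF refl], rule sum_sym_diff[symmetric])
  also have "\<dots> = (\<Sum>A\<in>UNIV. \<Sum>B\<in>UNIV.
      (csign A (sym_diff A C) * a $ A) *\<^sub>R (csign B (sym_diff B (sym_diff A C)) * b $ B) *\<^sub>R v $ sym_diff B (sym_diff A C))"
  proof (intro sum.cong refl)
    fix A B :: "'n set"
    have 1: "sym_diff A (sym_diff A B) = B" and 2: "sym_diff (sym_diff A B) C = sym_diff B (sym_diff A C)"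
      by blast+
    have *: "x * y * z * x = y * z" if "x * x = 1" for x y z :: real
      using that by algebra
    have **: "x * (y * r * t) = (z * r) * (w * t)" if "x * y = z * w" for x y z w r t :: real
      using that by algebra
    have "csign (sym_diff A B) (sym_diff B (sym_diff A C)) * csign A B
        = csign A B * csign A (sym_diff A C) * csign B (sym_diff B (sym_diff A C)) * csign A B"
      by (simp only: csign_sym_diff_left[of A B] csign_sym_diff_right[of A B])
    also have "\<dots> = csign A (sym_diff A C) * csign B (sym_diff B (sym_diff A C))"
      by (rule *) (rule csign_square)
    finally have "csign (sym_diff A B) (sym_diff B (sym_diff A C)) * (csign A B * a $ A * b $ B)
        = (csign A (sym_diff A C) * a $ A) * (csign B (sym_diff B (sym_diff A C)) * b $ B)"
      by (rule **)
    then show "(csign (sym_diff A B) (sym_diff (sym_diff A B) C) * (csign A (sym_diff A (sym_diff A B)) * a $ A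
          * b $ sym_diff A (sym_diff A B))) *\<^sub>R v $ sym_diff (sym_diff A B) C
        = (csign A (sym_diff A C) * a $ A) *\<^sub>R (csign B (sym_diff B (sym_diff A C)) * b $ B) *\<^sub>R v $ sym_diff B (sym_diff A C)"
      unfolding 1 2 scaleR_scaleR by (rule arg_cong)
  qed
  also have "\<dots> = vec_lmul a (vec_lmul b v) $ C"
    by (simp add: vec_lmul_nth scaleR_sum_right)
  finally show "vec_lmul (vec_lmul a b) v $ C = vec_lmul a (vec_lmul b v) $ C" .
qed

lemma vec_lmul_linear:
  "vec_lmul (a + b) v = vec_lmul a v + vec_lmul b v"
  "vec_lmul a (v + w) = vec_lmul a v + vec_lmul a w"
  "vec_lmul (r *\<^sub>R a) v = r *\<^sub>R vec_lmul a v"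
  "vec_lmul a (r *\<^sub>R v) = r *\<^sub>R vec_lmul a v"
  by (simp_all add: vec_eq_iff vec_lmul_nth algebra_simps sum.distrib scaleR_sum_right)

lemma vec_lmul_axis: "vec_lmul (axis A x) v $ C = (csign A (sym_diff A C) * x) *\<^sub>R v $ sym_diff A C"
proof -
  have "(csign B (sym_diff B C) * axis A x $ B) *\<^sub>R v $ sym_diff B C
    = (if B = A then (csign A (sym_diff A C) * x) *\<^sub>R v $ sym_diff A C else 0)" for B
    by (simp add: axis_def)
  then show ?thesis by (simp add: vec_lmul_nth)
qed

lemma vec_lmul_one_left: "vec_lmul (axis {} 1) v = v"
  by (simp add: vec_eq_iff vec_lmul_axis)

lemma vec_lmul_axis_axis:
  "vec_lmul (axis A x) (axis B y) = axis (sym_diff A B) ((csign A B * x) *\<^sub>R y)"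
  unfolding vec_eq_iff vec_lmul_axis
proof (rule allI)
  fix C
  show "(csign A (sym_diff A C) * x) *\<^sub>R axis B y $ sym_diff A C = axis (sym_diff A B) ((csign A B * x) *\<^sub>R y) $ C"
  proof (cases "C = sym_diff A B")
    case True
    then have *: "sym_diff A C = B" by blast
    show ?thesis unfolding * unfolding True axis_nth ..
  next
    case False
    then have "sym_diff A C \<noteq> B" by blast
    with False show ?thesis
      by (simp only: axis_def vec_lambda_beta if_False scaleR_zero_right)
  qed
qed

lemma vec_lmul_one_right: "vec_lmul a (axis {} 1) = (a :: real ^ ('n::{finite,linorder} set))"
proof (rule vec_eq_iff[THEN iffD2], rule allI)
  fix C
  have "(csign A (sym_diff A C) * a $ A) *\<^sub>R axis {} (1::real) $ sym_diff A C = (if A = C then a $ C else 0)" for A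
  proof (cases "A = C")
    case False
    then have "sym_diff A C \<noteq> {}" by blast
    with False show ?thesis by (simp only: axis_def vec_lambda_beta) simp
  qed (simp add: axis_def)
  then show "vec_lmul a (axis {} 1) $ C = a $ C"
    by (simp add: vec_lmul_nth)
qed

typedef (overloaded) 'n clifford = "UNIV :: (real ^ ('n::finite set)) set"
  morphisms coords of_coords ..

setup_lifting type_definition_clifford

instantiation clifford :: (finite) real_normed_vector
begin

lift_definition zero_clifford :: "'a clifford" is 0 .
lift_definition plus_clifford :: "'a clifford \<Rightarrow> 'a clifford \<Rightarrow> 'a clifford" is "(+)" .
lift_definition minus_clifford :: "'a clifford \<Rightarrow> 'a clifford \<Rightarrow> 'a clifford" is "(-)" .
lift_definition uminus_clifford :: "'a clifford \<Rightarrow> 'a clifford" is uminus .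
lift_definition scaleR_clifford :: "real \<Rightarrow> 'a clifford \<Rightarrow> 'a clifford" is scaleR .
lift_definition norm_clifford :: "'a clifford \<Rightarrow> real" is norm .
lift_definition dist_clifford :: "'a clifford \<Rightarrow> 'a clifford \<Rightarrow> real" is dist .
lift_definition sgn_clifford :: "'a clifford \<Rightarrow> 'a clifford" is sgn .

definition uniformity_clifford :: "('a clifford \<times> 'a clifford) filter" where
  "uniformity_clifford = (INF e\<in>{0<..}. principal {(x, y). dist x y < e})"

definition open_clifford :: "'a clifford set \<Rightarrow> bool" where
  "open_clifford U \<longleftrightarrow> (\<forall>x\<in>U. \<forall>\<^sub>F (x', y) in uniformity. x' = x \<longrightarrow> y \<in> U)"

instance
proof
  show "dist x y = norm (x - y)" for x y :: "'a clifford"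
    by transfer (rule dist_norm)
  show "sgn x = inverse (norm x) *\<^sub>R x" for x :: "'a clifford"
    by transfer (rule sgn_div_norm)
  show "norm (x + y) \<le> norm x + norm y" for x y :: "'a clifford"
    by transfer (rule norm_triangle_ineq)
  show "a *\<^sub>R (x + y) = a *\<^sub>R x + a *\<^sub>R y" for a and x y :: "'a clifford"
    by transfer (rule scaleR_add_right)
  show "(a + b) *\<^sub>R x = a *\<^sub>R x + b *\<^sub>R x" for a b and x :: "'a clifford"
    by transfer (rule scaleR_add_left)
qed (simp_all only: uniformity_clifford_def open_clifford_def, (transfer, simp)+)

end

instantiation clifford :: ("{finite,linorder}") real_algebra_1
begin

lift_definition one_clifford :: "'a clifford" is "axis {} 1" .
lift_definition times_clifford :: "'a clifford \<Rightarrow> 'a clifford \<Rightarrow> 'a clifford" is vec_lmul .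

instance
proof
  fix a b c :: "'a clifford" and r :: real
  show "a * b * c = a * (b * c)" by transfer (rule vec_lmul_assoc)
  show "1 * a = a" by transfer (rule vec_lmul_one_left)
  show "a * 1 = a" by transfer (rule vec_lmul_one_right)
  show "(a + b) * c = a * c + b * c" by transfer (rule vec_lmul_linear)
  show "a * (b + c) = a * b + a * c" by transfer (rule vec_lmul_linear)
  show "r *\<^sub>R a * b = r *\<^sub>R (a * b)" by transfer (rule vec_lmul_linear)
  show "a * r *\<^sub>R b = r *\<^sub>R (a * b)" by transfer (rule vec_lmul_linear)
  show "(0::'a clifford) \<noteq> 1" by transfer (simp add: axis_eq_axis)
qed
end

definition cl_basis :: "'n::{finite,linorder} set \<Rightarrow> 'n clifford" where
  "cl_basis A = of_coords (axis A 1)"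

definition gen :: "'n::{finite,linorder} \<Rightarrow> 'n clifford" where
  "gen i = cl_basis {i}"

definition lmul ::
  "'n::{finite,linorder} clifford \<Rightarrow> 'v::real_vector ^ 'n set \<Rightarrow> 'v ^ 'n set" where
  "lmul a v = vec_lmul (coords a) v"

definition rmul ::
  "'v::real_vector ^ 'n::{finite,linorder} set \<Rightarrow> 'n clifford \<Rightarrow> 'v ^ 'n set" where
  "rmul v a = vec_rmul v (coords a)"

lemma norm_clifford_eq: "(norm s)\<^sup>2 = (\<Sum>A\<in>UNIV. (coords s $ A)\<^sup>2)"
  by transfer (simp add: norm_vec_def L2_set_def sum_nonneg)

lemma cl_basis_mult: "cl_basis A * cl_basis B = csign A B *\<^sub>R cl_basis (sym_diff A B)"
  unfolding cl_basis_def
  by (rule coords_inject[THEN iffD1])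
     (simp add: times_clifford.rep_eq scaleR_clifford.rep_eq of_coords_inverse vec_lmul_axis_axis,
       simp add: axis_def vec_eq_iff)

lemma cl_basis_empty: "cl_basis {} = 1"
  by (simp add: cl_basis_def one_clifford_def)

lemma gen_square: "gen i * gen i = - 1"
  by (simp add: gen_def cl_basis_mult cl_basis_empty csign_def)

lemma gen_anticommute: "i \<noteq> j \<Longrightarrow> gen i * gen j = - (gen j * gen i)"
  by (auto simp: gen_def cl_basis_mult csign_def Un_commute)

lemma cl_basis_prod_list:
  "cl_basis A = prod_list (map gen (sorted_list_of_set (A :: 'n::{finite,linorder} set)))"
  using finite[of A]
proof (induction rule: finite_linorder_min_induct)
  case (insert a A)
  have "csign {a} A = 1"
    using insert.hyps by (auto simp: csign_def intro!: prod.neutral)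
  moreover have "sym_diff {a} A = insert a A"
    using insert.hyps by auto
  ultimately have "cl_basis (insert a A) = gen a * cl_basis A"
    by (simp add: gen_def cl_basis_mult)
  moreover have "sorted_list_of_set (insert a A) = a # sorted_list_of_set A"
    using insert.hyps 
    by (subst sorted_list_of_set_insert) (auto intro!: insort_is_Cons less_imp_le)
  ultimately show ?case
    using insert.IH by simp
qed (simp add: cl_basis_empty)


section \<open>Paravectors, axial symmetry and double sectors\<close>

definition paravectors :: "'n::{finite,linorder} clifford set" where
  "paravectors = {of_real x + (\<Sum>i\<in>UNIV. y i *\<^sub>R gen i) | x y. True}"

definition real_part :: "'n::finite clifford \<Rightarrow> real" where
  "real_part s = coords s $ {}"

definition pconj :: "'n::{finite,linorder} clifford \<Rightarrow> 'n clifford" where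
  "pconj s = of_real (real_part s) - (\<Sum>i\<in>UNIV. (coords s $ {i}) *\<^sub>R gen i)"

definition pinv :: "'n::{finite,linorder} clifford \<Rightarrow> 'n clifford" where
  "pinv s = (1 / (norm s)\<^sup>2) *\<^sub>R pconj s"

definition sphere_units :: "'n::{finite,linorder} clifford set" where
  "sphere_units = {s \<in> paravectors. real_part s = 0 \<and> norm s = 1}"

lemma vector_square:
  "(\<Sum>i\<in>UNIV. y i *\<^sub>R gen i) * (\<Sum>i\<in>UNIV. y i *\<^sub>R gen i)
   = - of_real (\<Sum>i\<in>UNIV. (y i)\<^sup>2)" (is "?v * ?v = _")
proof -
  have vv: "?v * ?v = (\<Sum>i\<in>UNIV. \<Sum>j\<in>UNIV. (y i * y j) *\<^sub>R (gen i * gen j))"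
    by (simp add: sum_product mult.commute)
  also have "\<dots> = (\<Sum>i\<in>UNIV. \<Sum>j\<in>UNIV. (y i * y j) *\<^sub>R (gen j * gen i))"
    by (rule sum.swap[THEN trans]) (intro sum.cong refl, simp add: mult.commute)
  finally have "2 *\<^sub>R (?v * ?v)
      = (\<Sum>i\<in>UNIV. \<Sum>j\<in>UNIV. (y i * y j) *\<^sub>R (gen i * gen j + gen j * gen i))"
    using vv by (simp add: scaleR_2 scaleR_add_right sum.distrib)
  also have "\<dots> = (\<Sum>i\<in>UNIV. \<Sum>j\<in>UNIV. if j = i then - (2 * (y i)\<^sup>2) *\<^sub>R 1 else 0)"
  proof (intro sum.cong refl)
    fix i j :: 'a
    show "(y i * y j) *\<^sub>R (gen i * gen j + gen j * gen i) = (if j = i then - (2 * (y i)\<^sup>2) *\<^sub>R 1 else 0)"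
    proof (cases "j = i")
      case True
      then show ?thesis
        by (simp add: gen_square power2_eq_square flip: scaleR_2)
    next
      case False
      then show ?thesis
        using gen_anticommute[of i j] by simp
    qed
  qed
  also have "\<dots> = 2 *\<^sub>R (- of_real (\<Sum>i\<in>UNIV. (y i)\<^sup>2))"
    by (simp add: of_real_def scaleR_sum_left scaleR_sum_right sum_negf mult.commute)
  finally show ?thesis
    by (rule scaleR_left_imp_eq[rotated]) simp
qed

lemma coords_sum: "coords (sum f I) $ A = (\<Sum>i\<in>I. coords (f i) $ A)"
  by (induction I rule: infinite_finite_induct) (simp_all add: zero_clifford.rep_eq plus_clifford.rep_eq)

lemma coords_paravector:
  fixes x :: real and y :: "'n::{finite,linorder} \<Rightarrow> real"
  defines "s \<equiv> of_real x + (\<Sum>i\<in>UNIV. y i *\<^sub>R gen i)"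
  shows "coords s $ {} = x" "coords s $ {i} = y i" "A \<noteq> {} \<Longrightarrow> A \<notin> range (\<lambda>i. {i}) \<Longrightarrow> coords s $ A = 0"
proof -
  have "coords s $ A = (if A = {} then x else 0) + (\<Sum>i\<in>UNIV. if A = {i} then y i else 0)" for A
    unfolding s_def gen_def cl_basis_def
    by (simp add: plus_clifford.rep_eq coords_sum scaleR_clifford.rep_eq of_coords_inverse axis_def
        of_real_def one_clifford.rep_eq if_distrib cong: if_cong)
  then show "coords s $ {} = x" "coords s $ {i} = y i"
      "A \<noteq> {} \<Longrightarrow> A \<notin> range (\<lambda>i. {i}) \<Longrightarrow> coords s $ A = 0"
    by (auto intro!: sum.neutral split: if_splits)
qed

lemma norm_paravector:
  fixes y :: "'n::{finite,linorder} \<Rightarrow> real"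
  shows "(norm (of_real x + (\<Sum>i\<in>UNIV. y i *\<^sub>R gen i)))\<^sup>2 = x\<^sup>2 + (\<Sum>i\<in>UNIV. (y i)\<^sup>2)"
proof -
  let ?s = "of_real x + (\<Sum>i\<in>UNIV. y i *\<^sub>R gen i)"
  have "(norm ?s)\<^sup>2 = (\<Sum>A\<in>insert {} (range (\<lambda>i. {i})). (coords ?s $ A)\<^sup>2)"
    unfolding norm_clifford_eq by (rule sum.mono_neutral_right) (use coords_paravector(3)[of _ x y] in auto)
  also have "\<dots> = x\<^sup>2 + (\<Sum>A\<in>range (\<lambda>i. {i}). (coords ?s $ A)\<^sup>2)"
    by (subst sum.insert) (auto simp: coords_paravector)
  also have "(\<Sum>A\<in>range (\<lambda>i. {i}). (coords ?s $ A)\<^sup>2) = (\<Sum>i\<in>UNIV. (y i)\<^sup>2)"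
    by (subst sum.reindex) (auto simp: coords_paravector)
  finally show ?thesis .
qed

lemma pinv_inverse:
  assumes "s \<in> paravectors" "s \<noteq> 0"
  shows "s * pinv s = 1" "pinv s * s = 1"
proof -
  obtain x y where s: "s = of_real x + (\<Sum>i\<in>UNIV. y i *\<^sub>R gen i)"
    using assms by (auto simp: paravectors_def)
  define v :: "'a clifford" where "v = (\<Sum>i\<in>UNIV. y i *\<^sub>R gen i)"
  have conj: "pconj s = of_real x - v"
    unfolding pconj_def real_part_def s coords_paravector v_def ..
  have "s = of_real x + v"
    by (simp add: s v_def)
  then have "s * pconj s = of_real (x\<^sup>2) - v * v" "pconj s * s = of_real (x\<^sup>2) - v * v"
    unfolding conj by (simp_all add: algebra_simps power2_eq_square of_real_def)
  moreover have "of_real (x\<^sup>2) - v * v = of_real ((norm s)\<^sup>2)"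
    unfolding s norm_paravector v_def vector_square by simp
  ultimately show "s * pinv s = 1" "pinv s * s = 1"
    using assms(2) by (simp_all add: pinv_def of_real_def)
qed

text \<open>\<open>cexp J \<phi>\<close> is \<open>e\<^sup>J\<^sup>\<phi>\<close> for \<open>J \<in> \<S>\<close>, where \<open>J\<^sup>2 = - 1\<close>.\<close>

definition cexp :: "'n::{finite,linorder} clifford \<Rightarrow> real \<Rightarrow> 'n clifford" where
  "cexp J \<phi> = of_real (cos \<phi>) + sin \<phi> *\<^sub>R J"

definition axially_symmetric :: "'n::{finite,linorder} clifford set \<Rightarrow> bool" where
  "axially_symmetric U \<longleftrightarrow>
     (\<forall>x y. \<forall>J\<in>sphere_units. of_real x + y *\<^sub>R J \<in> U \<longrightarrow> (\<forall>I\<in>sphere_units. of_real x + y *\<^sub>R I \<in> U))"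

definition angles :: "real \<Rightarrow> real set" where
  "angles \<omega> = {-\<omega><..<\<omega>} \<union> {pi - \<omega><..<pi + \<omega>}"

definition double_sector :: "real \<Rightarrow> 'n::{finite,linorder} clifford set" where
  "double_sector \<omega> = {r *\<^sub>R cexp J \<phi> | r J \<phi>. r > 0 \<and> J \<in> sphere_units \<and> \<phi> \<in> angles \<omega>}"


section \<open>Slice hyperholomorphic functions\<close>

definition slice_domain :: "'n::{finite,linorder} clifford set \<Rightarrow> (real \<times> real) set" where
  "slice_domain U = {(x, y). \<forall>J\<in>sphere_units. of_real x + y *\<^sub>R J \<in> U}"

text \<open>
  \<open>F0\<close> and \<open>F1\<close> are the total derivatives of \<open>f0\<close> and \<open>f1\<close>; their values at \<open>(1, 0)\<close> and \<open>(0, 1)\<close>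
  are the partial derivatives.
\<close>

definition slice_decomposition ::
  "'n::{finite,linorder} clifford set \<Rightarrow> ('n clifford \<Rightarrow> 'n clifford) \<Rightarrow>
     (real \<times> real \<Rightarrow> 'n clifford) \<Rightarrow> (real \<times> real \<Rightarrow> 'n clifford) \<Rightarrow> bool" where
  "slice_decomposition U f f0 f1 \<longleftrightarrow>
     (\<forall>(x, y)\<in>slice_domain U.
        (\<forall>J\<in>sphere_units. f (of_real x + y *\<^sub>R J) = f0 (x, y) + J * f1 (x, y)) \<and>
        f0 (x, - y) = f0 (x, y) \<and> f1 (x, - y) = - f1 (x, y)) \<and>
     (\<exists>F0 F1. continuous_on (slice_domain U) F0 \<and> continuous_on (slice_domain U) F1 \<and>
        (\<forall>z\<in>slice_domain U.
           (f0 has_derivative blinfun_apply (F0 z)) (at z) \<and>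
           (f1 has_derivative blinfun_apply (F1 z)) (at z) \<and>
           F0 z (1, 0) = F1 z (0, 1) \<and> F0 z (0, 1) = - F1 z (1, 0)))"

definition slice_hyperholomorphic ::
  "'n::{finite,linorder} clifford set \<Rightarrow> ('n clifford \<Rightarrow> 'n clifford) set" where
  "slice_hyperholomorphic U =
     {f. openin (top_of_set paravectors) U \<and> axially_symmetric U \<and>
         (\<exists>f0 f1. slice_decomposition U f f0 f1)}"

definition intrinsic ::
  "'n::{finite,linorder} clifford set \<Rightarrow> ('n clifford \<Rightarrow> 'n clifford) set" where
  "intrinsic U =
     {f. openin (top_of_set paravectors) U \<and> axially_symmetric U \<and>
         (\<exists>f0 f1. slice_decomposition U f f0 f1 \<and> (\<forall>z\<in>slice_domain U. f0 z \<in> \<real> \<and> f1 z \<in> \<real>))}"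

definition SH0 :: "real \<Rightarrow> ('n::{finite,linorder} clifford \<Rightarrow> 'n clifford) set" where
  "SH0 \<theta> =
     {f \<in> slice_hyperholomorphic (double_sector \<theta>).
        bounded (f ` double_sector \<theta>) \<and>
        (\<forall>J\<in>sphere_units. \<forall>\<phi>\<in>angles \<theta>.
           set_integrable lborel {0<..} (\<lambda>t. norm (f (t *\<^sub>R cexp J \<phi>)) / t))}"

definition N0 :: "real \<Rightarrow> ('n::{finite,linorder} clifford \<Rightarrow> 'n clifford) set" where
  "N0 \<theta> = SH0 \<theta> \<inter> intrinsic (double_sector \<theta>)"


section \<open>Operators on the Clifford module\<close>

text \<open>
  An operator \<open>T : dom(T) \<rightarrow> V\<close> is a partial function, so that equality of operators includes equality
  of domains, and \<open>\<circ>\<^sub>m\<close> is composition with its natural domain.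
\<close>

type_synonym ('v, 'n) op = "'v ^ 'n set \<rightharpoonup> 'v ^ 'n set"

definition right_linear :: "('v::real_normed_vector, 'n::{finite,linorder}) op \<Rightarrow> bool" where
  "right_linear T \<longleftrightarrow> 0 \<in> dom T \<and>
     (\<forall>u\<in>dom T. \<forall>v\<in>dom T. T (u + v) = Some (the (T u) + the (T v))) \<and>
     (\<forall>u\<in>dom T. \<forall>a. T (rmul u a) = Some (rmul (the (T u)) a))"

definition closed_ops :: "('v::banach, 'n::{finite,linorder}) op set" where
  "closed_ops = {T. right_linear T \<and> closed (Map.graph T)}"

definition bounded_ops :: "('v::banach, 'n::{finite,linorder}) op set" where
  "bounded_ops = {T. right_linear T \<and> (\<exists>B. bounded_linear B \<and> T = Some \<circ> B)}"

definition op_inv :: "('v, 'n::finite) op \<Rightarrow> ('v, 'n) op" where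
  "op_inv T y = (if y \<in> ran T then Some (THE x. T x = Some y) else None)"

definition op_pow :: "('v, 'n::finite) op \<Rightarrow> nat \<Rightarrow> ('v, 'n) op" where
  "op_pow T k = (((\<circ>\<^sub>m) T) ^^ k) Some"

definition op_poly :: "real poly \<Rightarrow> ('v::real_normed_vector, 'n::{finite,linorder}) op \<Rightarrow> ('v, 'n) op" where
  "op_poly p T v =
     (if v \<in> dom (op_pow T (degree p))
      then Some (\<Sum>k\<le>degree p. coeff p k *\<^sub>R the (op_pow T k v)) else None)"

definition Q_op ::
  "'n::{finite,linorder} clifford \<Rightarrow> ('v::real_normed_vector, 'n) op \<Rightarrow> ('v, 'n) op" where
  "Q_op s T = op_poly [:(norm s)\<^sup>2, - 2 * real_part s, 1:] T"

definition S_resolvent_set ::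
  "('v::banach, 'n::{finite,linorder}) op \<Rightarrow> 'n clifford set" where
  "S_resolvent_set T =
     {s \<in> paravectors. inj_on (Q_op s T) (dom (Q_op s T)) \<and> op_inv (Q_op s T) \<in> bounded_ops}"

definition S_spectrum :: "('v::banach, 'n::{finite,linorder}) op \<Rightarrow> 'n clifford set" where
  "S_spectrum T = paravectors - S_resolvent_set T"

text \<open>Only meaningful for \<open>s\<close> in the S-resolvent set, where both inner operators are everywhere defined.\<close>

definition left_S_resolvent ::
  "'n::{finite,linorder} clifford \<Rightarrow> ('v::banach, 'n) op \<Rightarrow> 'v ^ 'n set \<Rightarrow> 'v ^ 'n set" where
  "left_S_resolvent s T v =
     the (op_inv (Q_op s T) (lmul (pconj s) v)) - the ((T \<circ>\<^sub>m op_inv (Q_op s T)) v)"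

text \<open>The bound \<open>\<parallel>A\<parallel> \<le> c\<close> on the operator norm is written out as \<open>\<parallel>A v\<parallel> \<le> c \<parallel>v\<parallel>\<close> for all \<open>v\<close>.\<close>

definition bisectorial :: "real \<Rightarrow> ('v::banach, 'n::{finite,linorder}) op \<Rightarrow> bool" where
  "bisectorial \<omega> T \<longleftrightarrow> S_spectrum T \<subseteq> closure (double_sector \<omega>) \<and>
     (\<forall>\<phi>\<in>{\<omega><..<pi/2}. \<exists>C\<ge>0. \<forall>s\<in>paravectors - (double_sector \<phi> \<union> {0}). \<forall>v.
        norm (left_S_resolvent s T v) \<le> C / norm s * norm v)"


section \<open>The \<open>\<omega>\<close>-functional calculus\<close>

definition path_pm :: "real \<Rightarrow> 'n::{finite,linorder} clifford \<Rightarrow> real \<Rightarrow> real \<Rightarrow> 'n clifford" where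
  "path_pm \<epsilon> J \<phi> t = (\<epsilon> * \<bar>t\<bar>) *\<^sub>R cexp J (- sgn t * \<phi>)"

definition calculus_integrand ::
  "('v::banach, 'n::{finite,linorder}) op \<Rightarrow> ('n clifford \<Rightarrow> 'n clifford) \<Rightarrow> 'n clifford \<Rightarrow> real \<Rightarrow>
     real \<Rightarrow> real \<Rightarrow> ('v ^ 'n set) \<Rightarrow>\<^sub>L ('v ^ 'n set)" where
  "calculus_integrand T f J \<phi> \<epsilon> t =
     Blinfun (\<lambda>v. left_S_resolvent (path_pm \<epsilon> J \<phi> t) T
       (lmul (vector_derivative (path_pm \<epsilon> J \<phi>) (at t) * pinv J * f (path_pm \<epsilon> J \<phi> t)) v))"

text \<open>
  The Bochner integral of the library needs a second countable codomain, which the space of bounded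
  operators is not. We therefore use the gauge integral of a function that is integrable together
  with its norm, which for the functions in question (continuous away from \<open>t = 0\<close>) is the Bochner
  integral with respect to the operator norm.
\<close>

definition calculus_convergent ::
  "('v::banach, 'n::{finite,linorder}) op \<Rightarrow> ('n clifford \<Rightarrow> 'n clifford) \<Rightarrow> 'n clifford \<Rightarrow> real \<Rightarrow> bool"
  where "calculus_convergent T f J \<phi> \<longleftrightarrow>
     (\<forall>\<epsilon>\<in>{1, -1}. calculus_integrand T f J \<phi> \<epsilon> integrable_on UNIV \<and>
        (\<lambda>t. norm (calculus_integrand T f J \<phi> \<epsilon> t)) integrable_on UNIV)"

definition calculus ::
  "('v::banach, 'n::{finite,linorder}) op \<Rightarrow> ('n clifford \<Rightarrow> 'n clifford) \<Rightarrow> 'n clifford \<Rightarrow> real \<Rightarrow>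
     ('v, 'n) op" where
  "calculus T f J \<phi> = Some \<circ> blinfun_apply
     ((1 / (2 * pi)) *\<^sub>R (\<Sum>\<epsilon>\<in>{1, -1}. integral UNIV (calculus_integrand T f J \<phi> \<epsilon>)))"


section \<open>Intrinsic polynomials\<close>

definition cl_poly :: "real poly \<Rightarrow> 'n::{finite,linorder} clifford \<Rightarrow> 'n clifford" where
  "cl_poly p s = (\<Sum>k\<le>degree p. coeff p k *\<^sub>R s ^ k)"

text \<open>\<open>pinv\<close> is the inverse in \<open>\<real>\<^sub>n\<close> here, as \<open>cl_poly q\<close> maps paravectors to paravectors.\<close>

definition cl_quotient :: "real poly \<Rightarrow> real poly \<Rightarrow> 'n::{finite,linorder} clifford \<Rightarrow> 'n clifford" where
  "cl_quotient p q s = cl_poly p s * pinv (cl_poly q s)"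

end

theory Submission
  imports Defs "HOL-Computational_Algebra.Fundamental_Theorem_Algebra"
begin

text \<open>
  A point \<open>s = x + J y\<close> is identified with \<open>z = x + \<i> y\<close>. On the complexification of the real
  space \<open>V\<close> the resolvent of \<open>T\<close> is \<open>R(z) = (cnj z - T) Q\<^sub>z[T]\<^sup>-\<^sup>1\<close>. Since \<open>f = p/q\<close> has real
  coefficients, conjugate points of a path combine, all terms with left multiplication by \<open>J\<close> cancel,
  and \<open>\<pi> f(T)\<close> is the integral over \<open>r > 0\<close> of the difference of \<open>Im (e\<^sup>i\<^sup>\<theta> f(z) R(z))\<close>,
  \<open>z = r e\<^sup>i\<^sup>\<theta>\<close>, between \<open>\<theta> = \<pi> - \<phi>\<close> and \<open>\<theta> = \<phi>\<close>. Only bounded operators of \<open>V\<close> appear here.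

  As \<open>q\<close> has no real zeros, it is a product of quadratic factors \<open>Q\<^sub>z\<close> with \<open>z\<close> in the resolvent
  set, so \<open>q[T]\<close> is bijective and every \<open>B\<^sub>j = T\<^sup>j q[T]\<^sup>-\<^sup>1\<close> with \<open>j \<le> deg q\<close> is bounded. Dividing
  \<open>q(z) - q(T)\<close> and \<open>p(z) - p(T)\<close> by \<open>z - T\<close> gives \<open>f(z) R(z) = R(z) A + \<Sum>\<^sub>j g\<^sub>j(z) B\<^sub>j\<close> with
  \<open>A = p[T] q[T]\<^sup>-\<^sup>1\<close> and rational functions \<open>g\<^sub>j\<close> whose only poles are the zeros of \<open>q\<close>. Green's
  theorem in polar coordinates, applied to \<open>R\<close> outside the double sector and to the \<open>g\<^sub>j\<close> inside it,
  turns the truncated integral into integrals over the circles \<open>|z| = a\<close> and \<open>|z| = b\<close>. There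
  \<open>z f(z) R(z)\<close> vanishes in both limits, while \<open>z g\<^sub>j(z)\<close> tends to \<open>0\<close> for \<open>z \<rightarrow> 0\<close> and to the
  negative of the coefficient \<open>p\<^sub>j\<close> for \<open>z \<rightarrow> \<infinity>\<close>; what remains is \<open>\<pi> \<Sum>\<^sub>j p\<^sub>j B\<^sub>j = \<pi> A\<close>.
\<close>

section \<open>Calculus for Banach-valued functions\<close>

text \<open>\<open>T\<close> is only right linear, so left multiplication by \<open>J\<close> cannot
  be moved past it and gives \<open>V\<close> no complex structure in which \<open>R(z)\<close>
  could be integrated as a holomorphic function. Therefore every contour quantity is a real part
  \<open>Re (c R(z))\<close>, a real combination of two bounded operators. The form of Cauchy's
  theorem that survives is the closedness of \<open>Re (- \<i> h dz)\<close>, whose radial component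
  is \<open>Re (- \<i> e^(\<i> \<theta>) h)\<close> and whose angular component is
  \<open>Re (z h)\<close>.

  The obstacle is that \<open>f R\<close> cannot be deformed to either side of the rays:
  \<open>R\<close> is known only outside the double sector, and the poles of \<open>f\<close> lie
  there too. The splitting gives each defect to a term that can be moved the other way:
  \<open>R(z) A\<close> goes outwards, the scalars \<open>g_j\<close> go inwards. They are real on
  the real axis, so the axis itself contributes nothing to the form.

  Since \<open>R\<close> grows like \<open>1/|z|\<close>, the circles disappear only if
  \<open>f\<close> tends to 0 at both ends; \<open>p(0) = 0\<close> provides this at the origin and
  the degree gap at infinity. The real line lies in the closed double sector, so the zeros of
  \<open>q\<close> are not real; this is why real quadratic factors suffice.\<close>

lemma has_vector_derivative_quotient:
  "(f has_vector_derivative D) (at x within S) \<longleftrightarrow>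
     ((\<lambda>t. (1 / (t - x)) *\<^sub>R (f t - f x)) \<longlongrightarrow> D) (at x within S)"
proof -
  have "norm ((1 / (t - x)) *\<^sub>R (f t - f x) - D) = norm ((1 / norm (t - x)) *\<^sub>R (f t - (f x + (t - x) *\<^sub>R D)))"
    if "t \<noteq> x" for t
  proof -
    have "(1 / (t - x)) *\<^sub>R (f t - f x) - D = (1 / (t - x)) *\<^sub>R (f t - (f x + (t - x) *\<^sub>R D))"
      using that by (simp add: diff_diff_eq[symmetric] scaleR_diff_right[of "1 / (t - x)" _ "(t - x) *\<^sub>R D"])
    then show ?thesis by simp
  qed
  then have *: "((\<lambda>t. norm ((1 / (t - x)) *\<^sub>R (f t - f x) - D)) \<longlongrightarrow> 0) (at x within S) \<longleftrightarrow>
     ((\<lambda>t. norm ((1 / norm (t - x)) *\<^sub>R (f t - (f x + (t - x) *\<^sub>R D)))) \<longlongrightarrow> 0) (at x within S)"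
    by (intro filterlim_cong refl) (auto simp: eventually_at_filter)
  show ?thesis
    unfolding has_vector_derivative_def has_derivative_within Lim_null[of _ D]
    using *[unfolded tendsto_norm_zero_iff] bounded_linear_scaleR_left[of D] by blast
qed

text \<open>The scalar factor vanishes at \<open>x\<close>, so mere continuity of \<open>G\<close>
  is enough. This is what differentiates a resolvent: the resolvent identity expresses its increment
  by the resolvent itself, times scalars that vanish.\<close>

lemma has_vector_derivative_scaleR_vanishing:
  fixes G :: "real \<Rightarrow> 'a::real_normed_vector"
  assumes "(\<xi> has_vector_derivative d) (at x within S)" "(G \<longlongrightarrow> G x) (at x within S)"
  shows "((\<lambda>t. (\<xi> t - \<xi> x) *\<^sub>R G t) has_vector_derivative d *\<^sub>R G x) (at x within S)"
proof -
  have "((\<lambda>t. ((1 / (t - x)) *\<^sub>R (\<xi> t - \<xi> x)) *\<^sub>R G t) \<longlongrightarrow> d *\<^sub>R G x) (at x within S)"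
    using assms unfolding has_vector_derivative_quotient by (intro tendsto_scaleR)
  then show ?thesis unfolding has_vector_derivative_quotient by simp
qed

text \<open>The form \<open>u dr + w d\<theta>\<close> is closed, \<open>D\<close> being the common
  mixed derivative. Differentiating the radial integral of \<open>u\<close> under the integral sign
  leaves the integral of the \<open>r\<close>-derivative of \<open>w\<close>, a difference of
  boundary values.\<close>

lemma green_rectangle:
  fixes u w D :: "real \<Rightarrow> real \<Rightarrow> 'a::banach"
  assumes "a \<le> b" "c \<le> d"
    and u: "\<And>\<theta> r. \<theta> \<in> {c..d} \<Longrightarrow> r \<in> {a..b} \<Longrightarrow> ((\<lambda>\<theta>. u \<theta> r) has_vector_derivative D \<theta> r) (at \<theta> within {c..d})"
    and w: "\<And>\<theta> r. \<theta> \<in> {c..d} \<Longrightarrow> r \<in> {a..b} \<Longrightarrow> (w \<theta> has_vector_derivative D \<theta> r) (at r within {a..b})"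
    and D: "continuous_on ({c..d} \<times> {a..b}) (\<lambda>(\<theta>, r). D \<theta> r)"
    and cont: "\<And>\<theta>. \<theta> \<in> {c..d} \<Longrightarrow> continuous_on {a..b} (u \<theta>)"
  shows "integral {a..b} (u d) - integral {a..b} (u c) = integral {c..d} (\<lambda>\<theta>. w \<theta> b - w \<theta> a)"
proof -
  have "((\<lambda>\<theta>. integral (cbox a b) (u \<theta>)) has_vector_derivative integral (cbox a b) (D \<theta>)) (at \<theta> within {c..d})"
    if "\<theta> \<in> {c..d}" for \<theta>
    by (rule leibniz_rule_vector_derivative) (use that u D cont in \<open>auto intro: integrable_continuous_real\<close>)
  moreover have "integral {a..b} (D \<theta>) = w \<theta> b - w \<theta> a" if "\<theta> \<in> {c..d}" for \<theta>
    using fundamental_theorem_of_calculus[OF \<open>a \<le> b\<close> w] that by blast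
  ultimately have "((\<lambda>\<theta>. integral {a..b} (u \<theta>)) has_vector_derivative w \<theta> b - w \<theta> a) (at \<theta> within {c..d})"
    if "\<theta> \<in> {c..d}" for \<theta>
    using that by simp
  then show ?thesis
    using fundamental_theorem_of_calculus[OF \<open>c \<le> d\<close>, of "\<lambda>\<theta>. integral {a..b} (u \<theta>)"]
    by (metis (mono_tags, lifting) integral_unique)
qed

text \<open>The Bochner integral is not available without separability, so an absolutely convergent
  improper integral is controlled by its primitive: in the variable \<open>arctan t\<close> the primitive is
  Lipschitz, hence it has limits at both ends.\<close>

lemma arctan_dominated_primitive:
  fixes f :: "real \<Rightarrow> 'a::banach"
  assumes cont: "continuous_on {0<..} f" and bound: "\<And>t. t > 0 \<Longrightarrow> norm (f t) \<le> C / (1 + t\<^sup>2)"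
  obtains g l where "continuous_on {0..} g" "\<And>t. t > 0 \<Longrightarrow> (g has_vector_derivative f t) (at t)"
    "(g \<longlongrightarrow> l) at_top"
proof -
  \<comment> \<open>Signed integral with base point 1: one of the two terms always runs over an
    empty or degenerate interval and is 0.\<close>
  define F where "F t = integral {1..t} f - integral {t..1} f" for t
  have int: "f integrable_on {s..t}" if "0 < s" for s t
    by (rule integrable_continuous_real, rule continuous_on_subset[OF cont]) (use that in auto)
  have F: "F t - F s = integral {s..t} f" if "0 < s" "s \<le> t" for s t
  proof -
    have comb: "integral {a..b} f + integral {b..c} f = integral {a..c} f" if "0 < a" "a \<le> b" "b \<le> c" for a b c
      using that by (intro Henstock_Kurzweil_Integration.integral_combine int) auto
    have z: "integral {a..b} f = 0" if "b \<le> a" for a b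
      using that by (cases "a = b") auto
    consider "1 \<le> s" | "s \<le> 1" "1 \<le> t" | "t \<le> 1" by linarith
    then show ?thesis
    proof cases
      case 1 then show ?thesis using comb[of 1 s t] z[of 1 s] z[of 1 t] that by (simp add: F_def algebra_simps)
    next
      case 2 then show ?thesis using comb[of s 1 t] z[of s 1] z[of 1 t] that by (simp add: F_def algebra_simps)
    next
      case 3 then show ?thesis using comb[of s t 1] z[of s 1] z[of t 1] that by (simp add: F_def algebra_simps)
    qed
  qed
  have deriv: "(F has_vector_derivative f t) (at t)" if "t > 0" for t
  proof -
    \<comment> \<open>The base point \<open>t/2\<close> makes \<open>t\<close> interior, so that the
      derivative within the interval is the full derivative.\<close>
    have "((\<lambda>x. integral {t/2..x} f) has_vector_derivative f t) (at t within {t/2..t+1})"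
      by (rule integral_has_vector_derivative) (use that in \<open>auto intro: continuous_on_subset[OF cont]\<close>)
    then have "((\<lambda>x. F (t/2) + integral {t/2..x} f) has_vector_derivative f t) (at t within {t/2..t+1})"
      using has_vector_derivative_add[OF has_vector_derivative_const] by fastforce
    then have "(F has_vector_derivative f t) (at t within {t/2..t+1})"
    proof (rule has_vector_derivative_transform[rotated -1])
      fix x assume "x \<in> {t/2..t+1}"
      then show "F x = F (t/2) + integral {t/2..x} f"
        using F[of "t/2" x] that by (auto simp: algebra_simps)
    qed (use that in auto)
    moreover have "at t within {t/2..t+1} = at t"
      by (rule at_within_interior) (use that in simp)
    ultimately show ?thesis by simp
  qed
  have lip0: "norm (F t - F s) \<le> C * (arctan t - arctan s)" if "0 < s" "s \<le> t" for s t
  proof -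
    have "((\<lambda>t. C / (1 + t\<^sup>2)) has_integral C * arctan t - C * arctan s) {s..t}"
      using that by (intro fundamental_theorem_of_calculus)
        (auto intro!: derivative_eq_intros simp flip: has_real_derivative_iff_has_vector_derivative
          simp: field_simps add_nonneg_eq_0_iff)
    moreover from this have "norm (integral {s..t} f) \<le> integral {s..t} (\<lambda>t. C / (1 + t\<^sup>2))"
      using that by (intro integral_norm_bound_integral int bound) auto
    ultimately have "norm (integral {s..t} f) \<le> C * arctan t - C * arctan s"
      by (simp add: integral_unique)
    then show ?thesis using F[OF that] by (simp add: algebra_simps)
  qed
  have lip: "norm (F t - F s) \<le> C * \<bar>arctan t - arctan s\<bar>" if "0 < s" "0 < t" for s t
    using lip0[of s t] lip0[of t s] that arctan_le_iff[of s t] arctan_le_iff[of t s]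
    by (cases "s \<le> t") (auto simp: norm_minus_commute abs_if)
  have tan_pos: "0 < tan v" "arctan (tan v) = v" if "v \<in> {0<..<pi/2}" for v
    using that by (auto intro!: tan_gt_zero arctan_tan)
  have "uniformly_continuous_on {0<..<pi/2} (\<lambda>v. F (tan v))"
  proof (unfold uniformly_continuous_on_def, intro allI impI)
    fix e :: real assume "e > 0"
    have C: "C \<ge> 0" using bound[of 1] norm_ge_zero[of "f 1"] by (simp, linarith)
    show "\<exists>d>0. \<forall>x\<in>{0<..<pi/2}. \<forall>x'\<in>{0<..<pi/2}. dist x' x < d \<longrightarrow> dist (F (tan x')) (F (tan x)) < e"
    \<comment> \<open>\<open>C + 1\<close> because \<open>C\<close> may be 0.\<close>
    proof (intro exI[of _ "e / (C + 1)"] conjI ballI impI)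
      show "e / (C + 1) > 0" using \<open>e > 0\<close> C by simp
      fix x x' assume x: "x \<in> {0<..<pi/2}" "x' \<in> {0<..<pi/2}" and d: "dist x' x < e / (C + 1)"
      have "dist (F (tan x')) (F (tan x)) \<le> C * \<bar>x' - x\<bar>"
        using lip[of "tan x" "tan x'"] tan_pos[OF x(1)] tan_pos[OF x(2)] by (simp add: dist_norm)
      also have "\<dots> \<le> (C + 1) * \<bar>x' - x\<bar>" by (simp add: mult_right_mono)
      also have "\<dots> < e" using d C by (simp add: dist_real_def field_simps)
      finally show "dist (F (tan x')) (F (tan x)) < e" .
    qed
  qed
  then obtain h where h: "uniformly_continuous_on (closure {0<..<pi/2}) h" "\<And>v. v \<in> {0<..<pi/2} \<Longrightarrow> F (tan v) = h v"
    by (rule uniformly_continuous_on_extension_on_closure) blast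
  have hc: "continuous_on {0..pi/2} h"
    using uniformly_continuous_imp_continuous[OF h(1)] by simp
  have hF: "h (arctan t) = F t" if "t > 0" for t
    using h(2)[of "arctan t"] that arctan_ubound[of t] by (simp add: tan_arctan)
  show ?thesis
  proof
    show "continuous_on {0..} (\<lambda>t. h (arctan t))"
      by (rule continuous_on_compose2[OF hc]) (use arctan_ubound in \<open>auto intro!: continuous_intros simp: less_imp_le\<close>)
    show "((\<lambda>t. h (arctan t)) has_vector_derivative f t) (at t)" if "t > 0" for t
      by (rule has_vector_derivative_transform_within_open[OF deriv[OF that], of "{0<..}"]) (use that hF in auto)
    have "\<forall>\<^sub>F t in at_top. arctan t \<in> {0..pi/2} \<and> arctan t \<noteq> pi/2"
      using eventually_ge_at_top[of 0]
    proof eventually_elim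
      case (elim t)
      then show ?case using arctan_ubound[of t] by simp
    qed
    then have "filterlim arctan (at (pi/2) within {0..pi/2}) at_top"
      using tendsto_arctan_at_top by (simp add: filterlim_at)
    moreover have "(h \<longlongrightarrow> h (pi/2)) (at (pi/2) within {0..pi/2})"
      using hc by (auto simp: continuous_on_def)
    ultimately show "((\<lambda>t. h (arctan t)) \<longlongrightarrow> h (pi/2)) at_top"
      by (rule filterlim_compose[rotated])
  qed
qed

text \<open>The exhaustion is folded at the origin because the integrands of the calculus simplify
  only in the sum of their values at \<open>t\<close> and \<open>- t\<close>. At 0 only the
  primitives are continuous; the integrand may jump there.\<close>

lemma arctan_dominated_integral:
  fixes f :: "real \<Rightarrow> 'a::banach"
  assumes cont: "continuous_on (-{0}) f" and bound: "\<And>t. t \<noteq> 0 \<Longrightarrow> norm (f t) \<le> C / (1 + t\<^sup>2)"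
  shows "f integrable_on UNIV"
    and "(\<lambda>n. integral {inverse (real (Suc n))..real (Suc n)} (\<lambda>t. f t + f (- t))) \<longlonglongrightarrow> integral UNIV f"
proof -
  have "continuous_on {0<..} f" by (rule continuous_on_subset[OF cont]) auto
  then obtain g l where g: "continuous_on {0..} g" "\<And>t. t > 0 \<Longrightarrow> (g has_vector_derivative f t) (at t)"
      "(g \<longlongrightarrow> l) at_top"
    using arctan_dominated_primitive[of f C] bound by auto
  have "continuous_on {0<..} (\<lambda>t. f (- t))"
    by (rule continuous_on_compose2[OF cont]) (auto intro!: continuous_intros)
  then obtain h m where h: "continuous_on {0..} h" "\<And>t. t > 0 \<Longrightarrow> (h has_vector_derivative f (- t)) (at t)"
      "(h \<longlongrightarrow> m) at_top"
    using arctan_dominated_primitive[of "\<lambda>t. f (- t)" C] bound[of "- _"] by auto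
  define I where "I = (l - g 0) + (m - h 0)"
  have int1: "(f has_integral g b - g a) {a..b}" if "0 \<le> a" "a \<le> b" for a b
    by (rule fundamental_theorem_of_calculus_interior)
       (use that g in \<open>auto intro: continuous_on_subset[OF g(1)]\<close>)
  have int2: "((\<lambda>t. f (- t)) has_integral h b - h a) {a..b}" if "0 \<le> a" "a \<le> b" for a b
    by (rule fundamental_theorem_of_calculus_interior)
       (use that h in \<open>auto intro: continuous_on_subset[OF h(1)]\<close>)
  have int3: "(f has_integral h a - h 0) {-a..0}" if "0 \<le> a" for a
    using has_integral_reflect_lemma_real[OF int2[of 0 a]] that by simp
  have int4: "(f has_integral (h a - h 0) + (g b - g 0)) {-a..b}" if "0 \<le> a" "0 \<le> b" for a b
    using that by (intro has_integral_combine[OF _ _ int3 int1]) auto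
  have I: "(f has_integral I) UNIV"
  proof (rule has_integral_alt'[THEN iffD2], intro conjI allI impI)
    fix a b :: real
    \<comment> \<open>The interval is enlarged to contain the origin, where the two primitives are
      joined.\<close>
    have "f integrable_on {-max 0 (-a)..max 0 b}"
      using int4[of "max 0 (-a)" "max 0 b"] by auto
    then show "(\<lambda>x. if x \<in> UNIV then f x else 0) integrable_on cbox a b"
      by simp (rule integrable_on_subinterval[of _ "{-max 0 (-a)..max 0 b}"], auto)
  next
    fix e :: real assume "e > 0"
    have "\<forall>\<^sub>F t in at_top. dist (g t) l < e / 2" "\<forall>\<^sub>F t in at_top. dist (h t) m < e / 2"
      using tendstoD[OF g(3), of "e / 2"] tendstoD[OF h(3), of "e / 2"] \<open>e > 0\<close> by simp_all
    then obtain B1 B2 where B: "\<And>t. t \<ge> B1 \<Longrightarrow> dist (g t) l < e / 2" "\<And>t. t \<ge> B2 \<Longrightarrow> dist (h t) m < e / 2"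
      unfolding eventually_at_top_linorder by metis
    define B where "B = max 1 (max B1 B2)"
    show "\<exists>B>0. \<forall>a b. ball 0 B \<subseteq> cbox a b \<longrightarrow>
        norm (integral (cbox a b) (\<lambda>x. if x \<in> UNIV then f x else 0) - I) < e"
    proof (intro exI[of _ B] conjI allI impI)
      show "B > 0" by (simp add: B_def)
      fix a b :: real assume *: "ball 0 B \<subseteq> cbox a b"
      then have "{-B<..<B} \<subseteq> {a..b}" by (auto simp: ball_def dist_real_def subset_iff)
      then have ab: "a \<le> -B" "B \<le> b"
        using \<open>B > 0\<close> greaterThanLessThan_subseteq_atLeastAtMost_iff[of "-B" B a b] by auto
      have "integral {a..b} f - I = (h (- a) - m) + (g b - l)"
        using integral_unique[OF int4[of "-a" b]] ab \<open>B > 0\<close> by (simp add: I_def)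
      also have "norm \<dots> < e / 2 + e / 2"
        using B(1)[of b] B(2)[of "-a"] ab by (intro norm_add_less) (auto simp: dist_norm B_def)
      finally show "norm (integral (cbox a b) (\<lambda>x. if x \<in> UNIV then f x else 0) - I) < e" by simp
    qed
  qed
  then show "f integrable_on UNIV" by auto
  have l1: "filterlim (\<lambda>n. real (Suc n)) at_top sequentially"
    by (rule filterlim_compose[OF filterlim_real_sequentially filterlim_Suc])
  have l2: "((\<lambda>n. k (inverse (real (Suc n)))) \<longlonglongrightarrow> k 0)" if "continuous_on {0..} k" for k :: "real \<Rightarrow> 'a"
  proof -
    have "(k \<longlongrightarrow> k 0) (at 0 within {0..})" using that by (auto simp: continuous_on_def)
    moreover have "filterlim (\<lambda>n. inverse (real (Suc n))) (at 0 within {0..}) sequentially"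
      unfolding filterlim_at using LIMSEQ_inverse_real_of_nat by (auto simp: less_imp_neq)
    ultimately show ?thesis by (rule filterlim_compose)
  qed
  have le: "inverse (real (Suc n)) \<le> real (Suc n)" for n
    by (rule order_trans[of _ 1]) (simp_all add: inverse_eq_divide)
  have "integral {inverse (real (Suc n))..real (Suc n)} (\<lambda>t. f t + f (- t)) =
     g (real (Suc n)) - g (inverse (real (Suc n))) + (h (real (Suc n)) - h (inverse (real (Suc n))))" for n
    by (intro integral_unique has_integral_add int1 int2 le) auto
  moreover have "(\<lambda>n. g (real (Suc n)) - g (inverse (real (Suc n))) + (h (real (Suc n)) - h (inverse (real (Suc n))))) \<longlonglongrightarrow> I"
    unfolding I_def by (intro tendsto_intros filterlim_compose[OF g(3) l1] filterlim_compose[OF h(3) l1] l2 g h)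
  ultimately show "(\<lambda>n. integral {inverse (real (Suc n))..real (Suc n)} (\<lambda>t. f t + f (- t))) \<longlonglongrightarrow> integral UNIV f"
    using I by (simp add: integral_unique)
qed

section \<open>Families of resolvents on a sector\<close>

lemmas blinfun_compose_simps =
  bounded_bilinear.add_left[OF bounded_bilinear_blinfun_compose]
  bounded_bilinear.add_right[OF bounded_bilinear_blinfun_compose]
  bounded_bilinear.diff_left[OF bounded_bilinear_blinfun_compose]
  bounded_bilinear.diff_right[OF bounded_bilinear_blinfun_compose]
  bounded_bilinear.scaleR_left[OF bounded_bilinear_blinfun_compose]
  bounded_bilinear.scaleR_right[OF bounded_bilinear_blinfun_compose]
  bounded_bilinear.minus_left[OF bounded_bilinear_blinfun_compose]

lemma compose_id_blinfun: "f o\<^sub>L id_blinfun = f"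
  by (simp add: blinfun_eqI)

text \<open>The upper half of the complement of the open double sector, without the origin. The
  lower half carries no further information, since \<open>Q_z[T]\<close> depends only on
  \<open>Re z\<close> and \<open>cmod z\<close>.\<close>

definition upper_sector :: "real \<Rightarrow> complex set" where
  "upper_sector \<phi> = {r *\<^sub>R cis \<theta> | r \<theta>. r > 0 \<and> \<theta> \<in> {\<phi>..pi - \<phi>}}"

lemma upper_sectorI [intro]: "r > 0 \<Longrightarrow> \<phi> \<le> \<theta> \<Longrightarrow> \<theta> \<le> pi - \<phi> \<Longrightarrow> r *\<^sub>R cis \<theta> \<in> upper_sector \<phi>"
  by (auto simp: upper_sector_def)

lemma zero_notin_upper_sector: "0 \<notin> upper_sector \<phi>"
  by (auto simp: upper_sector_def)

text \<open>\<open>K z\<close> and \<open>M z\<close> stand for \<open>Q\<^sub>z[T]\<^sup>-\<^sup>1\<close> and \<open>T Q\<^sub>z[T]\<^sup>-\<^sup>1\<close>; on the complexification of the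
  real space the resolvent is \<open>R z = cnj z K z - M z\<close>.\<close>

locale sector_resolvent =
  fixes \<phi> C :: real and K M :: "complex \<Rightarrow> 'a::banach \<Rightarrow>\<^sub>L 'a"
  assumes angle: "0 < \<phi>" "\<phi> < pi / 2"
    and K_diff: "z \<in> upper_sector \<phi> \<Longrightarrow> w \<in> upper_sector \<phi> \<Longrightarrow>
      K z - K w = (2 * (Re z - Re w)) *\<^sub>R (K z o\<^sub>L M w) - ((cmod z)\<^sup>2 - (cmod w)\<^sup>2) *\<^sub>R (K z o\<^sub>L K w)"
    and M_diff: "z \<in> upper_sector \<phi> \<Longrightarrow> w \<in> upper_sector \<phi> \<Longrightarrow>
      M z - M w = (2 * (Re z - Re w)) *\<^sub>R (M z o\<^sub>L M w) - ((cmod z)\<^sup>2 - (cmod w)\<^sup>2) *\<^sub>R (M z o\<^sub>L K w)"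
    and KM: "z \<in> upper_sector \<phi> \<Longrightarrow> K z o\<^sub>L M z = M z o\<^sub>L K z"
    and MM: "z \<in> upper_sector \<phi> \<Longrightarrow>
      M z o\<^sub>L M z = K z + (2 * Re z) *\<^sub>R (M z o\<^sub>L K z) - (cmod z)\<^sup>2 *\<^sub>R (K z o\<^sub>L K z)"
    and norm_K: "z \<in> upper_sector \<phi> \<Longrightarrow> norm (K z) \<le> C / (cmod z)\<^sup>2"
    and norm_M: "z \<in> upper_sector \<phi> \<Longrightarrow> norm (M z) \<le> C / cmod z"
begin

text \<open>\<open>K\<close> and \<open>M\<close> satisfy the same identity up to the left factor,
  so one argument serves both, with \<open>k = 2\<close> and \<open>k = 1\<close>. The norm bound
  controls the factor \<open>N z\<close> near \<open>w\<close>, and the scalars in front tend to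
  0.\<close>

lemma family_continuous:
  fixes N :: "complex \<Rightarrow> 'a \<Rightarrow>\<^sub>L 'a"
  assumes diff: "\<And>z w. z \<in> upper_sector \<phi> \<Longrightarrow> w \<in> upper_sector \<phi> \<Longrightarrow>
      N z - N w = (2 * (Re z - Re w)) *\<^sub>R (N z o\<^sub>L M w) - ((cmod z)\<^sup>2 - (cmod w)\<^sup>2) *\<^sub>R (N z o\<^sub>L K w)"
    and bound: "\<And>z. z \<in> upper_sector \<phi> \<Longrightarrow> norm (N z) \<le> C / (cmod z) ^ k"
  shows "continuous_on (upper_sector \<phi>) N"
  unfolding continuous_on_def
proof
  fix w assume w: "w \<in> upper_sector \<phi>"
  then have w0: "w \<noteq> 0" using zero_notin_upper_sector by auto
  have "((\<lambda>z. N z - N w) \<longlongrightarrow> 0) (at w within upper_sector \<phi>)"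
  proof (rule Lim_null_comparison)
    show "\<forall>\<^sub>F z in at w within upper_sector \<phi>. norm (N z - N w) \<le>
       \<bar>2 * (Re z - Re w)\<bar> * (C / (cmod z) ^ k * norm (M w)) + \<bar>(cmod z)\<^sup>2 - (cmod w)\<^sup>2\<bar> * (C / (cmod z) ^ k * norm (K w))"
      unfolding eventually_at_filter
    proof (intro always_eventually allI impI)
      fix z assume z: "z \<in> upper_sector \<phi>"
      have "norm (N z o\<^sub>L L) \<le> C / (cmod z) ^ k * norm L" for L :: "'a \<Rightarrow>\<^sub>L 'a"
        by (rule order_trans[OF norm_blinfun_compose]) (intro mult_right_mono bound z norm_ge_zero)
      then show "norm (N z - N w) \<le>
         \<bar>2 * (Re z - Re w)\<bar> * (C / (cmod z) ^ k * norm (M w)) + \<bar>(cmod z)\<^sup>2 - (cmod w)\<^sup>2\<bar> * (C / (cmod z) ^ k * norm (K w))"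
        unfolding diff[OF z w]
        by (intro order_trans[OF norm_triangle_ineq4] add_mono) (simp_all only: norm_scaleR mult_left_mono abs_ge_zero)
    qed
    show "((\<lambda>z. \<bar>2 * (Re z - Re w)\<bar> * (C / (cmod z) ^ k * norm (M w)) + \<bar>(cmod z)\<^sup>2 - (cmod w)\<^sup>2\<bar> * (C / (cmod z) ^ k * norm (K w))) \<longlongrightarrow> 0) (at w within upper_sector \<phi>)"
      using w0 by (auto intro!: tendsto_eq_intros)
  qed
  then show "(N \<longlongrightarrow> N w) (at w within upper_sector \<phi>)"
    using Lim_null by blast
qed

lemma continuous_K: "continuous_on (upper_sector \<phi>) K"
  by (rule family_continuous[of _ 2]) (use K_diff norm_K in auto)

lemma continuous_M: "continuous_on (upper_sector \<phi>) M"
  by (rule family_continuous[of _ 1]) (use M_diff norm_M in auto)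

text \<open>The point enters the resolvent identity only through \<open>Re z\<close> and
  \<open>(cmod z)^2\<close>. Along a curve the derivatives \<open>x'\<close> and \<open>n'\<close>
  of these two functions therefore determine the derivative of the family.\<close>

lemma family_derivative:
  fixes N :: "complex \<Rightarrow> 'a \<Rightarrow>\<^sub>L 'a"
  assumes diff: "\<And>z w. z \<in> upper_sector \<phi> \<Longrightarrow> w \<in> upper_sector \<phi> \<Longrightarrow>
      N z - N w = (2 * (Re z - Re w)) *\<^sub>R (N z o\<^sub>L M w) - ((cmod z)\<^sup>2 - (cmod w)\<^sup>2) *\<^sub>R (N z o\<^sub>L K w)"
    and cont: "continuous_on (upper_sector \<phi>) N"
    and z: "continuous_on S z" "z ` S \<subseteq> upper_sector \<phi>" "t \<in> S"
    and x': "((\<lambda>t. Re (z t)) has_vector_derivative x') (at t within S)"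
    and n': "((\<lambda>t. (cmod (z t))\<^sup>2) has_vector_derivative n') (at t within S)"
  shows "((\<lambda>t. N (z t)) has_vector_derivative
     (2 * x') *\<^sub>R (N (z t) o\<^sub>L M (z t)) - n' *\<^sub>R (N (z t) o\<^sub>L K (z t))) (at t within S)"
proof -
  have "continuous_on S (\<lambda>t. N (z t))"
    by (rule continuous_on_compose2[OF cont z(1,2)])
  then have "((\<lambda>s. N (z s)) \<longlongrightarrow> N (z t)) (at t within S)"
    using z(3) by (auto simp: continuous_on_def)
  then have G: "((\<lambda>s. N (z s) o\<^sub>L L) \<longlongrightarrow> N (z t) o\<^sub>L L) (at t within S)" for L :: "'a \<Rightarrow>\<^sub>L 'a"
    by (intro tendsto_intros)
  have "((\<lambda>s. N (z t) + ((2 * Re (z s) - 2 * Re (z t)) *\<^sub>R (N (z s) o\<^sub>L M (z t))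
      - ((cmod (z s))\<^sup>2 - (cmod (z t))\<^sup>2) *\<^sub>R (N (z s) o\<^sub>L K (z t)))) has_vector_derivative
     0 + ((2 * x') *\<^sub>R (N (z t) o\<^sub>L M (z t)) - n' *\<^sub>R (N (z t) o\<^sub>L K (z t)))) (at t within S)"
    by (intro has_vector_derivative_add has_vector_derivative_diff has_vector_derivative_const
        has_vector_derivative_scaleR_vanishing[of "\<lambda>t. 2 * Re (z t)"] has_vector_derivative_scaleR_vanishing n' G
        has_vector_derivative_mult_right x')
  then have *: "((\<lambda>s. N (z t) + ((2 * Re (z s) - 2 * Re (z t)) *\<^sub>R (N (z s) o\<^sub>L M (z t))
      - ((cmod (z s))\<^sup>2 - (cmod (z t))\<^sup>2) *\<^sub>R (N (z s) o\<^sub>L K (z t)))) has_vector_derivative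
      (2 * x') *\<^sub>R (N (z t) o\<^sub>L M (z t)) - n' *\<^sub>R (N (z t) o\<^sub>L K (z t))) (at t within S)"
    by (simp only: add_0_left)
  show ?thesis
  proof (rule has_vector_derivative_transform[OF z(3) _ *])
    fix s assume "s \<in> S"
    then show "N (z s) = N (z t) + ((2 * Re (z s) - 2 * Re (z t)) *\<^sub>R (N (z s) o\<^sub>L M (z t))
      - ((cmod (z s))\<^sup>2 - (cmod (z t))\<^sup>2) *\<^sub>R (N (z s) o\<^sub>L K (z t)))"
      using diff[of "z s" "z t"] z(2,3) by (simp add: algebra_simps image_subset_iff)
  qed
qed

text \<open>\<open>P c z\<close> is the real part of \<open>c R z\<close>.\<close>

definition P :: "complex \<Rightarrow> complex \<Rightarrow> 'a \<Rightarrow>\<^sub>L 'a" where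
  "P c z = Re (c * cnj z) *\<^sub>R K z - Re c *\<^sub>R M z"

lemma P_linear:
  "P (c + d) z = P c z + P d z" "P (c - d) z = P c z - P d z" "P (of_real r * c) z = r *\<^sub>R P c z"
  by (simp_all add: P_def algebra_simps)

lemma norm_P:
  assumes z: "z \<in> upper_sector \<phi>"
  shows "norm (P c z) \<le> 2 * C * cmod c / cmod z"
proof -
  have z0: "z \<noteq> 0" using z zero_notin_upper_sector by auto
  have "norm (P c z) \<le> \<bar>Re (c * cnj z)\<bar> * norm (K z) + \<bar>Re c\<bar> * norm (M z)"
    unfolding P_def by (rule order_trans[OF norm_triangle_ineq4]) simp
  also have "\<dots> \<le> (cmod c * cmod z) * (C / (cmod z)\<^sup>2) + cmod c * (C / cmod z)"
    using norm_K[OF z] norm_M[OF z] abs_Re_le_cmod[of "c * cnj z"] abs_Re_le_cmod[of c]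
    by (intro add_mono mult_mono) (auto simp: norm_mult)
  also have "\<dots> = 2 * C * cmod c / cmod z"
    using z0 by (simp add: field_simps power2_eq_square)
  finally show ?thesis .
qed

lemma continuous_P:
  assumes "continuous_on S c" "continuous_on S z" "z ` S \<subseteq> upper_sector \<phi>"
  shows "continuous_on S (\<lambda>t. P (c t) (z t))"
  unfolding P_def
  by (intro continuous_intros assms continuous_on_compose2[OF continuous_K assms(2,3)]
      continuous_on_compose2[OF continuous_M assms(2,3)])

text \<open>The identity \<open>R z (z - T) = 1\<close>, tested on \<open>B k\<close> with \<open>B (k + 1) = T B k\<close>.\<close>

definition moments :: "nat \<Rightarrow> (nat \<Rightarrow> 'a \<Rightarrow>\<^sub>L 'a) \<Rightarrow> bool" where
  "moments m B \<longleftrightarrow> (\<forall>c. \<forall>z\<in>upper_sector \<phi>. \<forall>k<m. P (c * z) z o\<^sub>L B k = (P c z o\<^sub>L B (Suc k)) + Re c *\<^sub>R B k)"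

lemma Re_cis_cnj [simp]: "Re (r *\<^sub>R cis \<theta> * cnj (r *\<^sub>R cis \<theta>)) = r\<^sup>2"
  by (simp add: power2_eq_square algebra_simps)

text \<open>Closedness of \<open>Re (- \<i> R(z) dz)\<close> on the region where the resolvent
  exists.\<close>

lemma P_green:
  assumes "0 < a" "a \<le> b"
  shows "integral {a..b} (\<lambda>r. P (- \<i> * cis (pi - \<phi>)) (r *\<^sub>R cis (pi - \<phi>))) - integral {a..b} (\<lambda>r. P (- \<i> * cis \<phi>) (r *\<^sub>R cis \<phi>)) =
    integral {\<phi>..pi - \<phi>} (\<lambda>\<theta>. P (b *\<^sub>R cis \<theta>) (b *\<^sub>R cis \<theta>) - P (a *\<^sub>R cis \<theta>) (a *\<^sub>R cis \<theta>))"
proof -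
  \<comment> \<open>The \<open>\<theta>\<close>-derivative of the radial component
    \<open>- sin \<theta> M\<close>; in that component \<open>K\<close> drops out because
    \<open>- \<i> cis \<theta> * cnj z\<close> is purely imaginary.\<close>
  define D where "D \<theta> r = (- cos \<theta>) *\<^sub>R M (r *\<^sub>R cis \<theta>) + (2 * r * (sin \<theta>)\<^sup>2) *\<^sub>R (M (r *\<^sub>R cis \<theta>) o\<^sub>L M (r *\<^sub>R cis \<theta>))" for \<theta> r
  have u: "P (- \<i> * cis \<theta>) (r *\<^sub>R cis \<theta>) = (- sin \<theta>) *\<^sub>R M (r *\<^sub>R cis \<theta>)" for \<theta> r
    by (simp add: P_def)
  have w: "P (r *\<^sub>R cis \<theta>) (r *\<^sub>R cis \<theta>) = r\<^sup>2 *\<^sub>R K (r *\<^sub>R cis \<theta>) - (r * cos \<theta>) *\<^sub>R M (r *\<^sub>R cis \<theta>)" for \<theta> r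
    unfolding P_def Re_cis_cnj by simp
  have mem: "r *\<^sub>R cis \<theta> \<in> upper_sector \<phi>" if "\<theta> \<in> {\<phi>..pi - \<phi>}" "r \<in> {a..b}" for \<theta> r
    using that assms by auto
  show ?thesis
  proof (rule green_rectangle[where u = "\<lambda>\<theta> r. P (- \<i> * cis \<theta>) (r *\<^sub>R cis \<theta>)" and w = "\<lambda>\<theta> r. P (r *\<^sub>R cis \<theta>) (r *\<^sub>R cis \<theta>)" and D = D])
    fix \<theta> r assume \<theta>: "\<theta> \<in> {\<phi>..pi - \<phi>}" and r: "r \<in> {a..b}"
    let ?z = "r *\<^sub>R cis \<theta>"
    have M: "((\<lambda>\<theta>. M (r *\<^sub>R cis \<theta>)) has_vector_derivative
        (2 * (- r * sin \<theta>)) *\<^sub>R (M ?z o\<^sub>L M ?z) - 0 *\<^sub>R (M ?z o\<^sub>L K ?z)) (at \<theta> within {\<phi>..pi - \<phi>})"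
      by (rule family_derivative[OF M_diff continuous_M])
        (use mem \<theta> r in \<open>auto intro!: continuous_intros derivative_eq_intros simp: norm_mult
          simp flip: has_real_derivative_iff_has_vector_derivative\<close>)
    show "((\<lambda>\<theta>. P (- \<i> * cis \<theta>) (r *\<^sub>R cis \<theta>)) has_vector_derivative D \<theta> r) (at \<theta> within {\<phi>..pi - \<phi>})"
      unfolding u D_def
      by (rule has_vector_derivative_eq_rhs[OF has_vector_derivative_scaleR[OF _ M]])
        (auto intro!: derivative_eq_intros simp: power2_eq_square algebra_simps)
    have K': "((\<lambda>r. K (r *\<^sub>R cis \<theta>)) has_vector_derivative
        (2 * cos \<theta>) *\<^sub>R (K ?z o\<^sub>L M ?z) - (2 * r) *\<^sub>R (K ?z o\<^sub>L K ?z)) (at r within {a..b})"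
      by (rule family_derivative[OF K_diff continuous_K])
        (use mem \<theta> r in \<open>auto intro!: continuous_intros derivative_eq_intros simp: norm_mult
          simp flip: has_real_derivative_iff_has_vector_derivative\<close>)
    have M': "((\<lambda>r. M (r *\<^sub>R cis \<theta>)) has_vector_derivative
        (2 * cos \<theta>) *\<^sub>R (M ?z o\<^sub>L M ?z) - (2 * r) *\<^sub>R (M ?z o\<^sub>L K ?z)) (at r within {a..b})"
      by (rule family_derivative[OF M_diff continuous_M])
        (use mem \<theta> r in \<open>auto intro!: continuous_intros derivative_eq_intros simp: norm_mult
          simp flip: has_real_derivative_iff_has_vector_derivative\<close>)
    have sin2: "(sin \<theta>)\<^sup>2 = 1 - (cos \<theta>)\<^sup>2" by (simp add: sin_squared_eq)
    have MMz: "M ?z o\<^sub>L M ?z = K ?z + (2 * r * cos \<theta>) *\<^sub>R (M ?z o\<^sub>L K ?z) - r\<^sup>2 *\<^sub>R (K ?z o\<^sub>L K ?z)"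
      using MM[OF mem[OF \<theta> r]] r assms by (simp add: norm_mult)
    \<comment> \<open>The terms in \<open>K\<close>, \<open>M K\<close> and \<open>K K\<close> on
      the left add up to \<open>2 r\<close> times the right side of \<open>MMz\<close>; hence only
      \<open>M\<close> and \<open>M M\<close> survive.\<close>
    have "(r\<^sup>2 *\<^sub>R ((2 * cos \<theta>) *\<^sub>R (K ?z o\<^sub>L M ?z) - (2 * r) *\<^sub>R (K ?z o\<^sub>L K ?z)) + (2 * r) *\<^sub>R K ?z)
       - ((r * cos \<theta>) *\<^sub>R ((2 * cos \<theta>) *\<^sub>R (M ?z o\<^sub>L M ?z) - (2 * r) *\<^sub>R (M ?z o\<^sub>L K ?z)) + cos \<theta> *\<^sub>R M ?z)
       = (- cos \<theta>) *\<^sub>R M ?z + (2 * r * (1 - (cos \<theta>)\<^sup>2)) *\<^sub>R (M ?z o\<^sub>L M ?z)"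
      unfolding KM[OF mem[OF \<theta> r]] MMz
      by (simp add: algebra_simps power2_eq_square flip: scaleR_add_left)
    then show "((\<lambda>r. P (r *\<^sub>R cis \<theta>) (r *\<^sub>R cis \<theta>)) has_vector_derivative D \<theta> r) (at r within {a..b})"
      unfolding w D_def sin2
      by (intro has_vector_derivative_eq_rhs[OF has_vector_derivative_diff[OF has_vector_derivative_scaleR[OF _ K'] has_vector_derivative_scaleR[OF _ M']]])
        (auto intro!: derivative_eq_intros)
  next
    have "(\<lambda>x. snd x *\<^sub>R cis (fst x)) ` ({\<phi>..pi - \<phi>} \<times> {a..b}) \<subseteq> upper_sector \<phi>"
      using mem by auto
    then have "continuous_on ({\<phi>..pi - \<phi>} \<times> {a..b}) (\<lambda>x. M (snd x *\<^sub>R cis (fst x)))"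
      by (intro continuous_on_compose2[OF continuous_M] continuous_intros)
    then show "continuous_on ({\<phi>..pi - \<phi>} \<times> {a..b}) (\<lambda>(\<theta>, r). D \<theta> r)"
      unfolding D_def case_prod_beta by (intro continuous_intros)
  next
    fix \<theta> assume "\<theta> \<in> {\<phi>..pi - \<phi>}"
    then show "continuous_on {a..b} (\<lambda>r. P (- \<i> * cis \<theta>) (r *\<^sub>R cis \<theta>))"
      using mem by (intro continuous_P continuous_intros) auto
  qed (use assms angle in auto)
qed

end

section \<open>Rational functions with real coefficients\<close>

definition cpoly :: "real poly \<Rightarrow> complex \<Rightarrow> complex" where
  "cpoly p = poly (map_poly of_real p)"

definition ratio :: "real poly \<Rightarrow> real poly \<Rightarrow> complex \<Rightarrow> complex" where
  "ratio p q z = cpoly p z / cpoly q z"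

text \<open>The coefficients, as functions of \<open>z\<close>, of the powers \<open>t\<^sup>j\<close> in the polynomial
  \<open>q(t) (f(z) - f(t)) / (z - t)\<close>, where \<open>f = p / q\<close>.\<close>

definition remainder_coeff :: "real poly \<Rightarrow> real poly \<Rightarrow> nat \<Rightarrow> complex \<Rightarrow> complex" where
  "remainder_coeff p q j z = cpoly (poly_shift (Suc j) p) z - ratio p q z * cpoly (poly_shift (Suc j) q) z"

lemma cpoly_pCons: "cpoly (pCons a p) z = of_real a + z * cpoly p z"
  by (simp add: cpoly_def map_poly_pCons)

lemma cpoly_0 [simp]: "cpoly 0 z = 0"
  by (simp add: cpoly_def)

text \<open>Horner's recursion. Its iterates are the coefficients of the quotient in the division of
  \<open>p(z) - p(t)\<close> by \<open>z - t\<close>.\<close>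

lemma cpoly_poly_shift: "cpoly (poly_shift j p) z = of_real (coeff p j) + z * cpoly (poly_shift (Suc j) p) z"
proof -
  have "poly_shift j p = pCons (coeff p j) (poly_shift (Suc j) p)"
    by (intro poly_eqI) (simp add: coeff_poly_shift coeff_pCons split: nat.splits)
  then show ?thesis by (simp add: cpoly_pCons)
qed

lemma cpoly_add: "cpoly (p + q) z = cpoly p z + cpoly q z"
proof -
  have "map_poly complex_of_real (p + q) = map_poly of_real p + map_poly of_real q"
    by (intro poly_eqI) (simp add: coeff_map_poly)
  then show ?thesis by (simp add: cpoly_def)
qed

lemma cpoly_smult: "cpoly (smult a p) z = of_real a * cpoly p z"
proof -
  have "map_poly complex_of_real (smult a p) = smult (of_real a) (map_poly of_real p)"
    by (intro poly_eqI) (simp add: coeff_map_poly)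
  then show ?thesis by (simp add: cpoly_def)
qed

lemma cpoly_mult: "cpoly (p * q) z = cpoly p z * cpoly q z"
  by (induction p) (auto simp: cpoly_pCons cpoly_add cpoly_smult algebra_simps)

lemma cpoly_Reals: "z \<in> \<real> \<Longrightarrow> cpoly p z \<in> \<real>"
  by (induction p) (auto simp: cpoly_pCons)

lemma cpoly_cnj: "cpoly p (cnj z) = cnj (cpoly p z)"
  by (induction p) (auto simp: cpoly_pCons)

lemma cpoly_at_0: "cpoly p 0 = of_real (coeff p 0)"
  using cpoly_poly_shift[of 0 p 0] by simp

lemma cpoly_has_derivative: "(cpoly p has_field_derivative cpoly (pderiv p) z) (at z)"
  proof (induction p)
  case (pCons a p)
  have "cpoly (pCons a p) = (\<lambda>z. of_real a + z * cpoly p z)"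
    by (simp add: fun_eq_iff cpoly_pCons)
  then show ?case
    by (auto intro!: derivative_eq_intros pCons simp: pderiv_pCons cpoly_add cpoly_pCons)
qed (simp add: cpoly_def)

lemma continuous_cpoly: "continuous_on S f \<Longrightarrow> continuous_on S (\<lambda>x. cpoly p (f x))"
  unfolding cpoly_def by (intro continuous_intros)

lemma degree_cpoly: "degree (map_poly complex_of_real p) = degree p"
  by (rule degree_map_poly) simp

lemma ratio_at_infinity: "degree p < degree q \<Longrightarrow> (ratio p q \<longlongrightarrow> 0) at_infinity"
  unfolding ratio_def cpoly_def by (rule poly_divide_tendsto_0_at_infinity) (simp add: degree_cpoly)

lemma eventually_cpoly_nonzero_at_infinity:
  assumes "0 < degree q"
  shows "\<forall>\<^sub>F z in at_infinity. cpoly q z \<noteq> 0"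
proof -
  have "filterlim (cpoly q) at_infinity at_infinity"
    unfolding cpoly_def by (rule filterlim_poly_at_infinity) (use assms in \<open>simp add: degree_cpoly\<close>)
  then show ?thesis
    using eventually_not_equal_at_infinity[of 0] by (auto simp: filterlim_iff)
qed

lemma remainder_coeff_at_infinity:
  assumes "degree p < degree q"
  shows "((\<lambda>z. z * remainder_coeff p q j z) \<longlongrightarrow> - of_real (coeff p j)) at_infinity"
proof -
  \<comment> \<open>The index is lowered by one to obtain a base case: \<open>h 0 = p - f q\<close>
    vanishes wherever \<open>q\<close> does not, while \<open>h (Suc j)\<close> is the remainder
    coefficient of index \<open>j\<close>. Once \<open>h j\<close> tends to 0, the recursion gives
    the limit of \<open>z * h (Suc j) z\<close>, hence \<open>h (Suc j)\<close> tends to 0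
    too.\<close>
  define h where "h j z = cpoly (poly_shift j p) z - ratio p q z * cpoly (poly_shift j q) z" for j z
  have nz: "\<forall>\<^sub>F z in at_infinity. cpoly q z \<noteq> 0 \<and> z \<noteq> 0"
    using eventually_cpoly_nonzero_at_infinity[of q] assms eventually_not_equal_at_infinity[of 0]
    by (auto intro: eventually_conj)
  have step: "z * h (Suc j) z = h j z - of_real (coeff p j) + ratio p q z * of_real (coeff q j)" for j z
    unfolding h_def cpoly_poly_shift[of j] by (simp add: algebra_simps)
  have succ: "((\<lambda>z. z * h (Suc j) z) \<longlongrightarrow> - of_real (coeff p j)) at_infinity" if "(h j \<longlongrightarrow> 0) at_infinity" for j
    unfolding step
    using tendsto_add[OF tendsto_diff[OF that tendsto_const] tendsto_mult[OF ratio_at_infinity[OF assms] tendsto_const]]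
    by simp
  have "(h j \<longlongrightarrow> 0) at_infinity" for j
  proof (induction j)
    case 0
    have "\<forall>\<^sub>F z in at_infinity. h 0 z = 0"
      using nz by eventually_elim (simp add: h_def ratio_def)
    then show ?case by (rule tendsto_eventually)
  next
    case (Suc j)
    have "((\<lambda>z. inverse z * (z * h (Suc j) z)) \<longlongrightarrow> 0 * - of_real (coeff p j)) at_infinity"
      by (intro tendsto_mult succ Suc tendsto_inverse_0)
    moreover have "\<forall>\<^sub>F z in at_infinity. inverse z * (z * h (Suc j) z) = h (Suc j) z"
      using nz by eventually_elim simp
    ultimately show ?case by (simp add: tendsto_cong)
  qed
  from succ[OF this] show ?thesis by (simp add: remainder_coeff_def h_def)
qed

lemma continuous_ratio:
  assumes "continuous_on S f" "\<And>x. x \<in> S \<Longrightarrow> cpoly q (f x) \<noteq> 0"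
  shows "continuous_on S (\<lambda>x. ratio p q (f x))"
  unfolding ratio_def by (intro continuous_intros continuous_cpoly) (use assms in auto)

lemma continuous_remainder_coeff:
  assumes "continuous_on S f" "\<And>x. x \<in> S \<Longrightarrow> cpoly q (f x) \<noteq> 0"
  shows "continuous_on S (\<lambda>x. remainder_coeff p q j (f x))"
  unfolding remainder_coeff_def by (intro continuous_intros continuous_cpoly continuous_ratio assms)

lemma ratio_Reals: "z \<in> \<real> \<Longrightarrow> ratio p q z \<in> \<real>"
  by (simp add: ratio_def cpoly_Reals)

lemma remainder_coeff_Reals: "z \<in> \<real> \<Longrightarrow> remainder_coeff p q j z \<in> \<real>"
  by (simp add: remainder_coeff_def cpoly_Reals ratio_Reals)

lemma ratio_cnj: "ratio p q (cnj z) = cnj (ratio p q z)"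
  by (simp add: ratio_def cpoly_cnj)

definition ratio_deriv :: "real poly \<Rightarrow> real poly \<Rightarrow> complex \<Rightarrow> complex" where
  "ratio_deriv p q z = (cpoly (pderiv p) z * cpoly q z - cpoly p z * cpoly (pderiv q) z) / (cpoly q z)\<^sup>2"

lemma ratio_has_derivative:
  assumes "cpoly q z \<noteq> 0"
  shows "(ratio p q has_field_derivative ratio_deriv p q z) (at z)"
  unfolding ratio_def[abs_def] ratio_deriv_def power2_eq_square
  by (rule DERIV_divide cpoly_has_derivative assms)+

lemma continuous_ratio_deriv:
  assumes "continuous_on S f" "\<And>x. x \<in> S \<Longrightarrow> cpoly q (f x) \<noteq> 0"
  shows "continuous_on S (\<lambda>x. ratio_deriv p q (f x))"
  unfolding ratio_deriv_def by (intro continuous_intros continuous_cpoly assms) (use assms in auto)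

definition remainder_deriv :: "real poly \<Rightarrow> real poly \<Rightarrow> nat \<Rightarrow> complex \<Rightarrow> complex" where
  "remainder_deriv p q j z = cpoly (pderiv (poly_shift (Suc j) p)) z -
     (ratio_deriv p q z * cpoly (poly_shift (Suc j) q) z + cpoly (pderiv (poly_shift (Suc j) q)) z * ratio p q z)"

lemma remainder_coeff_has_derivative:
  assumes "cpoly q z \<noteq> 0"
  shows "(remainder_coeff p q j has_field_derivative remainder_deriv p q j z) (at z)"
  unfolding remainder_coeff_def[abs_def] remainder_deriv_def
  by (intro DERIV_diff DERIV_mult cpoly_has_derivative ratio_has_derivative assms)

text \<open>The same closed form \<open>Re (- \<i> h dz)\<close>, now with a scalar
  \<open>h\<close>; here its closedness comes from complex differentiability.\<close>

lemma scalar_green: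
  assumes "a \<le> b" "c \<le> d" and nz: "\<And>r \<theta>. r \<in> {a..b} \<Longrightarrow> \<theta> \<in> {c..d} \<Longrightarrow> cpoly q (r *\<^sub>R cis \<theta>) \<noteq> 0"
  shows "integral {a..b} (\<lambda>r. Re (- \<i> * cis d * remainder_coeff p q j (r *\<^sub>R cis d))) -
      integral {a..b} (\<lambda>r. Re (- \<i> * cis c * remainder_coeff p q j (r *\<^sub>R cis c))) =
    integral {c..d} (\<lambda>\<theta>. Re (b *\<^sub>R cis \<theta> * remainder_coeff p q j (b *\<^sub>R cis \<theta>)) - Re (a *\<^sub>R cis \<theta> * remainder_coeff p q j (a *\<^sub>R cis \<theta>)))"
proof -
  let ?h = "remainder_coeff p q j"
  define D where "D \<theta> r = Re (cis \<theta> * ?h (r *\<^sub>R cis \<theta>) + r *\<^sub>R (cis \<theta> * cis \<theta>) * remainder_deriv p q j (r *\<^sub>R cis \<theta>))" for \<theta> r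
  show ?thesis
  proof (rule green_rectangle[where u = "\<lambda>\<theta> r. Re (- \<i> * cis \<theta> * ?h (r *\<^sub>R cis \<theta>))" and w = "\<lambda>\<theta> r. Re (r *\<^sub>R cis \<theta> * ?h (r *\<^sub>R cis \<theta>))" and D = D])
    fix \<theta> r assume \<theta>: "\<theta> \<in> {c..d}" and r: "r \<in> {a..b}"
    note h = remainder_coeff_has_derivative[OF nz[OF r \<theta>], of p j]
    have cis: "(cis has_vector_derivative \<i> * cis \<theta>) (at \<theta> within {c..d})"
      using has_derivative_cis[OF has_derivative_ident, of \<theta> "{c..d}"] by (simp add: has_vector_derivative_def)
    have "((\<lambda>\<theta>. ?h (r *\<^sub>R cis \<theta>)) has_vector_derivative r *\<^sub>R (\<i> * cis \<theta>) * remainder_deriv p q j (r *\<^sub>R cis \<theta>)) (at \<theta> within {c..d})"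
      using field_vector_diff_chain_within[OF bounded_linear.has_vector_derivative[OF bounded_linear_scaleR_right cis] has_field_derivative_at_within[OF h]]
      by (simp add: o_def)
    from has_vector_derivative_mult[OF has_vector_derivative_mult_right[OF cis, of "- \<i>"] this]
    have "((\<lambda>\<theta>. - \<i> * cis \<theta> * ?h (r *\<^sub>R cis \<theta>)) has_vector_derivative
        cis \<theta> * ?h (r *\<^sub>R cis \<theta>) + r *\<^sub>R (cis \<theta> * cis \<theta>) * remainder_deriv p q j (r *\<^sub>R cis \<theta>)) (at \<theta> within {c..d})"
      by (simp add: algebra_simps)
    from bounded_linear.has_vector_derivative[OF bounded_linear_Re this]
    show "((\<lambda>\<theta>. Re (- \<i> * cis \<theta> * ?h (r *\<^sub>R cis \<theta>))) has_vector_derivative D \<theta> r) (at \<theta> within {c..d})"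
      unfolding D_def .
    have r1: "((\<lambda>r. r *\<^sub>R cis \<theta>) has_vector_derivative cis \<theta>) (at r within {a..b})"
      by (auto intro!: derivative_eq_intros)
    have "((\<lambda>r. ?h (r *\<^sub>R cis \<theta>)) has_vector_derivative cis \<theta> * remainder_deriv p q j (r *\<^sub>R cis \<theta>)) (at r within {a..b})"
      using field_vector_diff_chain_within[OF r1 has_field_derivative_at_within[OF h]]
      by (simp add: o_def)
    from has_vector_derivative_mult[OF r1 this]
    have "((\<lambda>r. r *\<^sub>R cis \<theta> * ?h (r *\<^sub>R cis \<theta>)) has_vector_derivative
        cis \<theta> * ?h (r *\<^sub>R cis \<theta>) + r *\<^sub>R (cis \<theta> * cis \<theta>) * remainder_deriv p q j (r *\<^sub>R cis \<theta>)) (at r within {a..b})"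
      by (simp add: algebra_simps)
    from bounded_linear.has_vector_derivative[OF bounded_linear_Re this]
    show "((\<lambda>r. Re (r *\<^sub>R cis \<theta> * ?h (r *\<^sub>R cis \<theta>))) has_vector_derivative D \<theta> r) (at r within {a..b})"
      unfolding D_def .
  next
    show "continuous_on ({c..d} \<times> {a..b}) (\<lambda>(\<theta>, r). D \<theta> r)"
      unfolding D_def case_prod_beta remainder_deriv_def
      by (intro continuous_intros continuous_remainder_coeff continuous_cpoly continuous_ratio continuous_ratio_deriv) (use nz in auto)
  next
    fix \<theta> assume "\<theta> \<in> {c..d}"
    then show "continuous_on {a..b} (\<lambda>r. Re (- \<i> * cis \<theta> * ?h (r *\<^sub>R cis \<theta>)))"
      by (intro continuous_intros continuous_remainder_coeff) (use nz in auto)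
  qed (use assms in auto)
qed

section \<open>The contour integral of a rational function\<close>

lemma integral_uniform_limit:
  fixes F :: "'b \<Rightarrow> real \<Rightarrow> 'a::banach"
  assumes "c \<le> d"
    and *: "\<And>e. e > 0 \<Longrightarrow> \<forall>\<^sub>F r in G. continuous_on {c..d} (F r) \<and> (\<forall>\<theta>\<in>{c..d}. norm (F r \<theta> - L) \<le> e)"
  shows "((\<lambda>r. integral {c..d} (F r)) \<longlongrightarrow> (d - c) *\<^sub>R L) G"
proof (rule tendstoI)
  fix e :: real assume "e > 0"
  \<comment> \<open>The summand 1 covers \<open>c = d\<close> and makes the final estimate
    strict.\<close>
  then have "e / (d - c + 1) > 0" using \<open>c \<le> d\<close> by simp
  from *[OF this] show "\<forall>\<^sub>F r in G. dist (integral {c..d} (F r)) ((d - c) *\<^sub>R L) < e"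
  proof eventually_elim
    case (elim r)
    then have int: "F r integrable_on {c..d}" by (auto intro: integrable_continuous_real)
    have "integral {c..d} (F r) - (d - c) *\<^sub>R L = integral {c..d} (\<lambda>\<theta>. F r \<theta> - L)"
      using int \<open>c \<le> d\<close> by (subst Henstock_Kurzweil_Integration.integral_diff) auto
    also have "norm \<dots> \<le> e / (d - c + 1) * (d - c)"
      by (rule integral_bound) (use elim \<open>c \<le> d\<close> in \<open>auto intro!: continuous_intros\<close>)
    also have "\<dots> < e" using \<open>e > 0\<close> \<open>c \<le> d\<close> by (simp add: field_simps)
    finally show ?case by (simp add: dist_norm)
  qed
qed

text \<open>Turns a limit in the plane into a statement about whole circles, uniform in the angle,
  as needed for integrals over arcs.\<close>

lemma eventually_circle_at_infinity:
  assumes "eventually Q (at_infinity :: complex filter)"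
  shows "\<forall>\<^sub>F r in at_top. r > 0 \<and> (\<forall>\<theta>. Q (r *\<^sub>R cis \<theta>))"
proof -
  obtain B where B: "\<And>z. cmod z \<ge> B \<Longrightarrow> Q z"
    using assms by (auto simp: eventually_at_infinity)
  show ?thesis
    using eventually_ge_at_top[of "max 1 B"] by eventually_elim (auto intro!: B simp: norm_mult)
qed

lemma eventually_circle_at_0:
  assumes "eventually Q (at (0 :: complex))"
  shows "\<forall>\<^sub>F r in at_right 0. r > 0 \<and> (\<forall>\<theta>. Q (r *\<^sub>R cis \<theta>))"
proof -
  obtain B where B: "B > 0" "\<And>z. z \<noteq> 0 \<Longrightarrow> cmod z < B \<Longrightarrow> Q z"
    using assms by (auto simp: eventually_at)
  have "\<forall>\<^sub>F r in at_right 0. r \<in> {0<..<B}"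
    by (rule eventually_at_right_real[OF B(1)])
  then show ?thesis
    by eventually_elim (auto intro!: B simp: norm_mult)
qed

context sector_resolvent
begin

text \<open>Horner's scheme run downwards from \<open>k = m\<close>: each step peels off one
  coefficient and uses \<open>moments\<close> once to trade a factor \<open>z\<close> for a factor
  \<open>T\<close>, at the price of one scalar multiple of \<open>B k\<close>. The complex scalar
  stays inside the first argument of \<open>P\<close>, where complex multiplication makes
  sense.\<close>

lemma moments_poly:
  assumes B: "moments m B" and z: "z \<in> upper_sector \<phi>" and deg: "degree r \<le> m"
  shows "P (c * cpoly r z) z o\<^sub>L B 0 = (P c z o\<^sub>L (\<Sum>i\<le>m. coeff r i *\<^sub>R B i)) +
    (\<Sum>j<m. Re (c * cpoly (poly_shift (Suc j) r) z) *\<^sub>R B j)"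
proof -
  have "P (c * cpoly (poly_shift k r) z) z o\<^sub>L B k = (P c z o\<^sub>L (\<Sum>i\<in>{k..m}. coeff r i *\<^sub>R B i)) +
    (\<Sum>j\<in>{k..<m}. Re (c * cpoly (poly_shift (Suc j) r) z) *\<^sub>R B j)" if "k \<le> m" for k
    using that
  proof (induction rule: inc_induct)
    case base
    have "poly_shift (Suc m) r = 0"
      using deg by (intro poly_eqI) (simp add: coeff_poly_shift coeff_eq_0)
    then have "cpoly (poly_shift m r) z = of_real (coeff r m)"
      by (simp add: cpoly_poly_shift[of m])
    then show ?case
      by (simp add: P_linear(3) mult.commute[of c] blinfun_compose_simps)
  next
    case (step k)
    let ?d = "c * cpoly (poly_shift (Suc k) r) z"
    have "P (c * cpoly (poly_shift k r) z) z = coeff r k *\<^sub>R P c z + P (?d * z) z"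
      unfolding cpoly_poly_shift[of k] by (simp add: algebra_simps flip: P_linear)
    then have "P (c * cpoly (poly_shift k r) z) z o\<^sub>L B k =
      coeff r k *\<^sub>R (P c z o\<^sub>L B k) + (P ?d z o\<^sub>L B (Suc k)) + Re ?d *\<^sub>R B k"
      using B z step.hyps unfolding moments_def by (simp add: blinfun_compose_simps)
    then show ?case
      using step by (simp add: blinfun_compose_simps sum.atLeast_Suc_atMost[of k m] sum.atLeast_Suc_lessThan[of k m] algebra_simps)
  qed
  from this[of 0] show ?thesis by (simp add: atMost_atLeast0 atLeast0LessThan)
qed

text \<open>\<open>moments_poly\<close> is applied to \<open>p\<close> with scalar \<open>c\<close>
  and to \<open>q\<close> with scalar \<open>c f\<close>. The left sides agree because
  \<open>f q = p\<close>, and \<open>q\<close> turns the sum of the \<open>B i\<close> into the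
  identity, which isolates \<open>P (c f)\<close>.\<close>

lemma P_ratio:
  assumes B: "moments m B" and deg: "degree p \<le> m" "degree q \<le> m"
    and q: "(\<Sum>i\<le>m. coeff q i *\<^sub>R B i) = id_blinfun"
    and z: "z \<in> upper_sector \<phi>" "cpoly q z \<noteq> 0"
  shows "P (c * ratio p q z) z = (P c z o\<^sub>L (\<Sum>i\<le>m. coeff p i *\<^sub>R B i)) +
    (\<Sum>j<m. Re (c * remainder_coeff p q j z) *\<^sub>R B j)"
proof -
  have cancel: "X = Y + a" if "W = X + b" "a = d - b" "W = Y + d" for W X Y a b d :: "'a \<Rightarrow>\<^sub>L 'a"
    using that by simp (metis add_diff_cancel_right' add_diff_eq)
  have "P (c * cpoly p z) z o\<^sub>L B 0 = P (c * ratio p q z) z +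
      (\<Sum>j<m. Re (c * ratio p q z * cpoly (poly_shift (Suc j) q) z) *\<^sub>R B j)"
    using moments_poly[OF B z(1) deg(2), of "c * ratio p q z"] z(2) unfolding q
    by (simp add: ratio_def compose_id_blinfun)
  moreover have "(\<Sum>j<m. Re (c * remainder_coeff p q j z) *\<^sub>R B j) =
     (\<Sum>j<m. Re (c * cpoly (poly_shift (Suc j) p) z) *\<^sub>R B j) - (\<Sum>j<m. Re (c * ratio p q z * cpoly (poly_shift (Suc j) q) z) *\<^sub>R B j)"
    unfolding sum_subtractf[symmetric] remainder_coeff_def
    by (intro sum.cong refl) (simp add: algebra_simps)
  ultimately show ?thesis
    using moments_poly[OF B z(1) deg(1), of c] by (rule cancel)
qed


text \<open>The imaginary part of \<open>f(z) R(z) dz/dr\<close> on the ray of angle \<theta>, since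
  \<open>Re (- \<i> x) = Im x\<close>.\<close>

definition cauchy_integrand :: "real poly \<Rightarrow> real poly \<Rightarrow> real \<Rightarrow> real \<Rightarrow> 'a \<Rightarrow>\<^sub>L 'a" where
  "cauchy_integrand p q \<theta> r = P (- \<i> * cis \<theta> * ratio p q (r *\<^sub>R cis \<theta>)) (r *\<^sub>R cis \<theta>)"

lemma cauchy_integral:
  assumes B: "moments m B" and deg: "degree p < degree q" "degree q \<le> m"
    and q: "(\<Sum>i\<le>m. coeff q i *\<^sub>R B i) = id_blinfun"
    and q0: "cpoly q 0 \<noteq> 0" and p0: "cpoly p 0 = 0"
    and nz: "\<And>r \<theta>. r > 0 \<Longrightarrow> \<theta> \<in> {0..\<phi>} \<union> {pi - \<phi>..pi} \<Longrightarrow> cpoly q (r *\<^sub>R cis \<theta>) \<noteq> 0"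
  shows "(\<lambda>n. integral {inverse (real (Suc n))..real (Suc n)} (cauchy_integrand p q (pi - \<phi>)) -
      integral {inverse (real (Suc n))..real (Suc n)} (cauchy_integrand p q \<phi>))
    \<longlonglongrightarrow> pi *\<^sub>R (\<Sum>i\<le>m. coeff p i *\<^sub>R B i)"
proof -
  define A where "A = (\<Sum>i\<le>m. coeff p i *\<^sub>R B i)"
  define \<sigma> where "\<sigma> j r \<theta> = Re (r *\<^sub>R cis \<theta> * remainder_coeff p q j (r *\<^sub>R cis \<theta>))" for j r \<theta>
  define I where "I = {0..\<phi>} \<union> {\<phi>..pi - \<phi>} \<union> {pi - \<phi>..pi}"
  \<comment> \<open>Boundary term at radius \<open>r\<close>: the arc outside the double sector
    carries \<open>R A\<close>, the two arcs inside it carry the scalars. It plays the role of a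
    primitive for the truncated integral.\<close>
  define \<Lambda> where "\<Lambda> r = integral {\<phi>..pi - \<phi>} (\<lambda>\<theta>. P (r *\<^sub>R cis \<theta>) (r *\<^sub>R cis \<theta>) o\<^sub>L A) -
    (\<Sum>j<m. (integral {0..\<phi>} (\<sigma> j r) + integral {pi - \<phi>..pi} (\<sigma> j r)) *\<^sub>R B j)" for r
  have P_ratio': "P (c * ratio p q z) z = (P c z o\<^sub>L A) + (\<Sum>j<m. Re (c * remainder_coeff p q j z) *\<^sub>R B j)"
    if "z \<in> upper_sector \<phi>" "cpoly q z \<noteq> 0" for c z
    unfolding A_def using deg by (intro P_ratio B q that) auto
  have \<sigma>_cont: "continuous_on {c..d} (\<sigma> j r)" if "\<And>\<theta>. \<theta> \<in> {c..d} \<Longrightarrow> cpoly q (r *\<^sub>R cis \<theta>) \<noteq> 0" for c d j r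
    unfolding \<sigma>_def by (intro continuous_intros continuous_remainder_coeff that)
  have split: "integral {a..b} (cauchy_integrand p q (pi - \<phi>)) - integral {a..b} (cauchy_integrand p q \<phi>) = \<Lambda> b - \<Lambda> a"
    if ab: "0 < a" "a \<le> b" for a b
  proof -
    let ?u = "\<lambda>\<theta> j r. Re (- \<i> * cis \<theta> * remainder_coeff p q j (r *\<^sub>R cis \<theta>))"
    have int_u: "?u \<theta> j integrable_on {a..b}" if "\<theta> \<in> {\<phi>, pi - \<phi>}" for \<theta> j
      by (intro integrable_continuous_real continuous_intros continuous_remainder_coeff nz) (use that ab angle in auto)
    have int_P: "(\<lambda>r. P (- \<i> * cis \<theta>) (r *\<^sub>R cis \<theta>)) integrable_on {a..b}" if "\<theta> \<in> {\<phi>, pi - \<phi>}" for \<theta>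
      by (intro integrable_continuous_real continuous_P continuous_intros) (use that ab angle in auto)
    have comp: "bounded_linear (\<lambda>X. X o\<^sub>L A)"
      by (rule bounded_bilinear.bounded_linear_left[OF bounded_bilinear_blinfun_compose])
    have rays: "integral {a..b} (cauchy_integrand p q \<theta>) =
      (integral {a..b} (\<lambda>r. P (- \<i> * cis \<theta>) (r *\<^sub>R cis \<theta>)) o\<^sub>L A) + (\<Sum>j<m. integral {a..b} (?u \<theta> j) *\<^sub>R B j)"
      if \<theta>: "\<theta> \<in> {\<phi>, pi - \<phi>}" for \<theta>
    proof -
      have "((\<lambda>r. (P (- \<i> * cis \<theta>) (r *\<^sub>R cis \<theta>) o\<^sub>L A) + (\<Sum>j<m. ?u \<theta> j r *\<^sub>R B j)) has_integral
        (integral {a..b} (\<lambda>r. P (- \<i> * cis \<theta>) (r *\<^sub>R cis \<theta>)) o\<^sub>L A) + (\<Sum>j<m. integral {a..b} (?u \<theta> j) *\<^sub>R B j)) {a..b}"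
        using has_integral_linear[OF integrable_integral[OF int_P[OF \<theta>]] comp]
        by (intro has_integral_add has_integral_sum has_integral_scaleR_left integrable_integral int_u \<theta>)
          (auto simp: o_def)
      then have "(cauchy_integrand p q \<theta> has_integral
        (integral {a..b} (\<lambda>r. P (- \<i> * cis \<theta>) (r *\<^sub>R cis \<theta>)) o\<^sub>L A) + (\<Sum>j<m. integral {a..b} (?u \<theta> j) *\<^sub>R B j)) {a..b}"
        by (rule has_integral_eq[rotated])
          (unfold cauchy_integrand_def, rule P_ratio'[symmetric], use \<theta> ab angle nz in auto)
      then show ?thesis by (rule integral_unique)
    qed
    \<comment> \<open>On the real axis \<open>dz\<close> and the remainder coefficients are real, so
      multiplication by \<open>- \<i>\<close> leaves no real part. Green's theorem on the wedge
      between axis and ray thus involves only the ray and two arcs.\<close>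
    have real0: "?u \<theta> j r = 0" if "\<theta> \<in> {0, pi}" for \<theta> j r
    proof -
      have "cis \<theta> \<in> \<real>" using that by auto
      then have "cis \<theta> * remainder_coeff p q j (r *\<^sub>R cis \<theta>) \<in> \<real>"
        by (intro Reals_mult remainder_coeff_Reals) (simp_all add: scaleR_conv_of_real)
      then show ?thesis by (auto simp: complex_is_Real_iff)
    qed
    have int_\<sigma>: "\<sigma> j r integrable_on {c..d}" if "{c..d} \<subseteq> {0..\<phi>} \<union> {pi - \<phi>..pi}" "r \<in> {a, b}" for c d j r
      by (intro integrable_continuous_real \<sigma>_cont nz) (use that ab in auto)
    have edge: "integral {a..b} (?u d j) - integral {a..b} (?u c j) = integral {c..d} (\<sigma> j b) - integral {c..d} (\<sigma> j a)"
      if "{c..d} \<subseteq> {0..\<phi>} \<union> {pi - \<phi>..pi}" "c \<le> d" for c d j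
    proof -
      have "integral {a..b} (?u d j) - integral {a..b} (?u c j) = integral {c..d} (\<lambda>\<theta>. \<sigma> j b \<theta> - \<sigma> j a \<theta>)"
        unfolding \<sigma>_def
      proof (rule scalar_green)
        fix r \<theta> assume "r \<in> {a..b}" "\<theta> \<in> {c..d}"
        then show "cpoly q (r *\<^sub>R cis \<theta>) \<noteq> 0"
          using that(1) ab by (intro nz) auto
      qed (use that ab in auto)
      then show ?thesis
        using int_\<sigma>[OF that(1)] by (simp only: Henstock_Kurzweil_Integration.integral_diff insertI1 insertI2)
    qed
    have real0': "integral {a..b} (?u \<theta> j) = 0" if "\<theta> \<in> {0, pi}" for \<theta> j
      by (simp only: real0[OF that] integral_0)
    have s1: "integral {a..b} (?u \<phi> j) = integral {0..\<phi>} (\<sigma> j b) - integral {0..\<phi>} (\<sigma> j a)" for j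
      using edge[of 0 \<phi> j] real0'[of 0 j] angle by simp
    \<comment> \<open>The sign differs from \<open>s1\<close> because the ray is now the lower edge
      of its wedge.\<close>
    have s2: "integral {a..b} (?u (pi - \<phi>) j) = integral {pi - \<phi>..pi} (\<sigma> j a) - integral {pi - \<phi>..pi} (\<sigma> j b)" for j
      using edge[of "pi - \<phi>" pi j] real0'[of pi j] angle by simp
    have cont_PP: "continuous_on {\<phi>..pi - \<phi>} (\<lambda>\<theta>. P (r *\<^sub>R cis \<theta>) (r *\<^sub>R cis \<theta>))" if "r > 0" for r
      by (intro continuous_P continuous_intros) (use that in auto)
    have PA: "integral {\<phi>..pi - \<phi>} (\<lambda>\<theta>. P (b *\<^sub>R cis \<theta>) (b *\<^sub>R cis \<theta>) - P (a *\<^sub>R cis \<theta>) (a *\<^sub>R cis \<theta>)) o\<^sub>L A =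
      integral {\<phi>..pi - \<phi>} (\<lambda>\<theta>. P (b *\<^sub>R cis \<theta>) (b *\<^sub>R cis \<theta>) o\<^sub>L A) - integral {\<phi>..pi - \<phi>} (\<lambda>\<theta>. P (a *\<^sub>R cis \<theta>) (a *\<^sub>R cis \<theta>) o\<^sub>L A)"
    proof -
      have "integral {\<phi>..pi - \<phi>} (\<lambda>\<theta>. P (r *\<^sub>R cis \<theta>) (r *\<^sub>R cis \<theta>) o\<^sub>L A) = integral {\<phi>..pi - \<phi>} (\<lambda>\<theta>. P (r *\<^sub>R cis \<theta>) (r *\<^sub>R cis \<theta>)) o\<^sub>L A"
        if "r > 0" for r
        using integral_linear[OF integrable_continuous_real[OF cont_PP[OF that]] comp] by (simp add: o_def)
      then show ?thesis
        using ab by (simp add: Henstock_Kurzweil_Integration.integral_diff integrable_continuous_real cont_PP blinfun_compose_simps)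
    qed
    have "integral {a..b} (cauchy_integrand p q (pi - \<phi>)) - integral {a..b} (cauchy_integrand p q \<phi>) =
      ((integral {a..b} (\<lambda>r. P (- \<i> * cis (pi - \<phi>)) (r *\<^sub>R cis (pi - \<phi>))) - integral {a..b} (\<lambda>r. P (- \<i> * cis \<phi>) (r *\<^sub>R cis \<phi>))) o\<^sub>L A)
      - (\<Sum>j<m. (integral {a..b} (?u \<phi> j) - integral {a..b} (?u (pi - \<phi>) j)) *\<^sub>R B j)"
      by (simp add: rays blinfun_compose_simps scaleR_diff_left sum_subtractf)
    also have "\<dots> = \<Lambda> b - \<Lambda> a"
      unfolding P_green[OF ab] PA \<Lambda>_def
      by (simp only: s1 s2) (simp add: algebra_simps sum_subtractf sum.distrib)
    finally show ?thesis .
  qed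
  \<comment> \<open>One statement for both ends: \<open>\<G>\<close> is the filter of points in the
    plane, \<open>G\<close> the corresponding filter of radii. The contribution of
    \<open>z f R\<close> vanishes because \<open>R\<close> is \<open>O(1/|z|)\<close> and
    \<open>f\<close> tends to 0.\<close>
  have limit: "(\<Lambda> \<longlongrightarrow> - (pi *\<^sub>R (\<Sum>j<m. l j *\<^sub>R B j))) G"
    if ev: "\<And>Q. eventually Q \<G> \<Longrightarrow> \<forall>\<^sub>F r in G. r > 0 \<and> (\<forall>\<theta>. Q (r *\<^sub>R cis \<theta>))"
      and nzG: "\<forall>\<^sub>F z in \<G>. cpoly q z \<noteq> 0" and f: "(ratio p q \<longlongrightarrow> 0) \<G>"
      and g: "\<And>j. j < m \<Longrightarrow> ((\<lambda>z. z * remainder_coeff p q j z) \<longlongrightarrow> of_real (l j)) \<G>"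
    for \<G> G l
  proof -
    have nz': "\<forall>\<^sub>F r in G. r > 0 \<and> (\<forall>\<theta>. cpoly q (r *\<^sub>R cis \<theta>) \<noteq> 0)"
      by (rule ev[OF nzG])
    have "((\<lambda>r. integral {\<phi>..pi - \<phi>} (\<lambda>\<theta>. P (r *\<^sub>R cis \<theta> * ratio p q (r *\<^sub>R cis \<theta>)) (r *\<^sub>R cis \<theta>))) \<longlongrightarrow> (pi - \<phi> - \<phi>) *\<^sub>R 0) G"
    proof (rule integral_uniform_limit)
      fix e :: real assume "e > 0"
      have "((\<lambda>z. 2 * C * cmod (ratio p q z)) \<longlongrightarrow> 2 * C * 0) \<G>"
        by (intro tendsto_mult tendsto_const tendsto_norm_zero f)
      then have "\<forall>\<^sub>F z in \<G>. 2 * C * cmod (ratio p q z) < e"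
        using \<open>e > 0\<close> by (intro order_tendstoD) auto
      from ev[OF this] nz'
      show "\<forall>\<^sub>F r in G. continuous_on {\<phi>..pi - \<phi>} (\<lambda>\<theta>. P (r *\<^sub>R cis \<theta> * ratio p q (r *\<^sub>R cis \<theta>)) (r *\<^sub>R cis \<theta>)) \<and>
        (\<forall>\<theta>\<in>{\<phi>..pi - \<phi>}. norm (P (r *\<^sub>R cis \<theta> * ratio p q (r *\<^sub>R cis \<theta>)) (r *\<^sub>R cis \<theta>) - 0) \<le> e)"
      proof eventually_elim
        case (elim r)
        have "norm (P (r *\<^sub>R cis \<theta> * ratio p q (r *\<^sub>R cis \<theta>)) (r *\<^sub>R cis \<theta>)) \<le> e" if "\<theta> \<in> {\<phi>..pi - \<phi>}" for \<theta>
        proof -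
          have "norm (P (r *\<^sub>R cis \<theta> * ratio p q (r *\<^sub>R cis \<theta>)) (r *\<^sub>R cis \<theta>)) \<le> 2 * C * cmod (ratio p q (r *\<^sub>R cis \<theta>))"
            using norm_P[OF upper_sectorI[of r \<phi> \<theta>], of "r *\<^sub>R cis \<theta> * ratio p q (r *\<^sub>R cis \<theta>)"] elim that
            by (simp add: norm_mult)
          then show ?thesis using elim less_imp_le order_trans by blast
        qed
        moreover have "continuous_on {\<phi>..pi - \<phi>} (\<lambda>\<theta>. P (r *\<^sub>R cis \<theta> * ratio p q (r *\<^sub>R cis \<theta>)) (r *\<^sub>R cis \<theta>))"
          by (intro continuous_P continuous_intros continuous_ratio) (use elim in auto)
        ultimately show ?case by simp
      qed
    qed (use angle in auto)
    moreover have "((\<lambda>r. \<Sum>j<m. integral {0..pi} (\<sigma> j r) *\<^sub>R B j) \<longlongrightarrow> (\<Sum>j<m. ((pi - 0) *\<^sub>R l j) *\<^sub>R B j)) G"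
    proof (intro tendsto_sum tendsto_scaleR tendsto_const integral_uniform_limit)
      fix j and e :: real assume j: "j \<in> {..<m}" and "e > 0"
      have "\<forall>\<^sub>F z in \<G>. cmod (z * remainder_coeff p q j z - of_real (l j)) < e"
        using tendstoD[OF g \<open>e > 0\<close>] j by (simp add: dist_norm)
      from ev[OF this] nz'
      show "\<forall>\<^sub>F r in G. continuous_on {0..pi} (\<sigma> j r) \<and> (\<forall>\<theta>\<in>{0..pi}. norm (\<sigma> j r \<theta> - l j) \<le> e)"
      proof eventually_elim
        case (elim r)
        have "norm (\<sigma> j r \<theta> - l j) \<le> e" for \<theta>
          using abs_Re_le_cmod[of "r *\<^sub>R cis \<theta> * remainder_coeff p q j (r *\<^sub>R cis \<theta>) - of_real (l j)"] elim
          unfolding \<sigma>_def by (metis Re_complex_of_real less_imp_le minus_complex.simps(1) order_trans real_norm_def)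
        then show ?case using elim by (auto intro!: \<sigma>_cont)
      qed
    qed auto
    ultimately have "((\<lambda>r. integral {\<phi>..pi - \<phi>} (\<lambda>\<theta>. P (r *\<^sub>R cis \<theta> * ratio p q (r *\<^sub>R cis \<theta>)) (r *\<^sub>R cis \<theta>)) -
       (\<Sum>j<m. integral {0..pi} (\<sigma> j r) *\<^sub>R B j)) \<longlongrightarrow> (pi - \<phi> - \<phi>) *\<^sub>R 0 - (\<Sum>j<m. ((pi - 0) *\<^sub>R l j) *\<^sub>R B j)) G"
      by (rule tendsto_diff)
    \<comment> \<open>Adding and subtracting the scalar terms on the middle arc turns
      \<open>R A\<close> back into \<open>f R\<close> there and completes the scalar arcs to the
      half circle from \<open>0\<close> to \<open>pi\<close>. Its length is the source of the factor
      \<open>pi\<close>.\<close>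
    moreover have "\<forall>\<^sub>F r in G. integral {\<phi>..pi - \<phi>} (\<lambda>\<theta>. P (r *\<^sub>R cis \<theta> * ratio p q (r *\<^sub>R cis \<theta>)) (r *\<^sub>R cis \<theta>)) -
       (\<Sum>j<m. integral {0..pi} (\<sigma> j r) *\<^sub>R B j) = \<Lambda> r"
      using nz'
    proof eventually_elim
      case (elim r)
      have int_\<sigma>: "\<sigma> j r integrable_on {c..d}" for c d j
        by (intro integrable_continuous_real \<sigma>_cont) (use elim in auto)
      have "(\<lambda>\<theta>. P (r *\<^sub>R cis \<theta>) (r *\<^sub>R cis \<theta>) o\<^sub>L A) integrable_on {\<phi>..pi - \<phi>}"
        by (intro integrable_continuous_real continuous_intros continuous_P) (use elim in auto)
      then have "((\<lambda>\<theta>. (P (r *\<^sub>R cis \<theta>) (r *\<^sub>R cis \<theta>) o\<^sub>L A) + (\<Sum>j<m. \<sigma> j r \<theta> *\<^sub>R B j)) has_integral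
         integral {\<phi>..pi - \<phi>} (\<lambda>\<theta>. P (r *\<^sub>R cis \<theta>) (r *\<^sub>R cis \<theta>) o\<^sub>L A) + (\<Sum>j<m. integral {\<phi>..pi - \<phi>} (\<sigma> j r) *\<^sub>R B j)) {\<phi>..pi - \<phi>}"
        by (intro has_integral_add has_integral_sum has_integral_scaleR_left integrable_integral int_\<sigma>) auto
      then have "((\<lambda>\<theta>. P (r *\<^sub>R cis \<theta> * ratio p q (r *\<^sub>R cis \<theta>)) (r *\<^sub>R cis \<theta>)) has_integral
         integral {\<phi>..pi - \<phi>} (\<lambda>\<theta>. P (r *\<^sub>R cis \<theta>) (r *\<^sub>R cis \<theta>) o\<^sub>L A) + (\<Sum>j<m. integral {\<phi>..pi - \<phi>} (\<sigma> j r) *\<^sub>R B j)) {\<phi>..pi - \<phi>}"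
        by (rule has_integral_eq[rotated]) (unfold \<sigma>_def, rule P_ratio'[symmetric], use elim in auto)
      note integral_unique[OF this]
      moreover have "integral {0..pi} (\<sigma> j r) = integral {0..\<phi>} (\<sigma> j r) + integral {\<phi>..pi - \<phi>} (\<sigma> j r) + integral {pi - \<phi>..pi} (\<sigma> j r)" for j
        using Henstock_Kurzweil_Integration.integral_combine[of 0 \<phi> "pi - \<phi>" "\<sigma> j r"]
          Henstock_Kurzweil_Integration.integral_combine[of 0 "pi - \<phi>" pi "\<sigma> j r"] int_\<sigma> angle by simp
      ultimately show ?case
        by (simp add: \<Lambda>_def scaleR_add_left sum.distrib)
    qed
    ultimately show ?thesis
      by (simp add: tendsto_cong scaleR_sum_right)
  qed
  have "(\<Lambda> \<longlongrightarrow> - (pi *\<^sub>R (\<Sum>j<m. (- coeff p j) *\<^sub>R B j))) at_top"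
    using deg eventually_circle_at_infinity
    by (intro limit[of at_infinity] eventually_cpoly_nonzero_at_infinity ratio_at_infinity)
      (auto simp: remainder_coeff_at_infinity)
  \<comment> \<open>The sum on the left stops before \<open>m\<close>; the term of index
    \<open>m\<close> is 0 because \<open>degree p < m\<close>.\<close>
  moreover have "- (pi *\<^sub>R (\<Sum>j<m. (- coeff p j) *\<^sub>R B j)) = pi *\<^sub>R A"
    using deg by (simp add: A_def sum_negf coeff_eq_0 flip: lessThan_Suc_atMost)
  ultimately have top: "(\<Lambda> \<longlongrightarrow> pi *\<^sub>R A) at_top" by simp
  \<comment> \<open>The remainder coefficients are continuous at 0, as \<open>q\<close> does not
    vanish there, so the factor \<open>z\<close> sends each product to 0.\<close>
  have "(\<Lambda> \<longlongrightarrow> - (pi *\<^sub>R (\<Sum>j<m. 0 *\<^sub>R B j))) (at_right 0)"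
  proof (rule limit[OF eventually_circle_at_0])
    have "isCont (cpoly q) 0" "isCont (ratio p q) 0" "isCont (\<lambda>z. z * remainder_coeff p q j z) 0" for j
      using DERIV_isCont[OF cpoly_has_derivative] DERIV_isCont[OF ratio_has_derivative[OF q0]]
        DERIV_isCont[OF remainder_coeff_has_derivative[OF q0]] by (auto intro!: continuous_intros)
    then have *: "(cpoly q \<longlongrightarrow> cpoly q 0) (at 0)" "(ratio p q \<longlongrightarrow> ratio p q 0) (at 0)"
      "((\<lambda>z. z * remainder_coeff p q j z) \<longlongrightarrow> 0 * remainder_coeff p q j 0) (at 0)" for j
      by (auto simp: isCont_def)
    show "\<forall>\<^sub>F z in at 0. cpoly q z \<noteq> 0" by (rule tendsto_imp_eventually_ne[OF *(1) q0])
    show "(ratio p q \<longlongrightarrow> 0) (at 0)" using *(2) p0 by (simp add: ratio_def)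
    show "((\<lambda>z. z * remainder_coeff p q j z) \<longlongrightarrow> of_real 0) (at 0)" for j using *(3) by simp
  qed
  then have bot: "(\<Lambda> \<longlongrightarrow> 0) (at_right 0)" by simp
  have l1: "filterlim (\<lambda>n. real (Suc n)) at_top sequentially"
    by (rule filterlim_compose[OF filterlim_real_sequentially filterlim_Suc])
  have l2: "filterlim (\<lambda>n. inverse (real (Suc n))) (at_right 0) sequentially"
    by (rule filterlim_compose[OF filterlim_inverse_at_right_top l1])
  have le: "inverse (real (Suc n)) \<le> real (Suc n)" for n
    by (rule order_trans[of _ 1]) (simp_all add: inverse_eq_divide)
  have "(\<lambda>n. \<Lambda> (real (Suc n)) - \<Lambda> (inverse (real (Suc n)))) \<longlonglongrightarrow> pi *\<^sub>R A - 0"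
    by (intro tendsto_diff filterlim_compose[OF top l1] filterlim_compose[OF bot l2])
  then show ?thesis
    unfolding A_def[symmetric] by (subst split) (use le in auto)
qed

end

section \<open>Complex planes in the paravectors\<close>

definition emb :: "'n::{finite,linorder} clifford \<Rightarrow> complex \<Rightarrow> 'n clifford" where
  "emb J z = of_real (Re z) + Im z *\<^sub>R J"

lemma sphere_units_nonempty: "gen i \<in> sphere_units"
proof -
  have *: "gen i = of_real 0 + (\<Sum>j\<in>UNIV. (if j = i then 1 else 0) *\<^sub>R gen j)"
    by (simp add: if_distrib[of "\<lambda>x. x *\<^sub>R _"] cong: if_cong)
  have "(norm (gen i))\<^sup>2 = 1"
    by (subst *, subst norm_paravector) (simp add: if_distrib[of "\<lambda>x. x\<^sup>2"] cong: if_cong)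
  then have "norm (gen i) = 1"
    using norm_ge_zero[of "gen i"] by (simp add: power2_eq_1_iff)
  moreover have "gen i \<in> paravectors"
    unfolding paravectors_def mem_Collect_eq by (intro exI conjI, rule *) simp
  moreover have "real_part (gen i) = 0"
    unfolding real_part_def by (subst *, subst coords_paravector) simp
  ultimately show ?thesis by (simp add: sphere_units_def)
qed

lemma real_part_add: "real_part (s + t) = real_part s + real_part t"
  by (simp add: real_part_def plus_clifford.rep_eq)

lemma real_part_scaleR: "real_part (r *\<^sub>R s) = r * real_part s"
  by (simp add: real_part_def scaleR_clifford.rep_eq)

lemma bounded_linear_real_part: "bounded_linear real_part"
proof (rule bounded_linear_intro[where K = 1])
  show "norm (real_part s) \<le> norm s * 1" for s :: "'a clifford"
    unfolding real_part_def using Finite_Cartesian_Product.norm_nth_le[of "coords s" "{}"] by (simp add: norm_clifford.rep_eq)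
qed (simp_all add: real_part_add real_part_scaleR)

lemma sphere_unitsE:
  fixes J :: "'n::{finite,linorder} clifford"
  assumes "J \<in> sphere_units"
  obtains y where "J = (\<Sum>i\<in>UNIV. y i *\<^sub>R gen i)" "(\<Sum>i\<in>UNIV. (y i)\<^sup>2) = 1"
proof -
  obtain x y where J: "J = of_real x + (\<Sum>i\<in>UNIV. y i *\<^sub>R gen i)"
    using assms by (auto simp: sphere_units_def paravectors_def)
  then have x: "x = 0"
    using assms coords_paravector(1)[of x y] by (simp add: sphere_units_def real_part_def)
  have "(\<Sum>i\<in>UNIV. (y i)\<^sup>2) = 1"
    using norm_paravector[of x y] assms unfolding J[symmetric] by (simp add: x sphere_units_def)
  with J x show ?thesis by (intro that) auto
qed

lemma sphere_units_square: "J \<in> sphere_units \<Longrightarrow> J * J = - 1"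
  by (erule sphere_unitsE) (simp add: vector_square)

lemma emb_paravector:
  assumes "J \<in> sphere_units"
  shows "emb J z \<in> paravectors" "real_part (emb J z) = Re z" "norm (emb J z) = cmod z" "pconj (emb J z) = emb J (cnj z)"
proof -
  obtain y where J: "J = (\<Sum>i\<in>UNIV. y i *\<^sub>R gen i)" and y: "(\<Sum>i\<in>UNIV. (y i)\<^sup>2) = 1"
    using assms by (rule sphere_unitsE)
  have e: "emb J z = of_real (Re z) + (\<Sum>i\<in>UNIV. (Im z * y i) *\<^sub>R gen i)"
    by (simp add: emb_def J scaleR_sum_right)
  show "emb J z \<in> paravectors"
    unfolding paravectors_def mem_Collect_eq by (intro exI conjI, rule e) simp
  show r: "real_part (emb J z) = Re z" unfolding e real_part_def by (rule coords_paravector)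
  have "(norm (emb J z))\<^sup>2 = (cmod z)\<^sup>2"
    unfolding e norm_paravector by (simp add: power_mult_distrib y cmod_power2 flip: sum_distrib_left)
  then show "norm (emb J z) = cmod z" by (simp add: power2_eq_iff_nonneg)
  have "(\<Sum>i\<in>UNIV. (coords (emb J z) $ {i}) *\<^sub>R gen i) = Im z *\<^sub>R J"
    unfolding e coords_paravector by (simp add: J scaleR_sum_right)
  then show "pconj (emb J z) = emb J (cnj z)"
    unfolding pconj_def r by (simp add: emb_def)
qed

lemma emb_linear: "emb J (z + w) = emb J z + emb J w" "emb J (r *\<^sub>R z) = r *\<^sub>R emb J z"
    "emb J (z - w) = emb J z - emb J w" "emb J (- z) = - emb J z"
  by (simp_all add: emb_def algebra_simps of_real_def)

lemma emb_simps [simp]: "emb J (of_real r) = of_real r" "emb J \<i> = J" "emb J 0 = 0" "emb J 1 = 1"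
  by (simp_all add: emb_def)

lemma emb_mult: "J \<in> sphere_units \<Longrightarrow> emb J (z * w) = emb J z * emb J w"
  by (simp add: emb_def algebra_simps of_real_def sphere_units_square scaleR_diff_left scaleR_add_left)

lemma emb_power: "J \<in> sphere_units \<Longrightarrow> emb J (z ^ k) = emb J z ^ k"
  by (induction k) (simp_all add: emb_mult)

lemma emb_sum: "emb J (sum f A) = (\<Sum>a\<in>A. emb J (f a))"
  by (induction A rule: infinite_finite_induct) (simp_all add: emb_linear)

lemma emb_cexp: "r *\<^sub>R cexp J \<phi> = emb J (r *\<^sub>R cis \<phi>)"
  by (simp add: emb_def cexp_def scaleR_add_right of_real_def)

lemma emb_eq_0_iff: "J \<in> sphere_units \<Longrightarrow> emb J z = 0 \<longleftrightarrow> z = 0"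
  using emb_paravector(3)[of J z] by (metis norm_eq_zero)

lemma cpoly_altdef: "cpoly p z = (\<Sum>k\<le>degree p. coeff p k *\<^sub>R z ^ k)"
  by (simp add: cpoly_def poly_altdef degree_cpoly coeff_map_poly scaleR_conv_of_real)

lemma cl_poly_emb: "J \<in> sphere_units \<Longrightarrow> cl_poly p (emb J z) = emb J (cpoly p z)"
  by (simp add: cl_poly_def cpoly_altdef emb_sum emb_linear emb_power)

lemma pinv_emb:
  assumes "J \<in> sphere_units"
  shows "pinv (emb J z) = emb J (inverse z)"
proof -
  have "inverse z = (1 / (cmod z)\<^sup>2) *\<^sub>R cnj z"
    by (simp add: complex_eq_iff cmod_power2)
  then show ?thesis
    using assms by (simp only: pinv_def emb_paravector emb_linear)
qed

lemma norm_emb_vector_part: "J \<in> sphere_units \<Longrightarrow> norm (emb J z - of_real (real_part (emb J z))) = \<bar>Im z\<bar>"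
  by (simp only: emb_paravector(2)) (simp add: emb_def sphere_units_def)

lemma cl_quotient_emb: "J \<in> sphere_units \<Longrightarrow> cl_quotient p q (emb J z) = emb J (ratio p q z)"
  by (simp add: cl_quotient_def cl_poly_emb pinv_emb ratio_def divide_inverse emb_mult)

lemma paravectors_emb:
  fixes s :: "'n::{finite,linorder} clifford"
  assumes "s \<in> paravectors"
  obtains J z where "J \<in> sphere_units" "s = emb J z"
proof -
  obtain x y where s: "s = of_real x + (\<Sum>i\<in>UNIV. y i *\<^sub>R gen i)"
    using assms by (auto simp: paravectors_def)
  define n where "n = sqrt (\<Sum>i\<in>UNIV. (y i)\<^sup>2)"
  have n2: "n\<^sup>2 = (\<Sum>i\<in>UNIV. (y i)\<^sup>2)" unfolding n_def by (simp add: sum_nonneg)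
  show ?thesis
  proof (cases "n = 0")
    case True
    then have "y i = 0" for i
      using n2 sum_nonneg_eq_0_iff[of UNIV "\<lambda>i. (y i)\<^sup>2"] by simp
    \<comment> \<open>A real number lies in every complex plane, so any unit serves.\<close>
    then have "s = emb (gen undefined) (of_real x)" by (simp add: s)
    then show ?thesis using that sphere_units_nonempty by blast
  next
    case False
    define J where "J = of_real 0 + (\<Sum>i\<in>UNIV. (y i / n) *\<^sub>R gen i)"
    have "(norm J)\<^sup>2 = 1"
      unfolding J_def norm_paravector using False by (simp add: power_divide n2[symmetric] flip: sum_divide_distrib)
    then have "norm J = 1"
      using norm_ge_zero[of J] by (simp add: power2_eq_1_iff)
    then have "J \<in> sphere_units"
      unfolding sphere_units_def
      by (auto simp: real_part_def J_def coords_paravector paravectors_def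
        simp del: of_real_0)
    moreover have "s = emb J (Complex x n)"
      using False by (simp add: s J_def emb_def scaleR_sum_right)
    ultimately show ?thesis by (rule that)
  qed
qed

section \<open>Open and closed double sectors described by slopes\<close>

definition sector :: "real \<Rightarrow> complex set" where
  "sector \<theta> = {z. \<bar>Im z\<bar> < tan \<theta> * \<bar>Re z\<bar>}"

lemma cis_angles_in_sector:
  assumes "\<theta> \<in> {0<..<pi/2}" "\<phi> \<in> angles \<theta>" "r > 0"
  shows "r *\<^sub>R cis \<phi> \<in> sector \<theta>"
proof -
  have key: "\<bar>sin \<psi>\<bar> < tan \<theta> * \<bar>cos \<psi>\<bar>" if "\<psi> \<in> {-\<theta><..<\<theta>}" for \<psi>
  proof -
    have c: "cos \<psi> > 0" using that assms(1) by (intro cos_gt_zero_pi) auto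
    have "tan \<psi> < tan \<theta>" "tan (-\<theta>) < tan \<psi>"
      using that assms(1) by (intro tan_monotone; auto)+
    then have "\<bar>tan \<psi>\<bar> < tan \<theta>" by (simp add: abs_less_iff)
    moreover have "\<bar>sin \<psi>\<bar> = \<bar>tan \<psi>\<bar> * cos \<psi>" using c by (simp add: tan_def)
    ultimately show ?thesis using c by simp
  qed
  have "\<bar>sin \<phi>\<bar> < tan \<theta> * \<bar>cos \<phi>\<bar>"
    using key[of \<phi>] key[of "\<phi> - pi"] assms(2) by (auto simp: angles_def)
  then show ?thesis
    using assms(3) by (simp add: sector_def abs_mult)
qed

lemma sector_polar:
  assumes "\<theta> \<in> {0<..<pi/2}" "z \<in> sector \<theta>"
  obtains r \<phi> where "r > 0" "\<phi> \<in> angles \<theta>" "z = r *\<^sub>R cis \<phi>"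
proof -
  have x: "Re z \<noteq> 0" using assms(2) by (auto simp: sector_def)
  define \<psi> where "\<psi> = arctan (Im z / Re z)"
  have "\<bar>Im z / Re z\<bar> < tan \<theta>" using assms(2) x by (simp add: sector_def field_simps abs_divide)
  then have "Im z / Re z < tan \<theta>" "- tan \<theta> < Im z / Re z" by linarith+
  then have "\<psi> < arctan (tan \<theta>)" "arctan (- tan \<theta>) < \<psi>"
    unfolding \<psi>_def by (simp_all only: arctan_less_iff)
  then have \<psi>: "\<psi> \<in> {-\<theta><..<\<theta>}" using assms(1) by (simp add: arctan_minus arctan_tan)
  have c: "cos \<psi> > 0" using \<psi> assms(1) by (intro cos_gt_zero_pi) auto
  have "sin \<psi> = tan \<psi> * cos \<psi>" using c by (simp add: tan_def)
  then have s: "sin \<psi> = Im z / Re z * cos \<psi>" by (simp add: \<psi>_def tan_arctan)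
  show ?thesis
  proof (cases "Re z > 0")
    case True
    then show ?thesis
      using c s \<psi> x by (intro that[of "Re z / cos \<psi>" \<psi>]) (auto simp: angles_def complex_eq_iff)
  next
    case False
    then show ?thesis
      using c s \<psi> x by (intro that[of "- Re z / cos \<psi>" "pi + \<psi>"]) (auto simp: angles_def complex_eq_iff divide_neg_pos)
  qed
qed

text \<open>Comparing the size of the vector part with that of the real part removes both the angle
  and the imaginary unit, so openness and axial symmetry follow from an inequality.\<close>

lemma double_sector_eq:
  fixes J :: "'n::{finite,linorder} clifford"
  assumes "\<theta> \<in> {0<..<pi/2}"
  shows "(double_sector \<theta> :: 'n clifford set) = {s \<in> paravectors. norm (s - of_real (real_part s)) < tan \<theta> * \<bar>real_part s\<bar>}"
    and "J \<in> sphere_units \<Longrightarrow> emb J z \<in> double_sector \<theta> \<longleftrightarrow> z \<in> sector \<theta>"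
proof -
  have iff: "emb J z \<in> {s \<in> paravectors. norm (s - of_real (real_part s)) < tan \<theta> * \<bar>real_part s\<bar>} \<longleftrightarrow> z \<in> sector \<theta>"
    if "J \<in> sphere_units" for z and J :: "'n clifford"
    unfolding mem_Collect_eq norm_emb_vector_part[OF that]
    unfolding emb_paravector(2)[OF that] using emb_paravector(1)[OF that] by (simp add: sector_def)
  show *: "(double_sector \<theta> :: 'n clifford set) = {s \<in> paravectors. norm (s - of_real (real_part s)) < tan \<theta> * \<bar>real_part s\<bar>}" (is "?L = ?R")
  proof (intro equalityI subsetI)
    fix s assume "s \<in> ?L"
    then obtain r J \<phi> where s: "s = emb J (r *\<^sub>R cis \<phi>)" "J \<in> sphere_units" "r > 0" "\<phi> \<in> angles \<theta>"
      by (auto simp: double_sector_def emb_cexp)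
    then show "s \<in> ?R"
      using cis_angles_in_sector[OF assms s(4,3)] iff[OF s(2)] by blast
  next
    fix s assume s: "s \<in> ?R"
    obtain J z where Jz: "J \<in> sphere_units" "s = emb J z" using s paravectors_emb[of s] by auto
    then have "z \<in> sector \<theta>" using s iff by blast
    then show "s \<in> ?L"
      using Jz by (elim sector_polar[OF assms]) (auto simp: double_sector_def emb_cexp)
  qed
  show "emb J z \<in> double_sector \<theta> \<longleftrightarrow> z \<in> sector \<theta>" if "J \<in> sphere_units"
    unfolding * by (rule iff[OF that])
qed

definition closed_sector :: "real \<Rightarrow> complex set" where
  "closed_sector \<theta> = {z. \<bar>Im z\<bar> \<le> tan \<theta> * \<bar>Re z\<bar>}"

lemma closure_double_sector:
  assumes "\<theta> \<in> {0<..<pi/2}" "J \<in> sphere_units"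
  shows "emb J z \<in> closure (double_sector \<theta>) \<longleftrightarrow> z \<in> closed_sector \<theta>"
proof
  note norm = norm_emb_vector_part[OF assms(2)]
  let ?R = "{s :: 'a clifford. norm (s - of_real (real_part s)) \<le> tan \<theta> * \<bar>real_part s\<bar>}"
  have "closed ?R"
    by (intro closed_Collect_le continuous_intros bounded_linear.continuous_on[OF bounded_linear_real_part])
  then have "closure (double_sector \<theta>) \<subseteq> ?R"
    by (intro closure_minimal) (auto simp: double_sector_eq[OF assms(1)])
  moreover assume "emb J z \<in> closure (double_sector \<theta>)"
  ultimately have "emb J z \<in> ?R" by blast
  then show "z \<in> closed_sector \<theta>"
    using assms norm by (simp add: closed_sector_def emb_paravector)
next
  assume z: "z \<in> closed_sector \<theta>"
  have t: "tan \<theta> > 0" using assms by (intro tan_gt_zero) auto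
  \<comment> \<open>Shrinking the imaginary part makes the inequality strict when
    \<open>Re z\<close> is nonzero. Otherwise \<open>z = 0\<close>, which is approached along the
    positive real axis.\<close>
  define w where "w n = (if Re z = 0 then Complex (inverse (real (Suc n))) 0 else Complex (Re z) ((1 - inverse (real (Suc n))) * Im z))" for n
  have "w n \<in> sector \<theta>" for n
  proof (cases "Re z = 0")
    case False
    have i: "0 < inverse (real (Suc n))" "inverse (real (Suc n)) \<le> 1" by (simp_all add: inverse_eq_divide)
    have "\<bar>(1 - inverse (real (Suc n))) * Im z\<bar> = (1 - inverse (real (Suc n))) * \<bar>Im z\<bar>"
      using i by (simp add: abs_mult)
    also have "\<dots> \<le> (1 - inverse (real (Suc n))) * (tan \<theta> * \<bar>Re z\<bar>)"
      using z i by (intro mult_left_mono) (auto simp: closed_sector_def)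
    also have "\<dots> < 1 * (tan \<theta> * \<bar>Re z\<bar>)"
      using i t False by (intro mult_strict_right_mono) auto
    finally show ?thesis using False by (simp add: w_def sector_def)
  qed (use t in \<open>simp add: w_def sector_def\<close>)
  then have in_sec: "emb J (w n) \<in> double_sector \<theta>" for n
    using double_sector_eq(2)[OF assms] by blast
  have lim: "(\<lambda>n. Re (w n)) \<longlonglongrightarrow> Re z" "(\<lambda>n. Im (w n)) \<longlonglongrightarrow> Im z"
  proof -
    show "(\<lambda>n. Re (w n)) \<longlonglongrightarrow> Re z"
      unfolding w_def using LIMSEQ_inverse_real_of_nat by (cases "Re z = 0") auto
    have "(\<lambda>n. (1 - inverse (real (Suc n))) * Im z) \<longlonglongrightarrow> (1 - 0) * Im z"
      by (intro tendsto_intros LIMSEQ_inverse_real_of_nat)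
    moreover have "Re z = 0 \<Longrightarrow> Im z = 0" using z by (auto simp: closed_sector_def)
    ultimately show "(\<lambda>n. Im (w n)) \<longlonglongrightarrow> Im z"
      unfolding w_def by (cases "Re z = 0") auto
  qed
  then have "(\<lambda>n. emb J (w n)) \<longlonglongrightarrow> emb J z"
    unfolding emb_def by (intro tendsto_add tendsto_scaleR tendsto_of_real tendsto_const lim)
  then show "emb J z \<in> closure (double_sector \<theta>)"
    using in_sec unfolding closure_sequential by (intro exI[of _ "\<lambda>n. emb J (w n)"]) simp
qed

section \<open>Rational functions as intrinsic slice hyperholomorphic functions\<close>

lemma closed_closed_sector: "closed (closed_sector \<theta>)"
  unfolding closed_sector_def by (intro closed_Collect_le continuous_intros)

lemma sector_subset_closed_sector: "sector \<theta> \<subseteq> closed_sector \<theta>"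
  by (auto simp: sector_def closed_sector_def)

text \<open>There are finitely many zeros, and each violates the slope inequality strictly at
  \<omega>. By continuity of \<open>tan\<close> this persists for a slightly larger angle,
  simultaneously for all of them.\<close>

lemma zero_free_larger_sector:
  assumes "\<omega> \<in> {0<..<pi/2}" "q \<noteq> 0" "\<forall>z\<in>closed_sector \<omega>. cpoly q z \<noteq> 0"
  obtains \<theta> where "\<theta> \<in> {\<omega><..<pi/2}" "\<forall>z\<in>closed_sector \<theta>. cpoly q z \<noteq> 0"
proof -
  have "finite {z. cpoly q z = 0}"
    unfolding cpoly_def using assms(2) by (intro poly_roots_finite) (simp add: map_poly_eq_0_iff)
  moreover have "\<forall>\<^sub>F \<theta> in at_right \<omega>. tan \<theta> * \<bar>Re z\<bar> < \<bar>Im z\<bar>" if "z \<in> {z. cpoly q z = 0}" for z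
  proof (rule order_tendstoD)
    have "cos \<omega> \<noteq> 0" using assms(1) cos_gt_zero_pi[of \<omega>] by auto
    then show "((\<lambda>\<theta>. tan \<theta> * \<bar>Re z\<bar>) \<longlongrightarrow> tan \<omega> * \<bar>Re z\<bar>) (at_right \<omega>)"
      by (intro tendsto_intros)
    show "tan \<omega> * \<bar>Re z\<bar> < \<bar>Im z\<bar>"
      using assms(3) that by (force simp: closed_sector_def)
  qed
  ultimately have "\<forall>\<^sub>F \<theta> in at_right \<omega>. \<forall>z\<in>{z. cpoly q z = 0}. tan \<theta> * \<bar>Re z\<bar> < \<bar>Im z\<bar>"
    by (intro eventually_ball_finite ballI)
  moreover have "\<forall>\<^sub>F \<theta> in at_right \<omega>. \<theta> \<in> {\<omega><..<pi/2}"
    using assms(1) by (intro eventually_at_right_real) auto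
  ultimately have "\<forall>\<^sub>F \<theta> in at_right \<omega>. \<theta> \<in> {\<omega><..<pi/2} \<and> (\<forall>z\<in>{z. cpoly q z = 0}. tan \<theta> * \<bar>Re z\<bar> < \<bar>Im z\<bar>)"
    by eventually_elim simp
  from eventually_happens'[OF _ this] obtain \<theta> where
    "\<theta> \<in> {\<omega><..<pi/2}" "\<forall>z\<in>{z. cpoly q z = 0}. tan \<theta> * \<bar>Re z\<bar> < \<bar>Im z\<bar>" by auto
  then show ?thesis by (intro that) (force simp: closed_sector_def)+
qed

section \<open>Size of rational functions on a closed sector\<close>

lemma ratio_bounded_at_infinity:
  assumes "degree p \<le> degree q" "0 < degree q"
  obtains B R where "\<And>z. cmod z \<ge> R \<Longrightarrow> cmod (ratio p q z) \<le> B"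
proof -
  \<comment> \<open>The limit of the ratio at infinity, which is 0 if the degrees differ;
    subtracting it leaves a numerator of smaller degree.\<close>
  define c where "c = coeff p (degree q) / lead_coeff q"
  define r where "r = p - smult c q"
  have "coeff r (degree q) = 0" "degree r \<le> degree q"
    using assms by (auto simp: r_def c_def intro!: degree_diff_le)
  then have r: "degree r < degree q"
    using eq_zero_or_degree_less[of r "degree q"] assms(2) by auto
  have "\<forall>\<^sub>F z in at_infinity. cmod (ratio r q z) < 1"
    using tendstoD[OF ratio_at_infinity[OF r], of 1] by simp
  then have "\<forall>\<^sub>F z in at_infinity. cmod (ratio p q z) \<le> \<bar>c\<bar> + 1"
    using eventually_cpoly_nonzero_at_infinity[OF assms(2)]
  proof eventually_elim
    case (elim z)
    have "cpoly p z = of_real c * cpoly q z + cpoly r z"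
      using cpoly_add[of "smult c q" r z] by (simp add: r_def cpoly_smult)
    then have "ratio p q z = of_real c + ratio r q z"
      using elim by (simp add: ratio_def field_simps)
    then show ?case using elim norm_triangle_ineq[of "of_real c" "ratio r q z"] by simp
  qed
  then obtain R where "\<And>z. cmod z \<ge> R \<Longrightarrow> cmod (ratio p q z) \<le> \<bar>c\<bar> + 1"
    by (auto simp: eventually_at_infinity)
  then show ?thesis by (rule that)
qed

text \<open>The majorant decays at both ends, so it remains integrable after division by
  \<open>cmod z\<close>. The zero of \<open>p\<close> at the origin lets a factor \<open>z\<close>
  be split off; the quotient is bounded near 0 and decays quadratically at infinity.\<close>

lemma ratio_sector_bound:
  assumes "degree p < degree q" "coeff p 0 = 0" and nz: "\<forall>z\<in>closed_sector \<theta>. cpoly q z \<noteq> 0"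
  obtains B where "B \<ge> 0" "\<And>z. z \<in> closed_sector \<theta> \<Longrightarrow> cmod (ratio p q z) \<le> B * cmod z / (1 + (cmod z)\<^sup>2)"
proof -
  define h where "h = ratio (poly_shift 1 p) q"
  have pz: "ratio p q z = z * h z" for z
    using cpoly_poly_shift[of 0 p z] assms(2) by (simp add: ratio_def h_def)
  \<comment> \<open>The degree gap exactly allows \<open>z p / q\<close> to be bounded at
    infinity.\<close>
  have "degree (pCons 0 p) \<le> degree q" using assms(1) by (simp add: degree_pCons_eq_if)
  moreover have "0 < degree q" using assms(1) by simp
  ultimately obtain B1 R1 where B1: "\<And>z. cmod z \<ge> R1 \<Longrightarrow> cmod (ratio (pCons 0 p) q z) \<le> B1"
    by (rule ratio_bounded_at_infinity) blast
  define R where "R = max 1 R1"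
  have far: "(cmod z)\<^sup>2 * cmod (h z) \<le> B1" if "cmod z \<ge> R" for z
  proof -
    have "ratio (pCons 0 p) q z = z\<^sup>2 * h z"
    proof -
      have "ratio (pCons 0 p) q z = z * ratio p q z" by (simp add: ratio_def cpoly_pCons)
      then show ?thesis by (simp add: pz power2_eq_square)
    qed
    then show ?thesis using B1[of z] that by (simp add: norm_mult norm_power R_def)
  qed
  have "compact (closed_sector \<theta> \<inter> cball 0 R)"
    by (intro closed_Int_compact closed_closed_sector compact_cball)
  then have "compact (h ` (closed_sector \<theta> \<inter> cball 0 R))"
    unfolding h_def by (intro compact_continuous_image continuous_ratio continuous_intros) (use nz in auto)
  then obtain B2 where "\<forall>w\<in>h ` (closed_sector \<theta> \<inter> cball 0 R). cmod w \<le> B2"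
    using compact_imp_bounded bounded_iff by metis
  then have B2: "cmod (h z) \<le> B2" if "z \<in> closed_sector \<theta>" "cmod z \<le> R" for z
    using that by simp
  \<comment> \<open>The first entry serves \<open>cmod z > R\<close>, where \<open>R \<ge> 1\<close>
    gives \<open>1 + (cmod z)^2 \<le> 2 (cmod z)^2\<close>; the second serves the compact
    part.\<close>
  define B where "B = max (2 * B1) (B2 * (1 + R\<^sup>2))"
  have h: "cmod (h z) * (1 + (cmod z)\<^sup>2) \<le> B" if "z \<in> closed_sector \<theta>" for z
  proof (cases "cmod z \<le> R")
    case True
    have "0 \<le> B2" using B2[OF that True] norm_ge_zero order_trans by blast
    then have "cmod (h z) * (1 + (cmod z)\<^sup>2) \<le> B2 * (1 + R\<^sup>2)"
      using B2[OF that True] True by (intro mult_mono add_mono power_mono) auto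
    then show ?thesis by (simp add: B_def)
  next
    case False
    then have "1 \<le> (cmod z)\<^sup>2" by (simp add: R_def)
    then have "cmod (h z) * (1 + (cmod z)\<^sup>2) \<le> cmod (h z) * ((cmod z)\<^sup>2 + (cmod z)\<^sup>2)"
      by (intro mult_left_mono) auto
    also have "\<dots> \<le> 2 * B1" using far[of z] False by (simp add: algebra_simps)
    finally show ?thesis by (simp add: B_def)
  qed
  show ?thesis
  proof
    show "B \<ge> 0" using h[of 0] by (simp add: closed_sector_def) (metis norm_ge_zero order_trans)
    fix z assume "z \<in> closed_sector \<theta>"
    have pos: "1 + (cmod z)\<^sup>2 > 0" by (simp add: add_pos_nonneg)
    have "cmod z * (cmod (h z) * (1 + (cmod z)\<^sup>2)) \<le> cmod z * B"
      using h[OF \<open>z \<in> closed_sector \<theta>\<close>] by (intro mult_left_mono) auto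
    then show "cmod (ratio p q z) \<le> B * cmod z / (1 + (cmod z)\<^sup>2)"
      using pos by (simp add: pz norm_mult pos_le_divide_eq algebra_simps)
  qed
qed

lemma slice_domain_double_sector:
  assumes "\<theta> \<in> {0<..<pi/2}"
  shows "slice_domain (double_sector \<theta> :: 'n::{finite,linorder} clifford set) = {(x, y). \<bar>y\<bar> < tan \<theta> * \<bar>x\<bar>}"
proof -
  have "of_real x + y *\<^sub>R J \<in> double_sector \<theta> \<longleftrightarrow> \<bar>y\<bar> < tan \<theta> * \<bar>x\<bar>" if "J \<in> sphere_units" for x y and J :: "'n clifford"
    using double_sector_eq(2)[OF assms that, of "Complex x y"] by (simp add: emb_def sector_def)
  then show ?thesis
    using sphere_units_nonempty[of undefined] by (auto simp: slice_domain_def)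
qed

lemma openin_double_sector:
  assumes "\<theta> \<in> {0<..<pi/2}"
  shows "openin (top_of_set paravectors) (double_sector \<theta> :: 'n::{finite,linorder} clifford set)"
proof -
  have "open {s :: 'n clifford. norm (s - of_real (real_part s)) < tan \<theta> * \<bar>real_part s\<bar>}"
    by (intro open_Collect_less continuous_intros bounded_linear.continuous_on[OF bounded_linear_real_part])
  then have "openin (top_of_set paravectors) (paravectors \<inter> {s :: 'n clifford. norm (s - of_real (real_part s)) < tan \<theta> * \<bar>real_part s\<bar>})"
    by (rule openin_open_Int)
  moreover have "double_sector \<theta> = paravectors \<inter> {s :: 'n clifford. norm (s - of_real (real_part s)) < tan \<theta> * \<bar>real_part s\<bar>}"
    unfolding double_sector_eq(1)[OF assms] by blast
  ultimately show ?thesis by simp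
qed

lemma axially_symmetric_double_sector:
  assumes "\<theta> \<in> {0<..<pi/2}"
  shows "axially_symmetric (double_sector \<theta> :: 'n::{finite,linorder} clifford set)"
proof -
  have "of_real x + y *\<^sub>R J \<in> double_sector \<theta> \<longleftrightarrow> \<bar>y\<bar> < tan \<theta> * \<bar>x\<bar>" if "J \<in> sphere_units" for x y and J :: "'n clifford"
    using double_sector_eq(2)[OF assms that, of "Complex x y"] by (simp add: emb_def sector_def)
  then show ?thesis by (auto simp: axially_symmetric_def)
qed

lemma slice_decomposition_ratio:
  assumes "\<theta> \<in> {0<..<pi/2}" and nz: "\<forall>z\<in>sector \<theta>. cpoly q z \<noteq> 0"
  shows "slice_decomposition (double_sector \<theta> :: 'n::{finite,linorder} clifford set) (cl_quotient p q)
    (\<lambda>(x, y). of_real (Re (ratio p q (Complex x y)))) (\<lambda>(x, y). of_real (Im (ratio p q (Complex x y))))"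
proof -
  define L1 L2 :: "(real \<times> real) \<Rightarrow>\<^sub>L 'n clifford"
    where "L1 = Blinfun (\<lambda>h. of_real (fst h))" and "L2 = Blinfun (\<lambda>h. of_real (snd h))"
  have L: "blinfun_apply L1 h = of_real (fst h)" "blinfun_apply L2 h = of_real (snd h)" for h
    unfolding L1_def L2_def
    by (subst bounded_linear_Blinfun_apply; auto intro!: bounded_linear_intros bounded_linear_of_real[THEN bounded_linear_compose])+
  let ?c = "\<lambda>z :: real \<times> real. Complex (fst z) (snd z)"
  let ?D = "\<lambda>z. ratio_deriv p q (?c z)"
  \<comment> \<open>Real and imaginary part of multiplication by the complex derivative; the
    Cauchy-Riemann equations are built into this form.\<close>
  define F0 F1 where "F0 z = Re (?D z) *\<^sub>R L1 - Im (?D z) *\<^sub>R L2"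
    and "F1 z = Im (?D z) *\<^sub>R L1 + Re (?D z) *\<^sub>R L2" for z
  let ?U = "slice_domain (double_sector \<theta> :: 'n clifford set)"
  have nz': "cpoly q (?c z) \<noteq> 0" if "z \<in> ?U" for z
    using that nz unfolding slice_domain_double_sector[OF assms(1)] by (auto simp: sector_def)
  have c: "continuous_on S ?c" for S
    unfolding Complex_eq by (intro continuous_intros)
  have cont: "continuous_on ?U F0" "continuous_on ?U F1"
    unfolding F0_def F1_def by (intro continuous_intros continuous_ratio_deriv c nz'; assumption)+
  have deriv: "((\<lambda>z. ratio p q (?c z)) has_derivative (\<lambda>h. ?D z * ?c h)) (at z)" if "z \<in> ?U" for z
  proof -
    have "(?c has_derivative ?c) (at z)"
      unfolding Complex_eq by (auto intro!: derivative_eq_intros)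
    from has_derivative_compose[OF this ratio_has_derivative[OF nz'[OF that], of p, unfolded has_field_derivative_def]]
    show ?thesis .
  qed
  have "((\<lambda>(x, y). of_real (Re (ratio p q (Complex x y)))) has_derivative blinfun_apply (F0 z)) (at z)"
    "((\<lambda>(x, y). of_real (Im (ratio p q (Complex x y)))) has_derivative blinfun_apply (F1 z)) (at z)"
    if "z \<in> ?U" for z
  proof -
    have "blinfun_apply (F0 z) = (\<lambda>h. of_real (Re (?D z * ?c h)))" "blinfun_apply (F1 z) = (\<lambda>h. of_real (Im (?D z * ?c h)))"
      by (auto simp: fun_eq_iff F0_def F1_def L blinfun.bilinear_simps of_real_def algebra_simps)
    moreover have "((\<lambda>z. of_real (Re (ratio p q (?c z)))) has_derivative (\<lambda>h. of_real (Re (?D z * ?c h)))) (at z)"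
      "((\<lambda>z. of_real (Im (ratio p q (?c z)))) has_derivative (\<lambda>h. of_real (Im (?D z * ?c h)))) (at z)"
      by (intro has_derivative_of_real has_derivative_Re has_derivative_Im deriv that)+
    ultimately show
      "((\<lambda>(x, y). of_real (Re (ratio p q (Complex x y)))) has_derivative blinfun_apply (F0 z)) (at z)"
      "((\<lambda>(x, y). of_real (Im (ratio p q (Complex x y)))) has_derivative blinfun_apply (F1 z)) (at z)"
      by (simp_all only: case_prod_beta')
  qed
  moreover have "blinfun_apply (F0 z) (1, 0) = blinfun_apply (F1 z) (0, 1)"
    "blinfun_apply (F0 z) (0, 1) = - blinfun_apply (F1 z) (1, 0)" for z
    by (simp_all add: F0_def F1_def L blinfun.bilinear_simps)
  moreover have "cl_quotient p q (of_real x + y *\<^sub>R J) =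
      of_real (Re (ratio p q (Complex x y))) + J * of_real (Im (ratio p q (Complex x y)))"
    if "J \<in> sphere_units" for x y and J :: "'n clifford"
    using cl_quotient_emb[OF that, of p q "Complex x y"] by (simp add: emb_def of_real_def)
  moreover have "ratio p q (Complex x (- y)) = cnj (ratio p q (Complex x y))" for x y
    by (simp add: ratio_cnj[symmetric] complex_cnj)
  ultimately show ?thesis
    unfolding slice_decomposition_def using cont by (intro conjI exI[of _ F0] exI[of _ F1]) auto
qed

text \<open>Extension by 0 to the negative half line allows the two-sided criterion. Nonnegativity
  turns gauge integrability into Lebesgue integrability, and Borel measurability leads back from the
  completed measure.\<close>

lemma set_integrable_arctan_bound:
  fixes g :: "real \<Rightarrow> real"
  assumes cont: "continuous_on {0<..} g" and "\<And>t. t > 0 \<Longrightarrow> 0 \<le> g t" and bound: "\<And>t. t > 0 \<Longrightarrow> g t \<le> B / (1 + t\<^sup>2)"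
  shows "set_integrable lborel {0<..} g"
proof -
  define f where "f t = (if t > 0 then g t else 0)" for t
  have "continuous_on ({0<..} \<union> {..<0}) f"
    by (rule continuous_on_open_Un) (auto simp: f_def cong: continuous_on_cong intro: continuous_on_eq[OF cont] continuous_on_eq[OF continuous_on_const[of _ 0]])
  moreover have "{0<..} \<union> {..<0} = - {0 :: real}" by auto
  ultimately have "continuous_on (- {0}) f" by simp
  moreover have "norm (f t) \<le> \<bar>B\<bar> / (1 + t\<^sup>2)" if "t \<noteq> 0" for t
  proof (cases "t > 0")
    case True
    have "B / (1 + t\<^sup>2) \<le> \<bar>B\<bar> / (1 + t\<^sup>2)"
      by (intro divide_right_mono) auto
    with True show ?thesis using assms(2)[OF True] bound[OF True] by (simp add: f_def)
  qed (simp add: f_def)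
  ultimately have "f integrable_on UNIV" by (rule arctan_dominated_integral)
  then have "f absolutely_integrable_on UNIV"
    by (rule nonnegative_absolutely_integrable_1) (use assms(2) in \<open>auto simp: f_def\<close>)
  then have "integrable lebesgue f" by (simp add: set_integrable_def)
  moreover have f: "f = (\<lambda>t. indicator {0<..} t *\<^sub>R g t)" by (auto simp: f_def indicator_def)
  moreover have "(\<lambda>t. indicator {0<..} t *\<^sub>R g t) \<in> borel_measurable lborel"
    using borel_measurable_continuous_on_indicator[OF _ cont] by simp
  ultimately show ?thesis
    unfolding set_integrable_def by (metis integrable_completion)
qed

lemma cl_quotient_N0:
  assumes \<theta>: "\<theta> \<in> {0<..<pi/2}" and "degree p < degree q" "coeff p 0 = 0" and nz: "\<forall>z\<in>closed_sector \<theta>. cpoly q z \<noteq> 0"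
  shows "(cl_quotient p q :: 'n::{finite,linorder} clifford \<Rightarrow> 'n clifford) \<in> N0 \<theta>"
proof -
  obtain B where B: "B \<ge> 0" "\<And>z. z \<in> closed_sector \<theta> \<Longrightarrow> cmod (ratio p q z) \<le> B * cmod z / (1 + (cmod z)\<^sup>2)"
    using ratio_sector_bound[OF assms(2-)] by blast
  have nz': "\<forall>z\<in>sector \<theta>. cpoly q z \<noteq> 0" using nz sector_subset_closed_sector by blast
  have norm_le: "norm (cl_quotient p q s) \<le> B" if "s \<in> double_sector \<theta>" for s :: "'n clifford"
  proof -
    have "s \<in> paravectors" using that unfolding double_sector_eq(1)[OF \<theta>] by blast
    then obtain J z where s: "J \<in> sphere_units" "s = emb J z" by (rule paravectors_emb)
    then have "z \<in> closed_sector \<theta>" using that double_sector_eq(2)[OF \<theta>] sector_subset_closed_sector by blast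
    then have "norm (cl_quotient p q s) \<le> B * (cmod z / (1 + (cmod z)\<^sup>2))"
      using B(2)[of z] by (simp add: s cl_quotient_emb emb_paravector)
    also have "cmod z / (1 + (cmod z)\<^sup>2) \<le> 1"
    proof -
      have "0 \<le> (cmod z - 1)\<^sup>2 + cmod z" by simp
      then have "cmod z \<le> 1 + (cmod z)\<^sup>2" by (simp add: power2_diff)
      then show ?thesis by (simp add: divide_le_eq_1 add_pos_nonneg)
    qed
    then have "B * (cmod z / (1 + (cmod z)\<^sup>2)) \<le> B * 1" using B(1) by (intro mult_left_mono)
    finally show ?thesis by simp
  qed
  have int: "set_integrable lborel {0<..} (\<lambda>t. norm (cl_quotient p q (t *\<^sub>R cexp J \<phi>)) / t)"
    if J: "J \<in> sphere_units" and \<phi>: "\<phi> \<in> angles \<theta>" for J :: "'n clifford" and \<phi>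
  proof -
    have eq: "norm (cl_quotient p q (t *\<^sub>R cexp J \<phi>)) / t = cmod (ratio p q (t *\<^sub>R cis \<phi>)) / t" for t
      unfolding emb_cexp by (simp add: J cl_quotient_emb emb_paravector)
    have mem: "t *\<^sub>R cis \<phi> \<in> closed_sector \<theta>" if "t > 0" for t
      using cis_angles_in_sector[OF \<theta> \<phi> that] sector_subset_closed_sector by blast
    show ?thesis
      unfolding eq
    proof (rule set_integrable_arctan_bound)
      show "continuous_on {0<..} (\<lambda>t. cmod (ratio p q (t *\<^sub>R cis \<phi>)) / t)"
        by (intro continuous_intros continuous_ratio) (use mem nz in auto)
      show "cmod (ratio p q (t *\<^sub>R cis \<phi>)) / t \<le> B / (1 + t\<^sup>2)" if "t > 0" for t
        using B(2)[OF mem[OF that]] that by (simp add: field_simps)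
    qed simp
  qed
  have slice: "slice_decomposition (double_sector \<theta> :: 'n clifford set) (cl_quotient p q)
    (\<lambda>(x, y). of_real (Re (ratio p q (Complex x y)))) (\<lambda>(x, y). of_real (Im (ratio p q (Complex x y))))"
    by (rule slice_decomposition_ratio[OF \<theta> nz'])
  have "cl_quotient p q \<in> intrinsic (double_sector \<theta> :: 'n clifford set)"
    unfolding intrinsic_def using openin_double_sector[OF \<theta>] axially_symmetric_double_sector[OF \<theta>] slice
    by (intro CollectI conjI exI[of _ "\<lambda>(x, y). of_real (Re (ratio p q (Complex x y)))"]
        exI[of _ "\<lambda>(x, y). of_real (Im (ratio p q (Complex x y)))"]) auto
  moreover have "cl_quotient p q \<in> slice_hyperholomorphic (double_sector \<theta> :: 'n clifford set)"
    unfolding slice_hyperholomorphic_def using openin_double_sector[OF \<theta>] axially_symmetric_double_sector[OF \<theta>] slice by blast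
  moreover have "bounded (cl_quotient p q ` (double_sector \<theta> :: 'n clifford set))"
    unfolding bounded_iff using norm_le by blast
  ultimately show ?thesis
    unfolding N0_def SH0_def using int by blast
qed

section \<open>Powers and polynomials of an unbounded operator\<close>

text \<open>Right multiplication by reals is scaling, so a right linear operator is in particular
  real linear.\<close>

lemma rmul_of_real:
  fixes u :: "'v::real_vector ^ 'n::{finite,linorder} set"
  shows "rmul u (of_real r) = r *\<^sub>R u"
proof -
  have *: "coords (of_real r :: 'n clifford) $ A = (if A = {} then r else 0)" for A
    by (simp add: of_real_def scaleR_clifford.rep_eq one_clifford.rep_eq axis_def)
  have "axis (sym_diff B A) ((csign B A * (if A = {} then r else 0)) *\<^sub>R u $ B) =
      (if A = {} then axis B (r *\<^sub>R u $ B) else 0)" for A B :: "'n set"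
    by (auto simp: axis_def vec_eq_iff)
  then have "rmul u (of_real r) = (\<Sum>B\<in>UNIV. axis B (r *\<^sub>R u $ B))"
    unfolding rmul_def vec_rmul_def * by simp
  also have "\<dots> = r *\<^sub>R u"
    by (simp add: vec_eq_iff sum_component axis_def)
  finally show ?thesis .
qed

lemma op_pow_Suc: "op_pow T (Suc k) = T \<circ>\<^sub>m op_pow T k"
  by (simp add: op_pow_def)

lemma op_pow_0: "op_pow T 0 = Some"
  by (simp add: op_pow_def)

locale real_operator =
  fixes T :: "('v::banach, 'n::{finite,linorder}) op"
  assumes right_linear: "right_linear T"
begin

definition D :: "nat \<Rightarrow> ('v ^ 'n set) set" where
  "D k = dom (op_pow T k)"

text \<open>A total version of the power; its values off \<open>D k\<close> are unspecified, hence
  the domain conditions carried along below.\<close>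

definition pow :: "nat \<Rightarrow> 'v ^ 'n set \<Rightarrow> 'v ^ 'n set" where
  "pow k v = the (op_pow T k v)"

lemma D_0 [simp]: "v \<in> D 0" and pow_0 [simp]: "pow 0 v = v"
  by (auto simp: op_pow_0 pow_def D_def)

lemma D_1: "D (Suc 0) = dom T" and pow_1: "pow (Suc 0) v = the (T v)"
  by (auto simp: op_pow_0 op_pow_Suc pow_def D_def map_comp_def dom_def)

lemma D_Suc: "v \<in> D (Suc k) \<longleftrightarrow> v \<in> D k \<and> pow k v \<in> D (Suc 0)"
  unfolding D_1 by (auto simp: op_pow_Suc pow_def D_def map_comp_def split: option.splits)

lemma pow_Suc: "v \<in> D k \<Longrightarrow> pow (Suc k) v = pow (Suc 0) (pow k v)"
  unfolding pow_1 by (auto simp: op_pow_Suc pow_def D_def map_comp_def split: option.splits)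

lemma D_antimono: "v \<in> D k \<Longrightarrow> j \<le> k \<Longrightarrow> v \<in> D j"
  by (induction k) (auto simp: le_Suc_eq dest: D_Suc[THEN iffD1])

lemma D_1_linear:
  "u \<in> D (Suc 0) \<Longrightarrow> v \<in> D (Suc 0) \<Longrightarrow> u + v \<in> D (Suc 0)"
  "u \<in> D (Suc 0) \<Longrightarrow> r *\<^sub>R u \<in> D (Suc 0)"
  "u \<in> D (Suc 0) \<Longrightarrow> v \<in> D (Suc 0) \<Longrightarrow> pow (Suc 0) (u + v) = pow (Suc 0) u + pow (Suc 0) v"
  "u \<in> D (Suc 0) \<Longrightarrow> pow (Suc 0) (r *\<^sub>R u) = r *\<^sub>R pow (Suc 0) u"
proof -
  have *: "T (r *\<^sub>R u) = Some (r *\<^sub>R the (T u))" if "u \<in> dom T" for r u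
    using right_linear that unfolding right_linear_def by (metis rmul_of_real)
  show "u \<in> D (Suc 0) \<Longrightarrow> r *\<^sub>R u \<in> D (Suc 0)" "u \<in> D (Suc 0) \<Longrightarrow> pow (Suc 0) (r *\<^sub>R u) = r *\<^sub>R pow (Suc 0) u"
    unfolding D_1 pow_1 using *[of u r] by auto
qed (use right_linear in \<open>auto simp: right_linear_def D_1 pow_1\<close>)

lemma D_add: "u \<in> D k \<Longrightarrow> v \<in> D k \<Longrightarrow> u + v \<in> D k"
  and pow_add_right: "u \<in> D k \<Longrightarrow> v \<in> D k \<Longrightarrow> pow k (u + v) = pow k u + pow k v"
proof (induction k)
  case (Suc k)
  { case 1 then show ?case
      using Suc.IH by (simp add: D_Suc[of _ k] D_1_linear) }
  { case 2 then show ?case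
      using Suc.IH by (simp add: D_Suc[of _ k] pow_Suc[of _ k] D_1_linear) }
qed auto

lemma D_scaleR: "u \<in> D k \<Longrightarrow> r *\<^sub>R u \<in> D k"
  and pow_scaleR: "u \<in> D k \<Longrightarrow> pow k (r *\<^sub>R u) = r *\<^sub>R pow k u"
proof (induction k)
  case (Suc k)
  { case 1 then show ?case
      using Suc.IH by (simp add: D_Suc[of _ k] D_1_linear) }
  { case 2 then show ?case
      using Suc.IH by (simp add: D_Suc[of _ k] pow_Suc[of _ k] D_1_linear) }
qed auto

lemma D_diff: "u \<in> D k \<Longrightarrow> v \<in> D k \<Longrightarrow> u - v \<in> D k"
  using D_add[of u k "(-1) *\<^sub>R v"] D_scaleR[of v k "-1"] by simp

lemma pow_diff: "u \<in> D k \<Longrightarrow> v \<in> D k \<Longrightarrow> pow k (u - v) = pow k u - pow k v"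
  using pow_add_right[of u k "(-1) *\<^sub>R v"] D_scaleR[of v k "-1"] pow_scaleR[of v k "-1"] by simp

lemmas D_linear = D_add D_scaleR D_diff
lemmas pow_linear = pow_add_right pow_scaleR pow_diff

lemma D_plus: "v \<in> D (j + k) \<longleftrightarrow> v \<in> D k \<and> pow k v \<in> D j"
  and pow_plus: "v \<in> D (j + k) \<Longrightarrow> pow (j + k) v = pow j (pow k v)"
proof (induction j)
  case (Suc j)
  { case 1 show ?case using Suc.IH by (auto simp: D_Suc[of _ "j + k"] D_Suc[of _ j]) }
  { case 2 then show ?case using Suc.IH by (auto simp: D_Suc[of _ "j + k"] D_Suc[of _ j] pow_Suc[of _ "j + k"] pow_Suc[of _ j]) }
qed auto

section \<open>Polynomials of an operator on their natural domains\<close>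

definition poly_at :: "real poly \<Rightarrow> 'v ^ 'n set \<Rightarrow> 'v ^ 'n set" where
  "poly_at p v = (\<Sum>k\<le>degree p. coeff p k *\<^sub>R pow k v)"

lemma poly_at_upto: "degree p \<le> N \<Longrightarrow> poly_at p v = (\<Sum>k\<le>N. coeff p k *\<^sub>R pow k v)"
  unfolding poly_at_def by (rule sum.mono_neutral_left) (auto simp: coeff_eq_0)

lemma op_poly_eq: "op_poly p T v = (if v \<in> D (degree p) then Some (poly_at p v) else None)"
  by (simp add: op_poly_def poly_at_def pow_def D_def)

lemma poly_at_algebra:
  "poly_at (p + q) v = poly_at p v + poly_at q v" "poly_at (smult r p) v = r *\<^sub>R poly_at p v"
proof -
  let ?N = "max (degree p) (degree q)"
  have "degree (p + q) \<le> ?N" by (simp add: degree_add_le)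
  then show "poly_at (p + q) v = poly_at p v + poly_at q v"
    by (simp add: poly_at_upto[of _ ?N] scaleR_add_left sum.distrib)
  show "poly_at (smult r p) v = r *\<^sub>R poly_at p v"
    by (simp add: poly_at_upto[of _ "degree p"] degree_smult_le scaleR_sum_right)
qed

lemma poly_at_pCons:
  assumes "v \<in> D (Suc (degree p))"
  shows "poly_at (pCons a p) v = a *\<^sub>R v + poly_at p (pow (Suc 0) v)"
proof -
  have "(\<Sum>k\<le>degree p. coeff p k *\<^sub>R pow (Suc k) v) = poly_at p (pow (Suc 0) v)"
    unfolding poly_at_def
  proof (rule sum.cong[OF refl])
    fix k assume "k \<in> {..degree p}"
    then have "v \<in> D (k + Suc 0)" using D_antimono[OF assms, of "Suc k"] by simp
    from pow_plus[OF this] show "coeff p k *\<^sub>R pow (Suc k) v = coeff p k *\<^sub>R pow k (pow (Suc 0) v)"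
      by simp
  qed
  moreover have "poly_at (pCons a p) v = (\<Sum>k\<le>Suc (degree p). coeff (pCons a p) k *\<^sub>R pow k v)"
    by (rule poly_at_upto[OF degree_pCons_le])
  ultimately show ?thesis
    by (simp only: sum.atMost_Suc_shift coeff_pCons_0 coeff_pCons_Suc pow_0)
qed

lemma poly_at_linear:
  assumes u: "u \<in> D (degree p)"
  shows "v \<in> D (degree p) \<Longrightarrow> poly_at p (u + v) = poly_at p u + poly_at p v" "poly_at p (r *\<^sub>R u) = r *\<^sub>R poly_at p u"
  using D_antimono[OF u] D_antimono[of v "degree p"]
  by (simp_all add: poly_at_def pow_linear scaleR_add_right sum.distrib scaleR_sum_right mult.commute)

definition Q :: "complex \<Rightarrow> 'v ^ 'n set \<Rightarrow> 'v ^ 'n set" where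
  "Q z v = pow 2 v - (2 * Re z) *\<^sub>R pow (Suc 0) v + (cmod z)\<^sup>2 *\<^sub>R v"

text \<open>The product of \<open>t - z\<close> and \<open>t - cnj z\<close>, a real polynomial as
  required for an operator on a real space.\<close>

definition Qpoly :: "complex \<Rightarrow> real poly" where
  "Qpoly z = [:(cmod z)\<^sup>2, - 2 * Re z, 1:]"

lemma poly_at_Qpoly: "poly_at (Qpoly z) v = Q z v"
  by (simp add: poly_at_def Qpoly_def Q_def numeral_2_eq_2)

text \<open>The quadratic factor acts first, so an inverse of the product is an inverse of
  \<open>p[T]\<close> followed by one of \<open>Q_z[T]\<close>.\<close>

lemma poly_at_Qpoly_mult:
  assumes v: "v \<in> D (Suc (Suc (degree p)))"
  shows "poly_at (Qpoly z * p) v = poly_at p (Q z v)" and "Q z v \<in> D (degree p)"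
proof -
  let ?v1 = "pow (Suc 0) v" and ?v2 = "pow 2 v"
  have D: "v \<in> D (Suc (degree p))" "v \<in> D (degree p)"
    by (rule D_antimono[OF v]; simp)+
  have v2: "?v2 = pow (Suc 0) ?v1"
    using pow_plus[of v "Suc 0" "Suc 0"] D_antimono[OF v, of 2] by (simp add: numeral_2_eq_2)
  have D1: "?v1 \<in> D (Suc (degree p))" "?v2 \<in> D (degree p)"
    using D_plus[of v "Suc (degree p)" "Suc 0"] D_plus[of v "degree p" 2] v by auto
  then have D1': "?v1 \<in> D (degree p)" using D_antimono[of ?v1 "Suc (degree p)"] by simp
  have Q: "Q z v = (cmod z)\<^sup>2 *\<^sub>R v + ((- 2 * Re z) *\<^sub>R ?v1 + ?v2)" by (simp add: Q_def)
  show "Q z v \<in> D (degree p)"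
    unfolding Q by (intro D_linear D1 D1' D)
  have "degree (pCons 0 p) \<le> Suc (degree p)" by (rule degree_pCons_le)
  then have D3: "v \<in> D (Suc (degree (pCons 0 p)))"
    by (intro D_antimono[OF v]) simp
  have "Qpoly z * p = smult ((cmod z)\<^sup>2) p + (smult (- 2 * Re z) (pCons 0 p) + pCons 0 (pCons 0 p))"
    by (simp add: Qpoly_def)
  then have "poly_at (Qpoly z * p) v = (cmod z)\<^sup>2 *\<^sub>R poly_at p v + ((- 2 * Re z) *\<^sub>R poly_at p ?v1 + poly_at p ?v2)"
    by (simp only: poly_at_algebra poly_at_pCons[OF D(1)] poly_at_pCons[OF D3] poly_at_pCons[OF D1(1)] v2 scaleR_zero_left add_0_left)
  also have "\<dots> = poly_at p (Q z v)"
    unfolding Q by (simp only: poly_at_linear D_linear D D1 D1')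
  finally show "poly_at (Qpoly z * p) v = poly_at p (Q z v)" .
qed

section \<open>Inverses of quadratic and general polynomials of an operator\<close>

text \<open>Boundedness of \<open>T K\<close> is included because the powers
  \<open>T^j q[T]^-1\<close> are built from it; \<open>T^2 K\<close> is then a combination of the
  identity, \<open>T K\<close> and \<open>K\<close>.\<close>

definition Q_inverse :: "complex \<Rightarrow> ('v ^ 'n set \<Rightarrow> 'v ^ 'n set) \<Rightarrow> bool" where
  "Q_inverse z K \<longleftrightarrow> bounded_linear K \<and> bounded_linear (\<lambda>v. pow (Suc 0) (K v)) \<and>
     (\<forall>v. K v \<in> D 2 \<and> Q z (K v) = v) \<and> (\<forall>v\<in>D 2. K (Q z v) = v)"

lemma Q_inverse_D:
  assumes "Q_inverse z K"
  shows "K v \<in> D 2" "K v \<in> D (Suc 0)" "Q z (K v) = v"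
    "pow 2 (K v) = v + (2 * Re z) *\<^sub>R pow (Suc 0) (K v) - (cmod z)\<^sup>2 *\<^sub>R K v"
    "v \<in> D 2 \<Longrightarrow> K (Q z v) = v"
proof -
  show K: "K v \<in> D 2" "Q z (K v) = v" and "v \<in> D 2 \<Longrightarrow> K (Q z v) = v"
    using assms unfolding Q_inverse_def by blast+
  show "K v \<in> D (Suc 0)" using D_antimono[OF K(1)] by simp
  have "pow 2 (K v) = Q z (K v) + (2 * Re z) *\<^sub>R pow (Suc 0) (K v) - (cmod z)\<^sup>2 *\<^sub>R K v"
    by (simp add: Q_def)
  then show "pow 2 (K v) = v + (2 * Re z) *\<^sub>R pow (Suc 0) (K v) - (cmod z)\<^sup>2 *\<^sub>R K v"
    by (simp only: K(2))
qed

text \<open>Regularity is bootstrapped: \<open>T^2 K v\<close> is a combination of \<open>v\<close>,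
  \<open>T K v\<close> and \<open>K v\<close>, all in the domain of \<open>T\<close>, so
  \<open>K v\<close> has a third power. Then \<open>Q_z[T]\<close> sends \<open>T K v\<close> to
  \<open>T v\<close>, and \<open>K\<close> undoes it.\<close>

lemma Q_inverse_commute:
  assumes K: "Q_inverse z K" and v: "v \<in> D (Suc 0)"
  shows "K v \<in> D 3" "pow (Suc 0) (K v) = K (pow (Suc 0) v)"
proof -
  note KD = Q_inverse_D[OF K]
  let ?u = "K v" and ?t = "pow (Suc 0)"
  have u1: "?t ?u \<in> D (Suc 0)" using KD(1)[of v] D_plus[of ?u "Suc 0" "Suc 0"] by (auto simp: numeral_2_eq_2)
  have "v + (2 * Re z) *\<^sub>R ?t ?u - (cmod z)\<^sup>2 *\<^sub>R ?u \<in> D (Suc 0)"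
    using v u1 KD(2)[of v] by (intro D_linear) auto
  then have "pow 2 ?u \<in> D (Suc 0)" by (simp only: KD(4))
  then show u3: "?u \<in> D 3" using KD(1)[of v] D_plus[of ?u "Suc 0" 2] by (simp add: numeral_3_eq_3 numeral_2_eq_2)
  then have t2: "?t ?u \<in> D 2" using D_plus[of ?u 2 "Suc 0"] by (simp add: numeral_3_eq_3 numeral_2_eq_2)
  have p: "pow 2 (?t ?u) = ?t (pow 2 ?u)"
    using pow_plus[of ?u 2 "Suc 0"] pow_plus[of ?u "Suc 0" 2] u3 by (simp add: numeral_3_eq_3 numeral_2_eq_2)
  have dom: "v \<in> D (Suc 0)" "?t ?u \<in> D (Suc 0)" "?u \<in> D (Suc 0)" using v u1 KD(2) by auto
  have "?t (pow 2 ?u) = ?t v + (2 * Re z) *\<^sub>R ?t (?t ?u) - (cmod z)\<^sup>2 *\<^sub>R ?t ?u"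
    unfolding KD(4)[of v] using dom by (simp only: pow_linear D_linear)
  then have "Q z (?t ?u) = ?t v"
    unfolding Q_def p by simp
  then show "?t ?u = K (?t v)" using KD(5)[OF t2] by simp
qed

lemma Q_inverse_pow:
  assumes K: "Q_inverse z K" and v: "v \<in> D k"
  shows "K v \<in> D (k + 2) \<and> pow k (K v) = K (pow k v)"
  using v
proof (induction k)
  case 0 then show ?case using Q_inverse_D[OF K] by (simp add: numeral_2_eq_2)
next
  case (Suc k)
  have v: "v \<in> D k" "pow k v \<in> D (Suc 0)" using D_Suc[of v k] Suc.prems by blast+
  then have IH: "K v \<in> D (k + 2)" "pow k (K v) = K (pow k v)" using Suc.IH by auto
  then have Kk: "K v \<in> D k" using D_antimono[of "K v" "k + 2" k] by simp
  have "pow k (K v) \<in> D 3" unfolding IH(2) by (rule Q_inverse_commute[OF K v(2)])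
  then have "K v \<in> D (3 + k)" using D_plus[of "K v" 3 k] Kk by blast
  then have "K v \<in> D (Suc k + 2)" by (simp add: numeral_3_eq_3 add.commute)
  moreover have "pow (Suc k) (K v) = K (pow (Suc k) v)"
    using Q_inverse_commute(2)[OF K v(2)] by (simp only: pow_Suc[OF Kk] pow_Suc[OF v(1)] IH)
  ultimately show ?case by blast
qed

text \<open>The resolvent identity \<open>K - L = K (Q_w - Q_z) L\<close>; the terms in
  \<open>T^2\<close> cancel, so only \<open>L\<close> and \<open>T L\<close> appear.\<close>

lemma Q_inverse_diff:
  assumes K: "Q_inverse z K" and L: "Q_inverse w L"
  shows "K v - L v = (2 * (Re z - Re w)) *\<^sub>R K (pow (Suc 0) (L v)) - ((cmod z)\<^sup>2 - (cmod w)\<^sup>2) *\<^sub>R K (L v)"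
proof -
  note KD = Q_inverse_D[OF K] and LD = Q_inverse_D[OF L]
  interpret K: bounded_linear K using K by (simp add: Q_inverse_def)
  have "K v - L v = K (Q w (L v) - Q z (L v))"
    using KD(5)[OF LD(1)[of v]] LD(3)[of v] by (simp add: K.diff)
  also have "Q w (L v) - Q z (L v) = (2 * (Re z - Re w)) *\<^sub>R pow (Suc 0) (L v) - ((cmod z)\<^sup>2 - (cmod w)\<^sup>2) *\<^sub>R L v"
    by (simp add: Q_def algebra_simps)
  finally show ?thesis by (simp add: K.diff K.scaleR)
qed

text \<open>Induction on the degree, splitting off one conjugate pair of zeros at a time.
  Boundedness of all powers up to the full degree is part of the induction because the next factor
  raises it by two.\<close>

lemma poly_inverse:
  assumes "q \<noteq> 0" and "\<And>z. cpoly q z = 0 \<Longrightarrow> Im z \<noteq> 0 \<and> (\<exists>K. Q_inverse z K)"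
  shows "\<exists>E. (\<forall>v. E v \<in> D (degree q) \<and> poly_at q (E v) = v) \<and> (\<forall>v\<in>D (degree q). E (poly_at q v) = v) \<and>
    (\<forall>j\<le>degree q. bounded_linear (\<lambda>v. pow j (E v)))"
  using assms
proof (induction "degree q" arbitrary: q rule: less_induct)
  case less
  show ?case
  proof (cases "degree q = 0")
    case True
    then obtain c where q: "q = [:c:]" "c \<noteq> 0" using less.prems(1) degree_eq_zeroE by (metis pCons_0_0)
    show ?thesis
      by (rule exI[of _ "\<lambda>v. (1 / c) *\<^sub>R v"]) (use q in \<open>auto simp: poly_at_def bounded_linear_scaleR_right\<close>)
  next
    case False
    then have "\<not> constant (poly (map_poly complex_of_real q))"
      by (simp add: constant_degree degree_cpoly)
    then obtain z where z: "cpoly q z = 0"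
      unfolding cpoly_def using fundamental_theorem_of_algebra by blast
    obtain K where im: "Im z \<noteq> 0" and K: "Q_inverse z K" using less.prems(2)[OF z] by blast
    \<comment> \<open>The remainder is real and of degree at most 1, yet vanishes at the nonreal
      point \<open>z\<close>, so it is 0.\<close>
    have "Qpoly z dvd q"
    proof -
      let ?r = "q mod Qpoly z"
      have "cpoly (Qpoly z) z = 0"
        by (simp add: Qpoly_def cpoly_pCons complex_eq_iff cmod_power2 algebra_simps) (simp add: power2_eq_square)
      moreover have "cpoly q z = cpoly (q div Qpoly z) z * cpoly (Qpoly z) z + cpoly ?r z"
        by (simp only: cpoly_mult[symmetric] cpoly_add[symmetric] div_mult_mod_eq)
      ultimately have r: "cpoly ?r z = 0" using z by simp
      have "Qpoly z \<noteq> 0" "degree (Qpoly z) = 2" by (auto simp: Qpoly_def)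
      then have "degree ?r \<le> 1" using degree_mod_less'[of "Qpoly z" q] by (cases "?r = 0") auto
      then have ab: "?r = [:coeff ?r 0, coeff ?r 1:]" (is "_ = [:?a, ?b:]")
        by (intro poly_eqI) (auto simp: coeff_pCons coeff_eq_0 split: nat.splits)
      have "of_real ?a + z * of_real ?b = 0"
        using r by (subst (asm) ab) (simp add: cpoly_pCons)
      then have "?b = 0" "?a = 0" using im by (auto simp: complex_eq_iff)
      then have "?r = 0" using ab by simp
      then show ?thesis by (simp add: dvd_eq_mod_eq_0)
    qed
    then obtain q1 where q: "q = Qpoly z * q1" by blast
    then have q1: "q1 \<noteq> 0" using less.prems(1) by auto
    have deg: "degree q = Suc (Suc (degree q1))"
      unfolding q using q1 by (subst degree_mult_eq) (auto simp: Qpoly_def)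
    have "\<And>w. cpoly q1 w = 0 \<Longrightarrow> Im w \<noteq> 0 \<and> (\<exists>K. Q_inverse w K)"
      using less.prems(2) by (simp add: q cpoly_mult)
    then obtain E where E: "\<And>v. E v \<in> D (degree q1)" "\<And>v. poly_at q1 (E v) = v" "\<And>v. v \<in> D (degree q1) \<Longrightarrow> E (poly_at q1 v) = v"
        "\<And>j. j \<le> degree q1 \<Longrightarrow> bounded_linear (\<lambda>v. pow j (E v))"
      using less.hyps[of q1] q1 deg by auto
    note KD = Q_inverse_D[OF K]
    have KE: "K (E v) \<in> D (degree q)" for v
      using Q_inverse_pow[OF K E(1)[of v]] deg by simp
    show ?thesis
    proof (intro exI[of _ "\<lambda>v. K (E v)"] conjI allI ballI impI KE)
      show "poly_at q (K (E v)) = v" for v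
        using poly_at_Qpoly_mult(1)[of "K (E v)" q1 z] KE[of v] unfolding q[symmetric] deg by (simp add: KD E)
      show "K (E (poly_at q v)) = v" if "v \<in> D (degree q)" for v
      proof -
        have "v \<in> D 2" using D_antimono[OF that, of 2] deg by simp
        then show ?thesis
          using poly_at_Qpoly_mult[of v q1 z] that unfolding q[symmetric] deg by (simp add: KD E)
      qed
      show "bounded_linear (\<lambda>v. pow j (K (E v)))" if j: "j \<le> degree q" for j
      proof -
        have K1: "bounded_linear K" and K2: "bounded_linear (\<lambda>v. pow (Suc 0) (K v))" using K by (auto simp: Q_inverse_def)
        let ?m = "degree q1"
        note b = E(4)[OF order_refl]
        \<comment> \<open>\<open>E v\<close> is regular enough for \<open>?m\<close> powers; the at
          most two further powers are absorbed by \<open>K\<close>.\<close>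
        have top: "pow (i + ?m) (K (E v)) = pow i (K (pow ?m (E v)))" if "i \<le> 2" for i v
        proof -
          have "K (E v) \<in> D (i + ?m)" using D_antimono[OF KE[of v], of "i + ?m"] that deg by simp
          then show ?thesis using pow_plus Q_inverse_pow[OF K E(1)[of v]] by metis
        qed
        consider "j \<le> ?m" | "j = Suc 0 + ?m" | "j = 2 + ?m" using j deg by linarith
        then show ?thesis
        proof cases
          case 1
          have "pow j (K (E v)) = K (pow j (E v))" for v
            using Q_inverse_pow[OF K, of "E v" j] D_antimono[OF E(1) 1] by auto
          then show ?thesis using bounded_linear_compose[OF K1 E(4)[OF 1]] by simp
        next
          case 2
          have "pow (Suc 0 + ?m) (K (E v)) = pow (Suc 0) (K (pow ?m (E v)))" for v
            by (rule top) simp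
          then show ?thesis unfolding 2 using bounded_linear_compose[OF K2 b] by (simp only:)
        next
          case 3
          have "bounded_linear (\<lambda>v. pow ?m (E v) + (2 * Re z) *\<^sub>R pow (Suc 0) (K (pow ?m (E v))) - (cmod z)\<^sup>2 *\<^sub>R K (pow ?m (E v)))"
            by (intro bounded_linear_add bounded_linear_sub b
              bounded_linear_compose[OF bounded_linear_scaleR_right bounded_linear_compose[OF K2 b]]
              bounded_linear_compose[OF bounded_linear_scaleR_right bounded_linear_compose[OF K1 b]])
          then show ?thesis unfolding 3 by (simp only: top KD(4) order_refl)
        qed
      qed
    qed
  qed
qed

end

section \<open>Bisectorial operators\<close>

lemma lmul_linear:
  "lmul (a + b) v = lmul a v + lmul b v" "lmul a (v + w) = lmul a v + lmul a w"
  "lmul (r *\<^sub>R a) v = r *\<^sub>R lmul a v" "lmul a (r *\<^sub>R v) = r *\<^sub>R lmul a v"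
  by (simp_all add: lmul_def plus_clifford.rep_eq scaleR_clifford.rep_eq vec_lmul_linear)

lemma lmul_mult: "lmul (a * b) v = lmul a (lmul b v)"
  by (simp add: lmul_def times_clifford.rep_eq vec_lmul_assoc)

lemma lmul_of_real: "lmul (of_real r) v = r *\<^sub>R v"
  by (simp add: lmul_def of_real_def scaleR_clifford.rep_eq one_clifford.rep_eq vec_lmul_linear vec_lmul_one_left)

lemma lmul_emb: "lmul (emb J z) v = Re z *\<^sub>R v + Im z *\<^sub>R lmul J v"
  by (simp add: emb_def lmul_linear lmul_of_real)

lemma bounded_linear_lmul:
  "bounded_linear (lmul a :: 'v::real_normed_vector ^ ('n::{finite,linorder} set) \<Rightarrow> 'v ^ 'n set)"
proof (rule bounded_linear_intro)
  fix v :: "'v ^ 'n set"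
  have "norm (lmul a v) \<le> (\<Sum>C\<in>UNIV. norm (lmul a v $ C))"
    by (simp add: norm_vec_def L2_set_le_sum)
  also have "\<dots> \<le> (\<Sum>C\<in>UNIV. \<Sum>A\<in>UNIV. \<bar>csign A (sym_diff A C) * coords a $ A\<bar> * norm v)"
  proof (rule sum_mono)
    fix C :: "'n set"
    show "norm (lmul a v $ C) \<le> (\<Sum>A\<in>UNIV. \<bar>csign A (sym_diff A C) * coords a $ A\<bar> * norm v)"
      unfolding lmul_def vec_lmul_nth
      by (rule sum_norm_le) (simp add: mult_left_mono Finite_Cartesian_Product.norm_nth_le)
  qed
  also have "\<dots> = norm v * (\<Sum>C\<in>UNIV. \<Sum>A\<in>UNIV. \<bar>csign A (sym_diff A C) * coords a $ A\<bar>)"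
    by (simp add: sum_distrib_left mult.commute)
  finally show "norm (lmul a v) \<le> norm v * (\<Sum>C\<in>UNIV. \<Sum>A\<in>UNIV. \<bar>csign A (sym_diff A C) * coords a $ A\<bar>)" .
qed (rule lmul_linear)+

text \<open>The resolvent bound is given only for angles strictly above \<omega>, so a point outside
  the closed sector needs a slightly larger angle that still excludes it.\<close>

lemma larger_angle:
  assumes "\<omega> \<in> {0<..<pi/2}" "z \<notin> closed_sector \<omega>"
  obtains \<phi> where "\<phi> \<in> {\<omega><..<pi/2}" "z \<notin> closed_sector \<phi>"
proof -
  have "cos \<omega> \<noteq> 0" using assms(1) cos_gt_zero_pi[of \<omega>] by auto
  then have "((\<lambda>\<theta>. tan \<theta> * \<bar>Re z\<bar>) \<longlongrightarrow> tan \<omega> * \<bar>Re z\<bar>) (at_right \<omega>)"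
    by (intro tendsto_intros)
  then have "\<forall>\<^sub>F \<theta> in at_right \<omega>. tan \<theta> * \<bar>Re z\<bar> < \<bar>Im z\<bar>"
    using assms(2) by (intro order_tendstoD) (auto simp: closed_sector_def)
  moreover have "\<forall>\<^sub>F \<theta> in at_right \<omega>. \<theta> \<in> {\<omega><..<pi/2}"
    using assms(1) by (intro eventually_at_right_real) auto
  ultimately have "\<forall>\<^sub>F \<theta> in at_right \<omega>. \<theta> \<in> {\<omega><..<pi/2} \<and> z \<notin> closed_sector \<theta>"
    by eventually_elim (simp add: closed_sector_def)
  from eventually_happens'[OF _ this] show ?thesis using that by auto
qed

lemma upper_sector_not_sector:
  assumes \<phi>: "\<phi> \<in> {0<..<pi/2}" and z: "z \<in> upper_sector \<phi>"
  shows "sin \<phi> * cmod z \<le> Im z" "z \<notin> sector \<phi>" "cnj z \<notin> sector \<phi>" "z \<noteq> 0"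
    and "\<omega> \<in> {0<..<\<phi>} \<Longrightarrow> z \<notin> closed_sector \<omega>"
proof -
  obtain r \<theta> where z: "z = r *\<^sub>R cis \<theta>" "r > 0" "\<theta> \<in> {\<phi>..pi - \<phi>}" using z by (auto simp: upper_sector_def)
  have sin: "sin \<phi> \<le> sin \<theta>"
  proof (cases "\<theta> \<le> pi / 2")
    case True
    then show ?thesis using z \<phi> by (intro sin_monotone_2pi_le) auto
  next
    case False
    have "sin \<phi> \<le> sin (pi - \<theta>)" using z \<phi> False by (intro sin_monotone_2pi_le) auto
    then show ?thesis by simp
  qed
  have s: "sin \<phi> > 0" and c: "cos \<phi> > 0" using \<phi> by (auto intro: sin_gt_zero cos_gt_zero)
  have "(sin \<phi>)\<^sup>2 \<le> (sin \<theta>)\<^sup>2" using sin s by (intro power_mono) auto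
  then have "\<bar>cos \<theta>\<bar>\<^sup>2 \<le> (cos \<phi>)\<^sup>2" by (simp add: cos_squared_eq)
  then have cos: "\<bar>cos \<theta>\<bar> \<le> cos \<phi>" using c by (simp add: power2_le_iff_abs_le)
  show "sin \<phi> * cmod z \<le> Im z" using z sin by (simp add: norm_mult)
  have "tan \<phi> * \<bar>cos \<theta>\<bar> \<le> tan \<phi> * cos \<phi>" using cos s c by (intro mult_left_mono) (auto simp: tan_def)
  also have "\<dots> \<le> sin \<theta>" using c sin by (simp add: tan_def)
  finally have t: "tan \<phi> * \<bar>cos \<theta>\<bar> \<le> \<bar>sin \<theta>\<bar>" by simp
  then have t': "tan \<phi> * \<bar>Re z\<bar> \<le> \<bar>Im z\<bar>" using z by (simp add: abs_mult algebra_simps)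
  then show "z \<notin> sector \<phi>" "cnj z \<notin> sector \<phi>" by (auto simp: sector_def)
  show "z \<noteq> 0" using z by auto
  assume \<omega>: "\<omega> \<in> {0<..<\<phi>}"
  then have "tan \<omega> < tan \<phi>" using \<phi> by (intro tan_monotone) auto
  have im: "\<bar>Im z\<bar> > 0" using z sin s by simp
  have "tan \<omega> * \<bar>Re z\<bar> < \<bar>Im z\<bar>"
  proof (cases "Re z = 0")
    case False
    then have "tan \<omega> * \<bar>Re z\<bar> < tan \<phi> * \<bar>Re z\<bar>" using \<open>tan \<omega> < tan \<phi>\<close> by simp
    then show ?thesis using t' by simp
  qed (use im in simp)
  then show "z \<notin> closed_sector \<omega>" by (simp add: closed_sector_def)
qed

locale bisectorial_operator = real_operator T for T :: "('v::banach, 'n::{finite,linorder}) op" +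
  fixes \<omega> :: real
  assumes \<omega>: "\<omega> \<in> {0<..<pi/2}" and bisectorial: "bisectorial \<omega> T"
begin

definition K_fun :: "complex \<Rightarrow> 'v ^ 'n set \<Rightarrow> 'v ^ 'n set" where
  "K_fun z v = the (op_inv (op_poly (Qpoly z) T) v)"

lemma Q_op_emb: "J \<in> sphere_units \<Longrightarrow> Q_op (emb J z) T = op_poly (Qpoly z) T"
  by (simp add: Q_op_def Qpoly_def emb_paravector)

lemma op_poly_Qpoly: "op_poly (Qpoly z) T v = (if v \<in> D 2 then Some (Q z v) else None)"
  by (simp add: op_poly_eq poly_at_Qpoly) (simp add: Qpoly_def numeral_2_eq_2)

lemma resolvent:
  assumes z: "z \<notin> closed_sector \<omega>"
  shows "bounded_linear (K_fun z)" "K_fun z v \<in> D 2" "Q z (K_fun z v) = v" "v \<in> D 2 \<Longrightarrow> K_fun z (Q z v) = v"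
    "J \<in> sphere_units \<Longrightarrow> left_S_resolvent (emb J z) T v = K_fun z (lmul (emb J (cnj z)) v) - pow (Suc 0) (K_fun z v)"
proof -
  have all: "bounded_linear (K_fun z) \<and> inj_on (op_poly (Qpoly z) T) (D 2) \<and> op_inv (op_poly (Qpoly z) T) = Some \<circ> K_fun z"
  proof -
    \<comment> \<open>Any unit serves: the quadratic operator depends only on the real part and the
      norm of the paravector.\<close>
    define J :: "'n clifford" where "J = gen undefined"
    have J: "J \<in> sphere_units" unfolding J_def by (rule sphere_units_nonempty)
    then have "emb J z \<in> S_resolvent_set T"
      using bisectorial closure_double_sector[OF \<omega> J, of z] z emb_paravector(1)[OF J, of z]
      unfolding bisectorial_def S_spectrum_def by blast
    then have inj: "inj_on (op_poly (Qpoly z) T) (dom (op_poly (Qpoly z) T))" and "op_inv (op_poly (Qpoly z) T) \<in> bounded_ops"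
      by (auto simp: S_resolvent_set_def Q_op_emb[OF J])
    then obtain B where B: "bounded_linear B" "op_inv (op_poly (Qpoly z) T) = Some \<circ> B" by (auto simp: bounded_ops_def)
    then have "K_fun z = B" by (auto simp: K_fun_def fun_eq_iff)
    moreover have "dom (op_poly (Qpoly z) T) = D 2" by (auto simp: op_poly_Qpoly dom_def split: if_splits)
    ultimately show ?thesis using B inj by auto
  qed
  then have inv: "op_inv (op_poly (Qpoly z) T) v = Some (K_fun z v)" for v by simp
  show "bounded_linear (K_fun z)" using all by blast
  have left: "K_fun z (Q z v) = v" if "v \<in> D 2" for v
  proof -
    have eq: "op_poly (Qpoly z) T v = Some (Q z v)" using that by (simp add: op_poly_Qpoly)
    then have "Q z v \<in> ran (op_poly (Qpoly z) T)" by (auto simp: ran_def)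
    moreover have "(THE x. op_poly (Qpoly z) T x = Some (Q z v)) = v"
    proof (rule the_equality)
      show "op_poly (Qpoly z) T v = Some (Q z v)" by (rule eq)
      fix x assume "op_poly (Qpoly z) T x = Some (Q z v)"
      moreover from this have "x \<in> D 2" by (auto simp: op_poly_Qpoly split: if_splits)
      ultimately show "x = v" using all that eq by (metis inj_onD)
    qed
    ultimately show ?thesis using inv[of "Q z v"] by (simp add: op_inv_def)
  qed
  then show "v \<in> D 2 \<Longrightarrow> K_fun z (Q z v) = v" .
  have right: "K_fun z v \<in> D 2 \<and> Q z (K_fun z v) = v" for v
  proof -
    have "v \<in> ran (op_poly (Qpoly z) T)" using inv[of v] by (auto simp: op_inv_def split: if_splits)
    then obtain x where "op_poly (Qpoly z) T x = Some v" by (auto simp: ran_def)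
    then have "x \<in> D 2" "Q z x = v" by (auto simp: op_poly_Qpoly split: if_splits)
    then show ?thesis using left[of x] by simp
  qed
  then show r: "K_fun z v \<in> D 2" "Q z (K_fun z v) = v" by auto
  show "left_S_resolvent (emb J z) T v = K_fun z (lmul (emb J (cnj z)) v) - pow (Suc 0) (K_fun z v)" if "J \<in> sphere_units"
    unfolding left_S_resolvent_def Q_op_emb[OF that] emb_paravector(4)[OF that]
    by (simp add: inv pow_1 map_comp_def)
qed

lemma resolvent_norm:
  assumes "\<phi> \<in> {\<omega><..<pi/2}"
  obtains C where "C \<ge> 0"
    "\<And>z J v. z \<notin> sector \<phi> \<Longrightarrow> z \<noteq> 0 \<Longrightarrow> J \<in> sphere_units \<Longrightarrow> norm (left_S_resolvent (emb J z) T v) \<le> C / cmod z * norm v"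
proof -
  have "\<forall>\<phi>\<in>{\<omega><..<pi/2}. \<exists>C\<ge>0. \<forall>s\<in>paravectors - (double_sector \<phi> \<union> {0}). \<forall>v.
      norm (left_S_resolvent s T v) \<le> C / norm s * norm v"
    using bisectorial unfolding bisectorial_def by (rule conjunct2)
  from bspec[OF this assms] obtain C where "C \<ge> 0"
      and C: "\<forall>s\<in>paravectors - (double_sector \<phi> \<union> {0}). \<forall>v. norm (left_S_resolvent s T v) \<le> C / norm s * norm v"
    by (elim exE conjE)
  show ?thesis
  proof
    fix z J v assume z: "z \<notin> sector \<phi>" "z \<noteq> 0" and J: "J \<in> (sphere_units :: 'n clifford set)"
    have "emb J z \<in> paravectors - (double_sector \<phi> \<union> {0})"
      using z emb_paravector(1)[OF J, of z] double_sector_eq(2)[OF _ J, of \<phi> z] emb_eq_0_iff[OF J, of z] assms \<omega> by auto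
    with C show "norm (left_S_resolvent (emb J z) T v) \<le> C / cmod z * norm v"
      using emb_paravector(3)[OF J, of z] by metis
  qed (rule \<open>C \<ge> 0\<close>)
qed

text \<open>Boundedness of \<open>T K\<close> is read off from the S-resolvent, which is bounded by
  bisectoriality and differs from \<open>- T K\<close> only by the bounded map
  \<open>v \<mapsto> K (cnj s v)\<close>.\<close>

lemma Q_inverse_K_fun:
  assumes z: "z \<notin> closed_sector \<omega>"
  shows "Q_inverse z (K_fun z)"
proof -
  define J :: "'n clifford" where "J = gen undefined"
  have J: "J \<in> sphere_units" unfolding J_def by (rule sphere_units_nonempty)
  obtain \<phi> where \<phi>: "\<phi> \<in> {\<omega><..<pi/2}" "z \<notin> closed_sector \<phi>" using larger_angle[OF \<omega> z] .
  then have z0: "z \<noteq> 0" "z \<notin> sector \<phi>" using sector_subset_closed_sector by (auto simp: closed_sector_def)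
  obtain C where C: "\<And>v. norm (left_S_resolvent (emb J z) T v) \<le> C / cmod z * norm v"
    using resolvent_norm[OF \<phi>(1)] z0 J by metis
  note res = resolvent[OF z]
  interpret K: bounded_linear "K_fun z" by (rule res(1))
  have KL: "bounded_linear (\<lambda>v. K_fun z (lmul (emb J (cnj z)) v))"
    by (rule bounded_linear_compose[OF res(1) bounded_linear_lmul])
  obtain B where B: "\<And>v. norm (K_fun z (lmul (emb J (cnj z)) v)) \<le> norm v * B"
    using bounded_linear.bounded[OF KL] by blast
  have K1: "K_fun z v \<in> D (Suc 0)" for v using D_antimono[OF res(2)] by simp
  have "bounded_linear (\<lambda>v. pow (Suc 0) (K_fun z v))"
  proof (rule bounded_linear_intro)
    fix v
    have "norm (pow (Suc 0) (K_fun z v)) = norm (K_fun z (lmul (emb J (cnj z)) v) - left_S_resolvent (emb J z) T v)"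
      using res(5)[OF J, of v] by simp
    also have "\<dots> \<le> norm v * B + C / cmod z * norm v"
      by (intro order_trans[OF norm_triangle_ineq4] add_mono B C)
    also have "\<dots> = norm v * (B + C / cmod z)" by (simp add: algebra_simps)
    finally show "norm (pow (Suc 0) (K_fun z v)) \<le> norm v * (B + C / cmod z)" .
  qed (simp_all add: K.add K.scaleR pow_linear K1)
  then show ?thesis using res by (simp add: Q_inverse_def)
qed

definition K :: "complex \<Rightarrow> ('v ^ 'n set) \<Rightarrow>\<^sub>L ('v ^ 'n set)" where
  "K z = Blinfun (K_fun z)"

definition M :: "complex \<Rightarrow> ('v ^ 'n set) \<Rightarrow>\<^sub>L ('v ^ 'n set)" where
  "M z = Blinfun (\<lambda>v. pow (Suc 0) (K_fun z v))"

lemma KM_apply: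
  assumes "z \<notin> closed_sector \<omega>"
  shows "blinfun_apply (K z) = K_fun z" "blinfun_apply (M z) = (\<lambda>v. pow (Suc 0) (K_fun z v))"
  using Q_inverse_K_fun[OF assms] by (simp_all add: K_def M_def Q_inverse_def bounded_linear_Blinfun_apply)

lemma KM_cnj: "K (cnj z) = K z" "M (cnj z) = M z"
  by (simp_all add: K_def M_def K_fun_def[abs_def] Qpoly_def)

lemma sector_resolvent_KM:
  assumes \<phi>: "\<phi> \<in> {\<omega><..<pi/2}"
  obtains C where "sector_resolvent \<phi> C K M"
proof -
  have \<phi>': "\<phi> \<in> {0<..<pi/2}" and \<omega>\<phi>: "\<omega> \<in> {0<..<\<phi>}" using \<phi> \<omega> by auto
  define J :: "'n clifford" where "J = gen undefined"
  have J: "J \<in> sphere_units" unfolding J_def by (rule sphere_units_nonempty)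
  obtain C where C: "C \<ge> 0" "\<And>z v. z \<notin> sector \<phi> \<Longrightarrow> z \<noteq> 0 \<Longrightarrow> norm (left_S_resolvent (emb J z) T v) \<le> C / cmod z * norm v"
    using resolvent_norm[OF \<phi>] J by metis
  obtain c where c: "c \<ge> 0" "\<And>v. norm (lmul J (v :: 'v ^ 'n set)) \<le> norm v * c"
    using bounded_linear.nonneg_bounded[OF bounded_linear_lmul] by blast
  have sec: "z \<notin> closed_sector \<omega>" "z \<notin> sector \<phi>" "cnj z \<notin> sector \<phi>" "z \<noteq> 0" "sin \<phi> * cmod z \<le> Im z"
    if "z \<in> upper_sector \<phi>" for z
    using upper_sector_not_sector[OF \<phi>' that] \<omega>\<phi> by auto
  have s: "sin \<phi> > 0" using \<phi>' by (intro sin_gt_zero) auto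
  define C1 where "C1 = C * c / sin \<phi>"
  define C2 where "C2 = C1 + C1 * c + C"
  have C1: "C1 \<ge> 0" using C c s by (simp add: C1_def)
  have nK: "norm (K_fun z v) \<le> C1 / (cmod z)\<^sup>2 * norm v" if z: "z \<in> upper_sector \<phi>" for z v
  proof -
    note zs = sec[OF z]
    have zc: "cnj z \<notin> closed_sector \<omega>" using zs(1) by (simp add: closed_sector_def)
    interpret Kz: bounded_linear "K_fun z" by (rule resolvent(1)[OF zs(1)])
    have K_cnj: "K_fun (cnj z) = K_fun z" by (simp add: K_fun_def Qpoly_def fun_eq_iff)
    have JJ: "lmul J (lmul J v) = - v"
      using lmul_mult[of J J v] lmul_linear(3)[of "-1" 1 v] lmul_of_real[of 1 v] by (simp add: sphere_units_square[OF J])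
    \<comment> \<open>In the difference of the S-resolvents at \<open>s\<close> and its conjugate
      the terms in \<open>T K\<close> cancel. What remains is \<open>K\<close> applied to
      \<open>- 2 Im z J ?w\<close>, which is \<open>2 Im z v\<close>, and \<open>Im z\<close> is at
      least \<open>sin \<phi>\<close> times \<open>cmod z\<close>.\<close>
    let ?w = "lmul J v"
    have "left_S_resolvent (emb J z) T ?w - left_S_resolvent (emb J (cnj z)) T ?w = K_fun z (lmul (emb J (cnj z)) ?w - lmul (emb J z) ?w)"
      unfolding resolvent(5)[OF zs(1) J] resolvent(5)[OF zc J] K_cnj by (simp add: Kz.diff)
    also have "lmul (emb J (cnj z)) ?w - lmul (emb J z) ?w = (2 * Im z) *\<^sub>R v"
      by (simp add: lmul_emb JJ flip: scaleR_add_left)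
    also have "K_fun z \<dots> = (2 * Im z) *\<^sub>R K_fun z v" by (rule Kz.scaleR)
    finally have "\<bar>2 * Im z\<bar> * norm (K_fun z v) = norm (left_S_resolvent (emb J z) T ?w - left_S_resolvent (emb J (cnj z)) T ?w)"
      by simp
    also have "\<dots> \<le> C / cmod z * norm ?w + C / cmod z * norm ?w"
      using C(2)[of z ?w] C(2)[of "cnj z" ?w] zs by (intro order_trans[OF norm_triangle_ineq4] add_mono) auto
    also have "\<dots> \<le> 2 * (C / cmod z * (norm v * c))"
      using c(2)[of v] C(1) by (simp add: mult_left_mono divide_right_mono)
    finally have 1: "\<bar>Im z\<bar> * norm (K_fun z v) \<le> C / cmod z * (norm v * c)" by simp
    have "sin \<phi> * cmod z * norm (K_fun z v) \<le> \<bar>Im z\<bar> * norm (K_fun z v)"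
      using zs(5) by (intro mult_right_mono) auto
    with 1 have "sin \<phi> * cmod z * norm (K_fun z v) \<le> C / cmod z * (norm v * c)" by linarith
    then show ?thesis using s zs(4) by (simp add: C1_def field_simps power2_eq_square)
  qed
  have nM: "norm (pow (Suc 0) (K_fun z v)) \<le> C2 / cmod z * norm v" if z: "z \<in> upper_sector \<phi>" for z v
  proof -
    note zs = sec[OF z]
    interpret Kz: bounded_linear "K_fun z" by (rule resolvent(1)[OF zs(1)])
    have 1: "norm (K_fun z (lmul (emb J (cnj z)) v)) \<le> C1 / (cmod z)\<^sup>2 * (cmod z * norm v + cmod z * (norm v * c))"
    proof (rule order_trans[OF nK[OF z]], rule mult_left_mono)
      have "norm (lmul (emb J (cnj z)) v) \<le> \<bar>Re z\<bar> * norm v + \<bar>Im z\<bar> * norm (lmul J v)"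
        unfolding lmul_emb by (rule order_trans[OF norm_triangle_ineq]) simp
      also have "\<dots> \<le> cmod z * norm v + cmod z * (norm v * c)"
        using abs_Re_le_cmod[of z] abs_Im_le_cmod[of z] c by (intro add_mono mult_mono) auto
      finally show "norm (lmul (emb J (cnj z)) v) \<le> cmod z * norm v + cmod z * (norm v * c)" .
    qed (use C1 in simp)
    have "norm (pow (Suc 0) (K_fun z v)) = norm (K_fun z (lmul (emb J (cnj z)) v) - left_S_resolvent (emb J z) T v)"
      using resolvent(5)[OF zs(1) J, of v] by simp
    also have "\<dots> \<le> C1 / (cmod z)\<^sup>2 * (cmod z * norm v + cmod z * (norm v * c)) + C / cmod z * norm v"
      by (intro order_trans[OF norm_triangle_ineq4] add_mono 1 C(2) zs)
    also have "\<dots> = C2 / cmod z * norm v"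
      using zs(4) by (simp add: C2_def field_simps power2_eq_square)
    finally show ?thesis .
  qed
  have C12: "C1 \<le> C2" using C1 C c by (simp add: C2_def)
  have "sector_resolvent \<phi> C2 K M"
  proof
    show "0 < \<phi>" "\<phi> < pi / 2" using \<phi>' by auto
    fix z assume z: "z \<in> upper_sector \<phi>"
    note zs = sec(1)[OF z]
    note app = KM_apply[OF zs]
    have Kz: "Q_inverse z (K_fun z)" by (rule Q_inverse_K_fun[OF zs])
    note KD = Q_inverse_D[OF Kz] and comm = Q_inverse_commute(2)[OF Kz]
    show "K z o\<^sub>L M z = M z o\<^sub>L K z"
      by (rule blinfun_eqI) (simp add: app comm KD)
    show "M z o\<^sub>L M z = K z + (2 * Re z) *\<^sub>R (M z o\<^sub>L K z) - (cmod z)\<^sup>2 *\<^sub>R (K z o\<^sub>L K z)"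
    proof (rule blinfun_eqI)
      fix v
      have "pow (Suc 0) (K_fun z (pow (Suc 0) (K_fun z v))) = pow (Suc 0) (pow (Suc 0) (K_fun z (K_fun z v)))"
        by (simp only: comm KD)
      also have "\<dots> = pow 2 (K_fun z (K_fun z v))"
        using pow_plus[of "K_fun z (K_fun z v)" "Suc 0" "Suc 0"] KD(1) by (simp add: numeral_2_eq_2)
      finally show "blinfun_apply (M z o\<^sub>L M z) v = blinfun_apply (K z + (2 * Re z) *\<^sub>R (M z o\<^sub>L K z) - (cmod z)\<^sup>2 *\<^sub>R (K z o\<^sub>L K z)) v"
        by (simp add: app blinfun.bilinear_simps KD(4))
    qed
    have "norm (K z) \<le> C1 / (cmod z)\<^sup>2"
      by (rule norm_blinfun_bound) (use nK[OF z] C1 in \<open>auto simp: app\<close>)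
    also have "\<dots> \<le> C2 / (cmod z)\<^sup>2" using C12 by (intro divide_right_mono) auto
    finally show "norm (K z) \<le> C2 / (cmod z)\<^sup>2" .
    show "norm (M z) \<le> C2 / cmod z"
      by (rule norm_blinfun_bound) (use nM[OF z] C1 C12 in \<open>auto simp: app\<close>)
    fix w assume w: "w \<in> upper_sector \<phi>"
    note appw = KM_apply[OF sec(1)[OF w]]
    note diff = Q_inverse_diff[OF Kz Q_inverse_K_fun[OF sec(1)[OF w]]]
    show "K z - K w = (2 * (Re z - Re w)) *\<^sub>R (K z o\<^sub>L M w) - ((cmod z)\<^sup>2 - (cmod w)\<^sup>2) *\<^sub>R (K z o\<^sub>L K w)"
      by (rule blinfun_eqI) (simp add: app appw blinfun.bilinear_simps diff)
    show "M z - M w = (2 * (Re z - Re w)) *\<^sub>R (M z o\<^sub>L M w) - ((cmod z)\<^sup>2 - (cmod w)\<^sup>2) *\<^sub>R (M z o\<^sub>L K w)"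
    proof (rule blinfun_eqI)
      fix v
      have D1: "K_fun z u \<in> D (Suc 0)" "K_fun w u \<in> D (Suc 0)" for u
        using KD(2) Q_inverse_D(2)[OF Q_inverse_K_fun[OF sec(1)[OF w]]] by auto
      have "pow (Suc 0) (K_fun z v) - pow (Suc 0) (K_fun w v) = pow (Suc 0) (K_fun z v - K_fun w v)"
        by (simp only: pow_linear D1)
      also have "\<dots> = (2 * (Re z - Re w)) *\<^sub>R pow (Suc 0) (K_fun z (pow (Suc 0) (K_fun w v)))
          - ((cmod z)\<^sup>2 - (cmod w)\<^sup>2) *\<^sub>R pow (Suc 0) (K_fun z (K_fun w v))"
        unfolding diff by (simp only: pow_linear D_linear D1)
      finally show "blinfun_apply (M z - M w) v = blinfun_apply ((2 * (Re z - Re w)) *\<^sub>R (M z o\<^sub>L M w) - ((cmod z)\<^sup>2 - (cmod w)\<^sup>2) *\<^sub>R (M z o\<^sub>L K w)) v"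
        by (simp add: app appw blinfun.bilinear_simps)
    qed
  qed
  then show ?thesis by (rule that)
qed

end

section \<open>The functional calculus of rational functions\<close>

lemma path_pm_emb: "path_pm \<epsilon> J \<phi> t = emb J ((\<epsilon> * \<bar>t\<bar>) *\<^sub>R cis (- sgn t * \<phi>))"
  by (simp add: path_pm_def emb_cexp)

lemma vector_derivative_path_pm:
  assumes "t \<noteq> 0"
  shows "vector_derivative (path_pm \<epsilon> J \<phi>) (at t) = emb J ((\<epsilon> * sgn t) *\<^sub>R cis (- sgn t * \<phi>))"
proof (rule vector_derivative_at)
  let ?w = "emb J (\<epsilon> *\<^sub>R cis (- sgn t * \<phi>))"
  \<comment> \<open>On the half line containing \<open>t\<close> the absolute value is linear and
    the angle constant.\<close>
  define S where "S = {x :: real. sgn x = sgn t}"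
  have S: "S = (if t > 0 then {0<..} else {..<0})"
    using assms by (auto simp: S_def sgn_if)
  have "((\<lambda>x. x *\<^sub>R (sgn t *\<^sub>R ?w)) has_vector_derivative 1 *\<^sub>R (sgn t *\<^sub>R ?w)) (at t)"
    unfolding has_vector_derivative_def by (auto intro!: derivative_eq_intros)
  then have "((\<lambda>x. (x * sgn t) *\<^sub>R ?w) has_vector_derivative (1 * sgn t) *\<^sub>R ?w) (at t)"
    by simp
  then have "(path_pm \<epsilon> J \<phi> has_vector_derivative (1 * sgn t) *\<^sub>R ?w) (at t)"
  proof (rule has_vector_derivative_transform_within_open)
    show "open S" "t \<in> S" by (simp add: S) (simp add: S_def)
    show "(x * sgn t) *\<^sub>R ?w = path_pm \<epsilon> J \<phi> x" if "x \<in> S" for x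
    proof -
      have "\<bar>x\<bar> = x * sgn t" using that by (simp add: S_def abs_sgn)
      then show ?thesis using that by (simp add: path_pm_emb S_def emb_linear mult.commute)
    qed
  qed
  then show "(path_pm \<epsilon> J \<phi> has_vector_derivative emb J ((\<epsilon> * sgn t) *\<^sub>R cis (- sgn t * \<phi>))) (at t)"
    by (simp add: emb_linear mult.commute)
qed

section \<open>Pairing conjugate halves of the integration paths\<close>

definition ray_angle :: "real \<Rightarrow> real \<Rightarrow> real" where
  "ray_angle \<phi> \<epsilon> = (if \<epsilon> = 1 then \<phi> else pi - \<phi>)"

text \<open>The factor \<open>\<gamma>' J^-1 f\<close> on the half of the path in the upper half
  plane. That half is \<open>t < 0\<close> for \<open>\<epsilon> = 1\<close> and
  \<open>t > 0\<close> for \<open>\<epsilon> = -1\<close>, whence the sign.\<close>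

definition ray_coeff :: "real poly \<Rightarrow> real poly \<Rightarrow> real \<Rightarrow> real \<Rightarrow> real \<Rightarrow> complex" where
  "ray_coeff p q \<phi> \<epsilon> r = \<epsilon> *\<^sub>R (\<i> * cis (ray_angle \<phi> \<epsilon>) * ratio p q (r *\<^sub>R cis (ray_angle \<phi> \<epsilon>)))"

context bisectorial_operator
begin

definition R :: "complex \<Rightarrow> complex \<Rightarrow> ('v ^ 'n set) \<Rightarrow>\<^sub>L ('v ^ 'n set)" where
  "R c z = Re (c * cnj z) *\<^sub>R K z - Re c *\<^sub>R M z"

lemma R_cnj: "R (cnj c) (cnj z) = R c z"
  by (simp add: R_def KM_cnj)

lemma R_scaleR: "R (r *\<^sub>R c) z = r *\<^sub>R R c z" and R_minus: "R (- c) z = - R c z"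
  by (simp_all add: R_def algebra_simps)

text \<open>Only the real coordinates of \<open>emb J c\<close> pass through \<open>K\<close> and
  \<open>T\<close>. The unit \<open>J\<close> stays as a factor on the right, and its coefficient is
  the imaginary part, written as the real part of \<open>- \<i> c\<close>.\<close>

lemma left_S_resolvent_lmul:
  assumes z: "z \<notin> closed_sector \<omega>" and J: "J \<in> sphere_units"
  shows "left_S_resolvent (emb J z) T (lmul (emb J c) v) = blinfun_apply (R c z + (R (- \<i> * c) z o\<^sub>L Blinfun (lmul J))) v"
proof -
  interpret K: bounded_linear "K_fun z" by (rule resolvent(1)[OF z])
  have M: "bounded_linear (\<lambda>v. pow (Suc 0) (K_fun z v))" using Q_inverse_K_fun[OF z] by (simp add: Q_inverse_def)
  interpret M: bounded_linear "\<lambda>v. pow (Suc 0) (K_fun z v)" by (rule M)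
  have "left_S_resolvent (emb J z) T (lmul (emb J c) v) = K_fun z (lmul (emb J (cnj z * c)) v) - pow (Suc 0) (K_fun z (lmul (emb J c) v))"
    unfolding resolvent(5)[OF z J] by (simp only: lmul_mult[symmetric] emb_mult[OF J])
  also have "\<dots> = (Re (cnj z * c) *\<^sub>R K_fun z v + Im (cnj z * c) *\<^sub>R K_fun z (lmul J v)) -
      (Re c *\<^sub>R pow (Suc 0) (K_fun z v) + Im c *\<^sub>R pow (Suc 0) (K_fun z (lmul J v)))"
    by (simp only: lmul_emb M.add M.scaleR) (simp only: K.add K.scaleR)
  also have "\<dots> = (Re (c * cnj z) *\<^sub>R K_fun z v - Re c *\<^sub>R pow (Suc 0) (K_fun z v)) +
      (Re (- \<i> * c * cnj z) *\<^sub>R K_fun z (lmul J v) - Re (- \<i> * c) *\<^sub>R pow (Suc 0) (K_fun z (lmul J v)))"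
  proof -
    have "Re (c * cnj z) = Re (cnj z * c)" "Re (- \<i> * c * cnj z) = Im (cnj z * c)" "Re (- \<i> * c) = Im c"
      by (simp_all add: algebra_simps)
    then show ?thesis by (simp only: add_diff_add)
  qed
  also have "\<dots> = blinfun_apply (R c z + (R (- \<i> * c) z o\<^sub>L Blinfun (lmul J))) v"
    by (simp only: R_def blinfun.add_left blinfun.diff_left blinfun.scaleR_left blinfun_apply_blinfun_compose
      KM_apply[OF z] bounded_linear_Blinfun_apply[OF bounded_linear_lmul])
  finally show ?thesis .
qed

text \<open>The two halves \<open>t > 0\<close> and \<open>t < 0\<close> of a path are conjugate to each other, so the terms with
  left multiplication by \<open>J\<close> cancel in the integral.\<close>

lemma calculus_integrand_eq:
  fixes p q :: "real poly" and J :: "'n clifford" and \<phi> \<epsilon> t :: real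
  assumes \<phi>: "\<phi> \<in> {\<omega><..<pi/2}" and J: "J \<in> sphere_units" and \<epsilon>: "\<epsilon> \<in> {1, -1}" and t: "t \<noteq> 0"
  defines "z \<equiv> \<bar>t\<bar> *\<^sub>R cis (ray_angle \<phi> \<epsilon>)" and "c \<equiv> ray_coeff p q \<phi> \<epsilon> \<bar>t\<bar>"
  shows "calculus_integrand T (cl_quotient p q) J \<phi> \<epsilon> t =
    R c z - (\<epsilon> * sgn t) *\<^sub>R (R (- \<i> * c) z o\<^sub>L Blinfun (lmul J))"
proof -
  define w where "w = (\<epsilon> * \<bar>t\<bar>) *\<^sub>R cis (- sgn t * \<phi>)"
  define d where "d = (\<epsilon> * sgn t) *\<^sub>R cis (- sgn t * \<phi>) * inverse \<i> * ratio p q w"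
  have \<phi>': "\<phi> \<in> {0<..<pi/2}" using \<phi> \<omega> by auto
  have "z \<in> upper_sector \<phi>"
    unfolding z_def ray_angle_def using t \<phi>' by auto
  then have z: "z \<notin> closed_sector \<omega>"
    using upper_sector_not_sector[OF \<phi>'] \<phi> \<omega> by auto
  have sg: "\<epsilon> * sgn t = 1 \<or> \<epsilon> * sgn t = -1" using \<epsilon> t by (auto simp: sgn_if)
  have inv: "inverse \<i> = - \<i>" by simp
  have neg: "w = z" "d = c" if "\<epsilon> * sgn t = -1"
  proof -
    have *: "\<epsilon> = 1 \<and> t < 0 \<or> \<epsilon> = -1 \<and> t > 0" using that \<epsilon> t by (auto simp: sgn_if split: if_splits)
    then show wz: "w = z"
      by (auto simp: w_def z_def ray_angle_def complex_eq_iff)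
    from * show "d = c"
      unfolding d_def c_def ray_coeff_def z_def[symmetric] inv wz
      by (auto simp: ray_angle_def complex_eq_iff)
  qed
  have pos: "w = cnj z" "d = cnj c" if "\<epsilon> * sgn t = 1"
  proof -
    have *: "\<epsilon> = 1 \<and> t > 0 \<or> \<epsilon> = -1 \<and> t < 0" using that \<epsilon> t by (auto simp: sgn_if split: if_splits)
    then show wz: "w = cnj z"
      by (auto simp: w_def z_def ray_angle_def complex_eq_iff)
    have "ratio p q w = cnj (ratio p q z)" unfolding wz by (rule ratio_cnj)
    with * show "d = cnj c"
      unfolding d_def c_def ray_coeff_def z_def[symmetric] inv
      by (auto simp: ray_angle_def complex_eq_iff)
  qed
  have w: "w \<notin> closed_sector \<omega>"
    using sg pos(1) neg(1) z by (auto simp: closed_sector_def)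
  have "vector_derivative (path_pm \<epsilon> J \<phi>) (at t) * pinv J * cl_quotient p q (path_pm \<epsilon> J \<phi> t) = emb J d"
    unfolding vector_derivative_path_pm[OF t] path_pm_emb w_def[symmetric] cl_quotient_emb[OF J]
    using pinv_emb[OF J, of \<i>] by (simp only: d_def emb_mult[OF J] emb_simps)
  then have "calculus_integrand T (cl_quotient p q) J \<phi> \<epsilon> t = Blinfun (blinfun_apply (R d w + (R (- \<i> * d) w o\<^sub>L Blinfun (lmul J))))"
    unfolding calculus_integrand_def by (simp only: path_pm_emb w_def[symmetric] left_S_resolvent_lmul[OF w J])
  also have "\<dots> = R d w + (R (- \<i> * d) w o\<^sub>L Blinfun (lmul J))"
    by (rule blinfun_apply_inverse)
  also have "\<dots> = R c z - (\<epsilon> * sgn t) *\<^sub>R (R (- \<i> * c) z o\<^sub>L Blinfun (lmul J))"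
    using sg
  proof
    assume 1: "\<epsilon> * sgn t = -1"
    then show ?thesis using neg by simp
  next
    assume 1: "\<epsilon> * sgn t = 1"
    \<comment> \<open>\<open>- \<i>\<close> is not conjugated together with \<open>c\<close>, which
      flips the sign of the \<open>J\<close>-term on the conjugate half.\<close>
    have "- \<i> * cnj c = cnj (- (- \<i> * c))" by simp
    then have "R (- \<i> * cnj c) (cnj z) = - R (- \<i> * c) z" by (simp only: R_cnj R_minus)
    then show ?thesis using pos[OF 1] 1 by (simp add: R_cnj blinfun_compose_simps)
  qed
  finally show ?thesis .
qed

lemma calculus_ratio:
  assumes deg: "degree p < degree q" and p0: "coeff p 0 = 0"
    and \<theta>: "\<theta> \<in> {\<omega><..<pi/2}" and nz: "\<forall>z\<in>closed_sector \<theta>. cpoly q z \<noteq> 0"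
    and E: "\<And>v. E v \<in> D (degree q)" "\<And>v. poly_at q (E v) = v" "\<And>j. j \<le> degree q \<Longrightarrow> bounded_linear (\<lambda>v. pow j (E v))"
    and \<phi>: "\<phi> \<in> {\<omega><..<\<theta>}" and J: "J \<in> sphere_units"
  shows "calculus_convergent T (cl_quotient p q) J \<phi>"
    and "calculus T (cl_quotient p q) J \<phi> = Some \<circ> (\<lambda>v. poly_at p (E v))"
proof -
  have \<phi>1: "\<phi> \<in> {\<omega><..<pi/2}" and \<phi>2: "\<phi> \<in> {0<..<pi/2}" and \<theta>': "\<theta> \<in> {0<..<pi/2}" using \<phi> \<theta> \<omega> by auto
  obtain C where "sector_resolvent \<phi> C K M" using sector_resolvent_KM[OF \<phi>1] .
  then interpret S: sector_resolvent \<phi> C K M .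
  have P: "S.P = R" by (simp add: fun_eq_iff S.P_def R_def)
  define m where "m = degree q"
  define B where "B k = Blinfun (\<lambda>v. pow k (E v))" for k
  have B: "blinfun_apply (B k) v = pow k (E v)" if "k \<le> m" for k v
    unfolding B_def using E(3)[of k] that by (simp add: bounded_linear_Blinfun_apply m_def)
  define A where "A = (\<Sum>i\<le>m. coeff p i *\<^sub>R B i)"
  have A: "blinfun_apply A v = poly_at p (E v)" for v
    using deg by (simp add: A_def blinfun.bilinear_simps blinfun.sum_left B poly_at_upto[of p m] m_def)
  have q: "(\<Sum>i\<le>m. coeff q i *\<^sub>R B i) = id_blinfun"
  proof (rule blinfun_eqI)
    fix v
    have "blinfun_apply (\<Sum>i\<le>m. coeff q i *\<^sub>R B i) v = poly_at q (E v)"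
      by (simp add: blinfun.bilinear_simps blinfun.sum_left B poly_at_def m_def)
    then show "blinfun_apply (\<Sum>i\<le>m. coeff q i *\<^sub>R B i) v = blinfun_apply id_blinfun v" by (simp add: E)
  qed
  \<comment> \<open>The identity behind it is \<open>K (|z|^2 - 2 Re z T + T^2) = 1\<close>, applied
    to \<open>u = T^k E v\<close>, which lies in the domain of \<open>T\<close> because
    \<open>k < m\<close>.\<close>
  have moments: "S.moments m B"
    unfolding S.moments_def
  proof (intro allI ballI impI blinfun_eqI)
    fix c z k v assume z: "z \<in> upper_sector \<phi>" and k: "k < m"
    have zs: "z \<notin> closed_sector \<omega>" using upper_sector_not_sector(5)[OF \<phi>2 z] \<phi> \<omega> by auto
    note app = KM_apply[OF zs]
    note KD = Q_inverse_D[OF Q_inverse_K_fun[OF zs]] and comm = Q_inverse_commute[OF Q_inverse_K_fun[OF zs]]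
    define u where "u = pow k (E v)"
    have "E v \<in> D (Suc k)" using D_antimono[OF E(1)] k by (simp add: m_def)
    then have u: "u \<in> D (Suc 0)" "pow (Suc k) (E v) = pow (Suc 0) u"
      using D_Suc[of "E v" k] pow_Suc[of "E v" k] by (auto simp: u_def)
    have 1: "K_fun z (pow (Suc 0) u) = pow (Suc 0) (K_fun z u)" using comm(2)[OF u(1)] by simp
    have "pow (Suc 0) (K_fun z (pow (Suc 0) u)) = pow 2 (K_fun z u)"
      unfolding 1 using pow_plus[of "K_fun z u" "Suc 0" "Suc 0"] KD(1) by (simp add: numeral_2_eq_2)
    then have 2: "pow (Suc 0) (K_fun z (pow (Suc 0) u)) = u + (2 * Re z) *\<^sub>R pow (Suc 0) (K_fun z u) - (cmod z)\<^sup>2 *\<^sub>R K_fun z u"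
      by (simp only: KD(4))
    have 3: "Re (c * z * cnj z) = Re c * (cmod z)\<^sup>2" "Re (c * cnj z) = 2 * Re z * Re c - Re (c * z)"
      by (simp_all add: cmod_power2) (simp add: algebra_simps power2_eq_square)
    have "blinfun_apply (S.P (c * z) z o\<^sub>L B k) v = (Re c * (cmod z)\<^sup>2) *\<^sub>R K_fun z u - Re (c * z) *\<^sub>R pow (Suc 0) (K_fun z u)"
      unfolding S.P_def 3(1) using k by (simp add: blinfun.bilinear_simps app B u_def del: times_complex.simps)
    also have "\<dots> = (2 * Re z * Re c - Re (c * z)) *\<^sub>R K_fun z (pow (Suc 0) u)
        - Re c *\<^sub>R pow (Suc 0) (K_fun z (pow (Suc 0) u)) + Re c *\<^sub>R u"
      unfolding 2 unfolding 1 by (simp add: algebra_simps del: times_complex.simps)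
    also have "\<dots> = blinfun_apply ((S.P c z o\<^sub>L B (Suc k)) + Re c *\<^sub>R B k) v"
      unfolding S.P_def 3(2) using k by (simp add: blinfun.bilinear_simps app B u(2) u_def[symmetric] del: times_complex.simps)
    finally show "blinfun_apply (S.P (c * z) z o\<^sub>L B k) v = blinfun_apply ((S.P c z o\<^sub>L B (Suc k)) + Re c *\<^sub>R B k) v" .
  qed
  have nzr: "cpoly q (r *\<^sub>R cis \<psi>) \<noteq> 0" "r *\<^sub>R cis \<psi> \<in> closed_sector \<theta>" if "r > 0" "\<psi> \<in> {0..\<phi>} \<union> {pi - \<phi>..pi}" for r \<psi>
  proof -
    have "\<psi> \<in> angles \<theta>" using that(2) \<phi> \<theta> \<omega> by (auto simp: angles_def)
    then show "r *\<^sub>R cis \<psi> \<in> closed_sector \<theta>"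
      using cis_angles_in_sector[OF \<theta>' _ that(1)] sector_subset_closed_sector by blast
    then show "cpoly q (r *\<^sub>R cis \<psi>) \<noteq> 0" using nz by blast
  qed
  have lim: "(\<lambda>n. integral {inverse (real (Suc n))..real (Suc n)} (S.cauchy_integrand p q (pi - \<phi>)) -
      integral {inverse (real (Suc n))..real (Suc n)} (S.cauchy_integrand p q \<phi>)) \<longlonglongrightarrow> pi *\<^sub>R A"
    unfolding A_def
  proof (rule S.cauchy_integral[OF moments deg _ q])
    show "cpoly q 0 \<noteq> 0" using nz by (simp add: closed_sector_def)
    show "cpoly p 0 = 0" by (simp add: cpoly_at_0 p0)
  qed (use nzr in \<open>auto simp: m_def\<close>)
  obtain b where b: "b \<ge> 0" "\<And>z. z \<in> closed_sector \<theta> \<Longrightarrow> cmod (ratio p q z) \<le> b * cmod z / (1 + (cmod z)\<^sup>2)"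
    by (rule ratio_sector_bound[OF deg p0 nz]) blast
  define L where "L = (Blinfun (lmul J) :: ('v ^ 'n set) \<Rightarrow>\<^sub>L ('v ^ 'n set))"
  let ?f = "calculus_integrand T (cl_quotient p q) J \<phi>"
  define c where "c = ray_coeff p q \<phi>"
  define z where "z \<epsilon> r = r *\<^sub>R cis (ray_angle \<phi> \<epsilon>)" for \<epsilon> r :: real
  have f_eq: "?f \<epsilon> t = R (c \<epsilon> \<bar>t\<bar>) (z \<epsilon> \<bar>t\<bar>) - (\<epsilon> * sgn t) *\<^sub>R (R (- \<i> * c \<epsilon> \<bar>t\<bar>) (z \<epsilon> \<bar>t\<bar>) o\<^sub>L L)"
    if "\<epsilon> \<in> {1, -1}" "t \<noteq> 0" for \<epsilon> t
    unfolding c_def z_def L_def by (rule calculus_integrand_eq[OF \<phi>1 J that])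
  have zu: "z \<epsilon> r \<in> upper_sector \<phi>" "z \<epsilon> r \<in> closed_sector \<theta>" "cpoly q (z \<epsilon> r) \<noteq> 0" "cmod (z \<epsilon> r) = r"
    if "r > 0" for \<epsilon> r
    using that \<phi>2 nzr[OF that, of "ray_angle \<phi> \<epsilon>"] by (auto simp: z_def ray_angle_def norm_mult)
  have cbound: "cmod (c \<epsilon> r) \<le> b * r / (1 + r\<^sup>2)" if "r > 0" "\<epsilon> \<in> {1, -1}" for \<epsilon> r
    using b(2)[OF zu(2)[OF that(1)], of \<epsilon>] that(2) zu(4)[OF that(1), of \<epsilon>] unfolding c_def ray_coeff_def z_def[symmetric]
    by (auto simp: norm_mult)
  have Rbound: "norm (R d (z \<epsilon> r)) \<le> 2 * \<bar>C\<bar> * b / (1 + r\<^sup>2)" if "r > 0" "cmod d \<le> b * r / (1 + r\<^sup>2)" for d \<epsilon> r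
  proof -
    have "norm (R d (z \<epsilon> r)) \<le> 2 * C * cmod d / r"
      using S.norm_P[OF zu(1)[OF that(1)], of d \<epsilon>] zu(4)[OF that(1), of \<epsilon>] by (simp add: P)
    also have "\<dots> \<le> 2 * \<bar>C\<bar> * (b * r / (1 + r\<^sup>2)) / r"
      by (rule divide_right_mono, rule mult_mono) (use that in auto)
    also have "\<dots> = 2 * \<bar>C\<bar> * b / (1 + r\<^sup>2)" using that(1) by simp
    finally show ?thesis .
  qed
  \<comment> \<open>The coefficient is at most \<open>b r / (1 + r^2)\<close> and \<open>R\<close>
    costs a factor \<open>1 / r\<close>; what remains is integrable at both ends.\<close>
  have bound: "norm (?f \<epsilon> t) \<le> 2 * \<bar>C\<bar> * b * (1 + norm L) / (1 + t\<^sup>2)" if "\<epsilon> \<in> {1, -1}" "t \<noteq> 0" for \<epsilon> t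
  proof -
    have t: "\<bar>t\<bar> > 0" using that by simp
    have "norm (?f \<epsilon> t) \<le> norm (R (c \<epsilon> \<bar>t\<bar>) (z \<epsilon> \<bar>t\<bar>)) + norm ((\<epsilon> * sgn t) *\<^sub>R (R (- \<i> * c \<epsilon> \<bar>t\<bar>) (z \<epsilon> \<bar>t\<bar>) o\<^sub>L L))"
      unfolding f_eq[OF that] by (rule norm_triangle_ineq4)
    also have "norm ((\<epsilon> * sgn t) *\<^sub>R (R (- \<i> * c \<epsilon> \<bar>t\<bar>) (z \<epsilon> \<bar>t\<bar>) o\<^sub>L L)) \<le> norm (R (- \<i> * c \<epsilon> \<bar>t\<bar>) (z \<epsilon> \<bar>t\<bar>)) * norm L"
      using that norm_blinfun_compose by (auto simp: abs_mult abs_sgn_eq)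
    also have "norm (R (c \<epsilon> \<bar>t\<bar>) (z \<epsilon> \<bar>t\<bar>)) + norm (R (- \<i> * c \<epsilon> \<bar>t\<bar>) (z \<epsilon> \<bar>t\<bar>)) * norm L
        \<le> 2 * \<bar>C\<bar> * b / (1 + \<bar>t\<bar>\<^sup>2) + 2 * \<bar>C\<bar> * b / (1 + \<bar>t\<bar>\<^sup>2) * norm L"
      by (intro add_mono mult_right_mono Rbound t) (use cbound[OF t that(1)] in \<open>auto simp: norm_mult\<close>)
    also have "\<dots> = 2 * \<bar>C\<bar> * b * (1 + norm L) / (1 + t\<^sup>2)" by (simp add: algebra_simps add_divide_distrib)
    finally show ?thesis by simp
  qed
  have cont: "continuous_on (- {0}) (?f \<epsilon>)" if \<epsilon>: "\<epsilon> \<in> {1, -1}" for \<epsilon>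
  proof -
    have c1: "continuous_on S (\<lambda>t. c \<epsilon> \<bar>t\<bar>)" and z1: "continuous_on S (\<lambda>t. z \<epsilon> \<bar>t\<bar>)" if "0 \<notin> S" for S
    proof -
      show z1: "continuous_on S (\<lambda>t. z \<epsilon> \<bar>t\<bar>)" unfolding z_def by (intro continuous_intros)
      have "cpoly q (z \<epsilon> \<bar>t\<bar>) \<noteq> 0" if "t \<in> S" for t using zu(3)[of "\<bar>t\<bar>" \<epsilon>] that \<open>0 \<notin> S\<close> by (cases "t = 0") auto
      then show "continuous_on S (\<lambda>t. c \<epsilon> \<bar>t\<bar>)"
        unfolding c_def ray_coeff_def z_def[symmetric] by (intro continuous_intros continuous_ratio z1)
    qed
    \<comment> \<open>Continuity is shown on each half line separately, since \<open>sgn t\<close>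
      jumps at 0.\<close>
    have c2: "continuous_on S (?f \<epsilon>)" if "\<And>t. t \<in> S \<Longrightarrow> sgn t = \<sigma>" "\<sigma> \<noteq> 0" for S \<sigma>
    proof -
      have S0: "0 \<notin> S" using that by (metis sgn_0)
      have "(\<lambda>t. z \<epsilon> \<bar>t\<bar>) ` S \<subseteq> upper_sector \<phi>"
      proof (rule image_subsetI)
        fix t assume "t \<in> S"
        then have "\<bar>t\<bar> > 0" using S0 by (metis zero_less_abs_iff)
        then show "z \<epsilon> \<bar>t\<bar> \<in> upper_sector \<phi>" by (rule zu(1))
      qed
      then have "continuous_on S (\<lambda>t. R (c \<epsilon> \<bar>t\<bar>) (z \<epsilon> \<bar>t\<bar>) - (\<epsilon> * \<sigma>) *\<^sub>R (R (- \<i> * c \<epsilon> \<bar>t\<bar>) (z \<epsilon> \<bar>t\<bar>) o\<^sub>L L))"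
        unfolding P[symmetric] by (intro continuous_intros S.continuous_P c1 z1 S0)
      then show ?thesis
      proof (rule continuous_on_eq)
        fix t assume t: "t \<in> S"
        then have "t \<noteq> 0" using S0 by metis
        from f_eq[OF \<epsilon> this]
        show "R (c \<epsilon> \<bar>t\<bar>) (z \<epsilon> \<bar>t\<bar>) - (\<epsilon> * \<sigma>) *\<^sub>R (R (- \<i> * c \<epsilon> \<bar>t\<bar>) (z \<epsilon> \<bar>t\<bar>) o\<^sub>L L) = ?f \<epsilon> t"
          by (simp only: that(1)[OF t])
      qed
    qed
    have "continuous_on ({0<..} \<union> {..<0}) (?f \<epsilon>)"
      by (intro continuous_on_open_Un c2[of _ 1] c2[of _ "-1"]) auto
    moreover have "{0<..} \<union> {..<0} = - {0 :: real}" by auto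
    ultimately show ?thesis by simp
  qed
  have conv: "?f \<epsilon> integrable_on UNIV" "(\<lambda>t. norm (?f \<epsilon> t)) integrable_on UNIV"
    "(\<lambda>n. integral {inverse (real (Suc n))..real (Suc n)} (\<lambda>t. ?f \<epsilon> t + ?f \<epsilon> (- t))) \<longlonglongrightarrow> integral UNIV (?f \<epsilon>)"
    if "\<epsilon> \<in> {1, -1}" for \<epsilon>
    using arctan_dominated_integral[OF cont[OF that] bound[OF that]]
      arctan_dominated_integral(1)[OF continuous_on_norm[OF cont[OF that]], of "2 * \<bar>C\<bar> * b * (1 + norm L)"] bound[OF that]
    by auto
  then show "calculus_convergent T (cl_quotient p q) J \<phi>"
    by (simp add: calculus_convergent_def)
  \<comment> \<open>The \<open>J\<close>-terms are odd in \<open>t\<close> and cancel; the even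
    parts double.\<close>
  have pair: "?f \<epsilon> t + ?f \<epsilon> (- t) = (- 2 * \<epsilon>) *\<^sub>R S.cauchy_integrand p q (ray_angle \<phi> \<epsilon>) t" if "\<epsilon> \<in> {1, -1}" "t > 0" for \<epsilon> t
  proof -
    have "c \<epsilon> t = - (\<epsilon> *\<^sub>R (- \<i> * cis (ray_angle \<phi> \<epsilon>) * ratio p q (z \<epsilon> t)))"
      by (simp add: c_def ray_coeff_def z_def)
    then have "R (c \<epsilon> t) (z \<epsilon> t) = (- \<epsilon>) *\<^sub>R S.cauchy_integrand p q (ray_angle \<phi> \<epsilon>) t"
      by (simp only: R_minus R_scaleR S.cauchy_integrand_def P z_def scaleR_minus_left)
    moreover have "?f \<epsilon> t + ?f \<epsilon> (- t) = 2 *\<^sub>R R (c \<epsilon> t) (z \<epsilon> t)"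
      using that by (simp add: f_eq scaleR_2)
    ultimately show ?thesis by simp
  qed
  have int_pair: "integral {inverse (real (Suc n))..real (Suc n)} (\<lambda>t. ?f \<epsilon> t + ?f \<epsilon> (- t)) =
      (- 2 * \<epsilon>) *\<^sub>R integral {inverse (real (Suc n))..real (Suc n)} (S.cauchy_integrand p q (ray_angle \<phi> \<epsilon>))"
    if "\<epsilon> \<in> {1, -1}" for \<epsilon> n
  proof -
    have "integral {inverse (real (Suc n))..real (Suc n)} (\<lambda>t. ?f \<epsilon> t + ?f \<epsilon> (- t)) =
      integral {inverse (real (Suc n))..real (Suc n)} (\<lambda>t. (- 2 * \<epsilon>) *\<^sub>R S.cauchy_integrand p q (ray_angle \<phi> \<epsilon>) t)"
    proof (rule integral_cong)
      fix t assume t: "t \<in> {inverse (real (Suc n))..real (Suc n)}"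
      have "0 < inverse (real (Suc n))" by simp
      with t have "t > 0" by (simp only: atLeastAtMost_iff) linarith
      then show "?f \<epsilon> t + ?f \<epsilon> (- t) = (- 2 * \<epsilon>) *\<^sub>R S.cauchy_integrand p q (ray_angle \<phi> \<epsilon>) t" by (rule pair[OF that])
    qed
    then show ?thesis by simp
  qed
  have "(\<lambda>n. 2 *\<^sub>R (integral {inverse (real (Suc n))..real (Suc n)} (S.cauchy_integrand p q (pi - \<phi>)) -
      integral {inverse (real (Suc n))..real (Suc n)} (S.cauchy_integrand p q \<phi>))) \<longlonglongrightarrow> integral UNIV (?f 1) + integral UNIV (?f (-1))"
    using tendsto_add[OF conv(3)[of 1] conv(3)[of "-1"]]
    by (simp add: int_pair ray_angle_def scaleR_diff_right del: of_nat_Suc)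
  moreover have "(\<lambda>n. 2 *\<^sub>R (integral {inverse (real (Suc n))..real (Suc n)} (S.cauchy_integrand p q (pi - \<phi>)) -
      integral {inverse (real (Suc n))..real (Suc n)} (S.cauchy_integrand p q \<phi>))) \<longlonglongrightarrow> 2 *\<^sub>R (pi *\<^sub>R A)"
    by (intro tendsto_scaleR tendsto_const lim)
  ultimately have "integral UNIV (?f 1) + integral UNIV (?f (-1)) = 2 *\<^sub>R (pi *\<^sub>R A)"
    by (rule LIMSEQ_unique)
  then have "(1 / (2 * pi)) *\<^sub>R (\<Sum>\<epsilon>\<in>{1, -1}. integral UNIV (?f \<epsilon>)) = A"
    by simp
  then show "calculus T (cl_quotient p q) J \<phi> = Some \<circ> (\<lambda>v. poly_at p (E v))"
    unfolding calculus_def using A by (simp add: fun_eq_iff)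
qed

end

theorem theorem3p16:
  fixes T :: "('v::banach, 'n::{finite,linorder}) op"
    and \<omega> :: real and p q :: "real poly"
  assumes "\<omega> \<in> {0<..<pi/2}"
    and "T \<in> closed_ops" and "bisectorial \<omega> T"
    and "p \<noteq> 0" and "q \<noteq> 0"
    and "degree q \<ge> degree p + 1"
    and "cl_poly p (0 :: 'n clifford) = 0"
    and "\<forall>s \<in> closure (double_sector \<omega> :: 'n clifford set). cl_poly q s \<noteq> 0"
  shows "inj_on (op_poly q T) (dom (op_poly q T)) \<and> ran (op_poly q T) = UNIV \<and>
    (\<exists>\<theta>\<in>{\<omega><..<pi/2}.
       (\<forall>s \<in> (double_sector \<theta> :: 'n clifford set). cl_poly q s \<noteq> 0) \<and>
       (cl_quotient p q :: 'n clifford \<Rightarrow> 'n clifford) \<in> N0 \<theta> \<and>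
       (\<forall>\<phi>\<in>{\<omega><..<\<theta>}. \<forall>J\<in>sphere_units.
          calculus_convergent T (cl_quotient p q) J \<phi> \<and>
          calculus T (cl_quotient p q) J \<phi> = op_poly p T \<circ>\<^sub>m op_inv (op_poly q T)))"
proof -
  interpret bisectorial_operator T \<omega>
    using assms by unfold_locales (auto simp: closed_ops_def)
  define J0 :: "'n clifford" where "J0 = gen undefined"
  have J0: "J0 \<in> sphere_units" unfolding J0_def by (rule sphere_units_nonempty)
  have deg: "degree p < degree q" using assms(6) by simp
  have p0: "coeff p 0 = 0"
    using assms(7) cl_poly_emb[OF J0, of p 0] emb_eq_0_iff[OF J0] by (simp add: cpoly_at_0)
  have nz\<omega>: "\<forall>z\<in>closed_sector \<omega>. cpoly q z \<noteq> 0"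
  proof
    fix z assume "z \<in> closed_sector \<omega>"
    then have "cl_poly q (emb J0 z) \<noteq> 0" using closure_double_sector[OF assms(1) J0] assms(8) by blast
    then show "cpoly q z \<noteq> 0" by (simp add: cl_poly_emb J0 emb_eq_0_iff)
  qed
  have "Im z \<noteq> 0 \<and> (\<exists>K. Q_inverse z K)" if "cpoly q z = 0" for z
  proof -
    have z: "z \<notin> closed_sector \<omega>" using that nz\<omega> by blast
    \<comment> \<open>The real line lies in the closed sector, so no zero of \<open>q\<close> is
      real.\<close>
    have "0 \<le> tan \<omega> * \<bar>Re z\<bar>" using tan_gt_zero[of \<omega>] assms(1) by simp
    then have "Im z \<noteq> 0" using z by (auto simp: closed_sector_def)
    then show ?thesis using Q_inverse_K_fun[OF z] by blast
  qed
  from poly_inverse[OF assms(5) this] obtain E where E: "\<And>v. E v \<in> D (degree q)" "\<And>v. poly_at q (E v) = v"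
      "\<And>v. v \<in> D (degree q) \<Longrightarrow> E (poly_at q v) = v" "\<And>j. j \<le> degree q \<Longrightarrow> bounded_linear (\<lambda>v. pow j (E v))"
    by blast
  \<comment> \<open>The graph of \<open>q[T]\<close> is the transposed graph of the total map
    \<open>E\<close>; injectivity, surjectivity and the inverse are all read off from this.\<close>
  have op_q: "op_poly q T x = Some y \<longleftrightarrow> x = E y" for x y
    using E by (auto simp: op_poly_eq)
  have inj: "inj_on (op_poly q T) (dom (op_poly q T))"
    by (rule inj_onI) (auto simp: op_q)
  have ran: "ran (op_poly q T) = UNIV"
    by (auto simp: ran_def op_q)
  have "op_inv (op_poly q T) = Some \<circ> E"
    by (auto simp: fun_eq_iff op_inv_def ran op_q)
  then have comp: "op_poly p T \<circ>\<^sub>m op_inv (op_poly q T) = Some \<circ> (\<lambda>v. poly_at p (E v))"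
    using D_antimono[OF E(1), of "degree p"] deg by (auto simp: fun_eq_iff map_comp_def op_poly_eq)
  \<comment> \<open>Freedom from zeros on the closed sector, not just the open one, provides the
    compactness behind the uniform bound on the ratio.\<close>
  obtain \<theta> where \<theta>: "\<theta> \<in> {\<omega><..<pi/2}" and nz: "\<forall>z\<in>closed_sector \<theta>. cpoly q z \<noteq> 0"
    using zero_free_larger_sector[OF assms(1,5) nz\<omega>] .
  have \<theta>': "\<theta> \<in> {0<..<pi/2}" using \<theta> assms(1) by auto
  have "cl_poly q s \<noteq> 0" if s: "s \<in> double_sector \<theta>" for s :: "'n clifford"
  proof -
    have "s \<in> paravectors" using s unfolding double_sector_eq(1)[OF \<theta>'] by blast
    then obtain J z where Jz: "J \<in> sphere_units" "s = emb J z" by (rule paravectors_emb)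
    then have "z \<in> closed_sector \<theta>" using s double_sector_eq(2)[OF \<theta>'] sector_subset_closed_sector by blast
    then show ?thesis using nz Jz by (simp add: cl_poly_emb emb_eq_0_iff)
  qed
  moreover have "(cl_quotient p q :: 'n clifford \<Rightarrow> 'n clifford) \<in> N0 \<theta>"
    by (rule cl_quotient_N0[OF \<theta>' deg p0 nz])
  ultimately show ?thesis
    unfolding comp using inj ran \<theta> calculus_ratio[OF deg p0 \<theta> nz E(1,2,4)] by blast
qed

end
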